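(* Assume $A$ is associative. Fix a domain $G$ in the hypercomplex subspace $M$ of $A$ and a function $\phi:G\to A$ that is left-monogenic with respect to $\mathcal{B}$. In every open ball $B^{m+1}(p,R)$ contained in $G$, the following series expansion is valid: \[\phi(x)=\sum_{k\in\mathbb{N}}\ \sum_{|\mathbf{k}|=k}\mathcal{P}_{\mathbf{k}}^{\mathcal{B}}(x-p)\,a_{\mathbf{k}},\qquad a_{\mathbf{k}}=\frac{1}{\mathbf{k}!}\nabla_{\mathcal{B}}^{(0,\mathbf{k})}\phi(p),\] where $\mathbf{k}$ ranges over $\mathbb{N}^m$. Here the series (indexed by $k$) converges normally in $B^{m+1}(p,R)$, because \[\max_{\|x-p\|\le r_1}\Big\|\sum_{|\mathbf{k}|=k}\mathcal{P}_{\mathbf{k}}^{\mathcal{B}}(x-p)\,a_{\mathbf{k}}\Big\|\le\omega^2\,\sqrt{2}\,\binom{k+m}{m}\left(\frac{r_1}{r_2}\right)^k\max_{\|y-p\|=r_2}\|\phi(y)\|\] for all $k\in\mathbb{N}$ whenever $0<r_1<r_2<R$ (with $x,y\in M$).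
   Context: $\mathbb{N}$ includes $0$. $A$ is a finite-dimensional (unital) real $*$-algebra: a finite-dimensional real vector space with an $\mathbb{R}$-bilinear multiplication (here associative) and an involutive real-linear antiautomorphism $x\mapsto x^c$; $\mathbb{R}$ is identified with $\mathbb{R}1$. Set $t(x)=x+x^c$, $n(x)=xx^c$, $\mathbb{S}_A=\{x\in A:t(x)=0,\ n(x)=1\}$, assumed nonempty, and $Q_A=\bigcup_{J\in\mathbb{S}_A}(\mathbb{R}+J\mathbb{R})$. A hypercomplex subspace of $A$ is a real vector subspace $M$ with $\mathbb{R}\subsetneq M\subseteq Q_A$; a hypercomplex basis of $M$ is an ordered real basis $(v_0,\ldots,v_m)$ with $m\ge1$, $v_0=1$, $v_s\in\mathbb{S}_A$ and $v_sv_u=-v_uv_s$ for distinct $s,u\in\{1,\ldots,m\}$. Setting. $M$ is a hypercomplex subspace of $A$ with a fixed hypercomplex basis $\mathcal{B}=(v_0,\ldots,v_m)$, completed to a real basis $\mathcal{B}'=(v_0,\ldots,v_d)$ of $A$; $\|\cdot\|$ is the Euclidean norm on $A$ making $\mathcal{B}'$ orthonormal. $\omega:=\max\{\|uv\|:u\in M,\ v\in A,\ \|u\|=1=\|v\|\}$. Points of $M$ are written $x=\sum_{s=0}^mx_sv_s$. A domain is a nonempty connected open subset; $B^{m+1}(p,R)=\{x\in M:\|x-p\|<R\}$, with $p\in M$, $R>0$. For a $\mathscr{C}^1$ function $\phi:G\to A$: $\partial_s\phi(x)=\lim_{\mathbb{R}\ni\varepsilon\to0}\varepsilon^{-1}(\phi(x+\varepsilon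 v_s)-\phi(x))$ and $\overline{\partial}_{\mathcal{B}}\phi=\sum_{s=0}^mv_s\,\partial_s\phi$; $\phi$ is left-monogenic with respect to $\mathcal{B}$ if it is $\mathscr{C}^1$ and $\overline{\partial}_{\mathcal{B}}\phi\equiv0$ (such functions are real analytic). For $\mathbf{h}\in\mathbb{N}^{m+1}$: $\nabla_{\mathcal{B}}^{\mathbf{h}}\phi=\partial_0^{h_0}\partial_1^{h_1}\cdots\partial_m^{h_m}\phi$. For $\mathbf{k}=(k_1,\ldots,k_m)$: $|\mathbf{k}|=\sum_sk_s$, $\mathbf{k}!=\prod_sk_s!$; $\epsilon_1,\ldots,\epsilon_m$ are the standard unit vectors of $\mathbb{N}^m$. Hypercomplex Fueter variables: $\zeta_s^{\mathcal{B}}=x_s-x_0v_s$, $1\le s\le m$. Hypercomplex Fueter polynomial functions $\mathcal{P}_{\mathbf{k}}^{\mathcal{B}}:M\to A$, $\mathbf{k}\in\mathbb{Z}^m$: $\mathcal{P}_{\mathbf{k}}^{\mathcal{B}}\equiv0$ if $\mathbf{k}\notin\mathbb{N}^m$; $\mathcal{P}_{(0,\ldots,0)}^{\mathcal{B}}\equiv1$; and $|\mathbf{k}|\,\mathcal{P}_{\mathbf{k}}^{\mathcal{B}}(x)=\sum_{s=1}^mk_s\,\mathcal{P}_{\mathbf{k}-\epsilon_s}^{\mathcal{B}}(x)\,\zeta_s^{\mathcal{B}}$ if $\mathbf{k}\in\mathbb{N}^m\setminus\{(0,\ldots,0)\}$. A series $\sum_kf_k$ of continuous functions converges normally in an open set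 if $\sum_k\max_C\|f_k\|$ converges for every compact subset $C$ of it. *)

theory Defs
  imports "HOL-Analysis.Analysis"
begin

text \<open>
  A finite-dimensional associative unital real algebra is a type of sort
  \<open>{real_algebra_1, euclidean_space}\<close>.  This sort imposes no relation between the multiplication
  and the inner product; the inner product is pinned down by requiring the chosen basis of the
  whole algebra to be orthonormal (see \<open>orthonormal_family\<close>), so that \<open>norm\<close> and the topology are
  those of the Euclidean norm attached to that basis.
  Families \<open>(v\<^sub>0, \<dots>, v\<^sub>n)\<close> are functions on \<^typ>\<open>nat\<close> of which only the values at
  \<open>{0..n}\<close> matter.
\<close>

definition star_involution :: "('a::real_algebra_1 \<Rightarrow> 'a) \<Rightarrow> bool" where
  "star_involution c \<longleftrightarrow>
     linear c \<and> (\<forall>x. c (c x) = x) \<and> (\<forall>x y. c (x * y) = c y * c x)"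

definition imag_units :: "('a::real_algebra_1 \<Rightarrow> 'a) \<Rightarrow> 'a set" where
  "imag_units c = {x. x + c x = 0 \<and> x * c x = 1}"

definition quadratic_cone :: "('a::real_algebra_1 \<Rightarrow> 'a) \<Rightarrow> 'a set" where
  "quadratic_cone c = (\<Union>J\<in>imag_units c. {of_real a + J * of_real b | a b. True})"

definition hypercomplex_subspace :: "('a::real_algebra_1 \<Rightarrow> 'a) \<Rightarrow> 'a set \<Rightarrow> bool" where
  "hypercomplex_subspace c M \<longleftrightarrow> subspace M \<and> \<real> \<subset> M \<and> M \<subseteq> quadratic_cone c"

definition ordered_basis :: "(nat \<Rightarrow> 'a::real_vector) \<Rightarrow> nat \<Rightarrow> 'a set \<Rightarrow> bool" where
  "ordered_basis v n V \<longleftrightarrow>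
     inj_on v {0..n} \<and> independent (v ` {0..n}) \<and> span (v ` {0..n}) = V"

definition hypercomplex_basis ::
    "('a::real_algebra_1 \<Rightarrow> 'a) \<Rightarrow> 'a set \<Rightarrow> (nat \<Rightarrow> 'a) \<Rightarrow> nat \<Rightarrow> bool" where
  "hypercomplex_basis c M v m \<longleftrightarrow>
     ordered_basis v m M \<and> m \<ge> 1 \<and> v 0 = 1 \<and>
     (\<forall>s\<in>{1..m}. v s \<in> imag_units c) \<and>
     (\<forall>s\<in>{1..m}. \<forall>u\<in>{1..m}. s \<noteq> u \<longrightarrow> v s * v u = - (v u * v s))"

definition orthonormal_family :: "(nat \<Rightarrow> 'a::real_inner) \<Rightarrow> nat \<Rightarrow> bool" where
  "orthonormal_family v n \<longleftrightarrow> (\<forall>i\<le>n. \<forall>j\<le>n. v i \<bullet> v j = (if i = j then 1 else 0))"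

text \<open>
  The maximum of a real function on a set (unspecified if it is not attained).  Below it is only
  used for continuous functions on nonempty compact sets.
\<close>

definition max_on :: "'b set \<Rightarrow> ('b \<Rightarrow> real) \<Rightarrow> real" where
  "max_on S f = (GREATEST r. r \<in> f ` S)"

definition mult_bound :: "'a::{real_algebra_1, euclidean_space} set \<Rightarrow> real" where
  "mult_bound M = max_on {(u, v). u \<in> M \<and> norm u = 1 \<and> norm v = 1} (\<lambda>(u, v). norm (u * v))"

definition partial_quotient ::
    "'a::real_normed_vector \<Rightarrow> ('a \<Rightarrow> 'a) \<Rightarrow> 'a \<Rightarrow> real \<Rightarrow> 'a" where
  "partial_quotient w \<phi> x \<epsilon> = inverse \<epsilon> *\<^sub>R (\<phi> (x + \<epsilon> *\<^sub>R w) - \<phi> x)"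

text \<open>
  Functions on a relatively open subset \<open>G\<close> of \<open>M\<close> are total functions of which only the values
  on \<open>G\<close> are used: for \<open>w \<in> M\<close> and \<open>x \<in> G\<close> the limit below depends only on the values on \<open>G\<close>.
\<close>

definition partial_deriv :: "'a::real_normed_vector \<Rightarrow> ('a \<Rightarrow> 'a) \<Rightarrow> 'a \<Rightarrow> 'a" where
  "partial_deriv w \<phi> x = Lim (at 0) (partial_quotient w \<phi> x)"

definition C1_wrt ::
    "(nat \<Rightarrow> 'a::real_normed_vector) \<Rightarrow> nat \<Rightarrow> 'a set \<Rightarrow> ('a \<Rightarrow> 'a) \<Rightarrow> bool" where
  "C1_wrt v m G \<phi> \<longleftrightarrow>
     (\<forall>s\<le>m. (\<forall>x\<in>G. \<exists>L. (partial_quotient (v s) \<phi> x \<longlongrightarrow> L) (at 0)) \<and>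
            continuous_on G (partial_deriv (v s) \<phi>))"

definition left_monogenic ::
    "(nat \<Rightarrow> 'a::{real_algebra_1, real_normed_vector}) \<Rightarrow> nat \<Rightarrow> 'a set \<Rightarrow> ('a \<Rightarrow> 'a) \<Rightarrow> bool" where
  "left_monogenic v m G \<phi> \<longleftrightarrow>
     C1_wrt v m G \<phi> \<and> (\<forall>x\<in>G. (\<Sum>s=0..m. v s * partial_deriv (v s) \<phi> x) = 0)"

text \<open>\<open>\<partial>\<^sub>0\<^sup>h\<^sup>0 (\<partial>\<^sub>1\<^sup>h\<^sup>1 (\<dots> (\<partial>\<^sub>m\<^sup>h\<^sup>m \<phi>)))\<close>\<close>

definition nabla ::
    "(nat \<Rightarrow> 'a::real_normed_vector) \<Rightarrow> nat \<Rightarrow> (nat \<Rightarrow> nat) \<Rightarrow> ('a \<Rightarrow> 'a) \<Rightarrow> 'a \<Rightarrow> 'a" where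
  "nabla v m h \<phi> = foldr (\<lambda>s. partial_deriv (v s) ^^ h s) [0..<Suc m] \<phi>"

definition multi_indices :: "nat \<Rightarrow> nat \<Rightarrow> (nat \<Rightarrow> nat) set" where
  "multi_indices m n = {k. (\<forall>s. s \<notin> {1..m} \<longrightarrow> k s = 0) \<and> (\<Sum>s=1..m. k s) = n}"

lemma finite_multi_indices: "finite (multi_indices m n)"
proof (rule finite_subset)
  show "multi_indices m n \<subseteq>
      {f. \<forall>s. (s \<in> {1..m} \<longrightarrow> f s \<in> {0..n}) \<and> (s \<notin> {1..m} \<longrightarrow> f s = 0)}"
  proof
    fix k assume k: "k \<in> multi_indices m n"
    then have "k s \<le> n" if "s \<in> {1..m}" for s
      using member_le_sum[of s "{1..m}" k] that by (simp add: multi_indices_def)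
    with k show "k \<in> {f. \<forall>s. (s \<in> {1..m} \<longrightarrow> f s \<in> {0..n}) \<and> (s \<notin> {1..m} \<longrightarrow> f s = 0)}"
      by (auto simp: multi_indices_def)
  qed
  show "finite {f. \<forall>s. (s \<in> {1..m} \<longrightarrow> f s \<in> {0..n}) \<and> (s \<notin> {1..m} \<longrightarrow> f s = (0::nat))}"
    by (rule finite_set_of_finite_funs) auto
qed

definition coord :: "(nat \<Rightarrow> 'a::real_vector) \<Rightarrow> nat \<Rightarrow> nat \<Rightarrow> 'a \<Rightarrow> real" where
  "coord v m s x = representation (v ` {0..m}) x (v s)"

definition fueter_var :: "(nat \<Rightarrow> 'a::real_algebra_1) \<Rightarrow> nat \<Rightarrow> nat \<Rightarrow> 'a \<Rightarrow> 'a" where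
  "fueter_var v m s x = of_real (coord v m s x) - coord v m 0 x *\<^sub>R v s"

text \<open>Indices are elements of \<open>\<int>\<^sup>m\<close>, given by the values of \<open>k\<close> on \<open>{1..m}\<close>.\<close>

function fueter_poly ::
    "(nat \<Rightarrow> 'a::real_algebra_1) \<Rightarrow> nat \<Rightarrow> (nat \<Rightarrow> int) \<Rightarrow> 'a \<Rightarrow> 'a" where
  "fueter_poly v m k x =
     (if \<exists>s\<in>{1..m}. k s < 0 then 0
      else if \<forall>s\<in>{1..m}. k s = 0 then 1
      else inverse (of_int (\<Sum>s=1..m. k s)) *\<^sub>R
        (\<Sum>s=1..m. of_int (k s) *\<^sub>R (fueter_poly v m (k(s := k s - 1)) x * fueter_var v m s x)))"
  by pat_completeness auto
termination
proof (relation "Wellfounded.measure (\<lambda>(v, m, k, x). nat (\<Sum>s=1..m. k s))", goal_cases)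
  case 1
  show ?case by simp
next
  case (2 v m k x s)
  then have nonneg: "\<forall>s\<in>{1..m}. 0 \<le> k s" by auto
  with 2(2) obtain u where "u \<in> {1..m}" "k u > 0" by force
  with nonneg have "0 < (\<Sum>s=1..m. k s)" by (intro sum_pos2) auto
  moreover have "(\<Sum>i=1..m. (k(s := k s - 1)) i) < (\<Sum>i=1..m. k i)"
    using 2(3) by (intro sum_strict_mono_ex1) auto
  ultimately show ?case by simp
qed

text \<open>The defining equation loops as a rewrite rule.\<close>
declare fueter_poly.simps [simp del]

definition taylor_coeff ::
    "(nat \<Rightarrow> 'a::{real_algebra_1, real_normed_vector}) \<Rightarrow> nat \<Rightarrow> ('a \<Rightarrow> 'a) \<Rightarrow> 'a \<Rightarrow>
      (nat \<Rightarrow> nat) \<Rightarrow> 'a" where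
  "taylor_coeff v m \<phi> p k = inverse (\<Prod>s=1..m. fact (k s)) *\<^sub>R nabla v m (k(0 := 0)) \<phi> p"

definition taylor_part ::
    "(nat \<Rightarrow> 'a::{real_algebra_1, real_normed_vector}) \<Rightarrow> nat \<Rightarrow> ('a \<Rightarrow> 'a) \<Rightarrow> 'a \<Rightarrow>
      nat \<Rightarrow> 'a \<Rightarrow> 'a" where
  "taylor_part v m \<phi> p n x =
     (\<Sum>k\<in>multi_indices m n. fueter_poly v m (\<lambda>s. int (k s)) (x - p) * taylor_coeff v m \<phi> p k)"

definition converges_normally ::
    "(nat \<Rightarrow> 'a::real_normed_vector \<Rightarrow> 'a) \<Rightarrow> 'a set \<Rightarrow> bool" where
  "converges_normally f U \<longleftrightarrow>
     (\<forall>k. continuous_on U (f k)) \<and>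
     (\<forall>C. compact C \<and> C \<noteq> {} \<and> C \<subseteq> U \<longrightarrow> summable (\<lambda>k. max_on C (\<lambda>x. norm (f k x))))"

end

theory Submission
  imports Defs
begin

text \<open>
  A cutoff \<open>\<chi>\<close> of \<open>|y|\<^sup>2\<close>, equal to 1 for \<open>|y|\<^sup>2 \<le> a\<close> and to 0 for \<open>|y|\<^sup>2 \<ge> b\<close>, replaces the
  surface integral of the Cauchy formula by a volume integral over the shell \<open>a \<le> |y|\<^sup>2 \<le> b\<close>: since
  \<open>\<integral> \<partial>\<^sub>s(\<dots>) = 0\<close> for compactly supported integrands, the only trace of the boundary is the gradient
  of \<open>\<chi>\<close>, which is \<open>- W(y) y\<close> with \<open>W \<ge> 0\<close>.  The singular kernel \<open>E(z) = cj z |z|\<^sup>-\<^sup>2\<^sup>\<alpha>\<close>,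
  \<open>\<alpha> = (m + 1) / 2\<close>, is the limit for \<open>\<delta> \<rightarrow> 0\<close> of smooth kernels in which \<open>|z|\<^sup>2 + \<delta>\<close> replaces
  \<open>|z|\<^sup>2\<close> and whose divergence concentrates at the origin.  This gives
  \<open>C \<phi>(p + x) = \<integral> E(y - x) W(y) y \<phi>(p + y) dy\<close> with \<open>C = \<integral> W(y) |y|\<^sup>2\<^sup>-\<^sup>2\<^sup>\<alpha> dy\<close>; neither the
  normalization of the measure nor the area of the sphere is needed.

  The formula makes \<open>\<phi>\<close> smooth.  Expanding \<open>E(y - t x)\<close> in powers of \<open>t\<close>, with coefficients bounded by
  \<open>(k + m choose m) |x|\<^sup>k |y|\<^sup>1\<^sup>-\<^sup>2\<^sup>\<alpha>\<^sup>-\<^sup>k\<close>, yields \<open>\<phi>(p + t x)\<close> as a power series in \<open>t\<close>.  Its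
  coefficients are the Taylor parts, because monogenicity turns the derivative along \<open>x\<close> into
  \<open>\<Sum>\<^sub>s \<zeta>\<^sub>s(x) \<partial>\<^sub>s\<close>, whose iterates produce the Fueter polynomials.  Letting the shell shrink to a sphere
  gives the estimate.
\<close>

section \<open>Line derivatives, cutoff functions and power series\<close>

text \<open>The only products whose norm is controlled sharply are those with a left factor in
  \<open>M\<close>. In the estimate there are two such factors, the kernel coefficient and the
  vector \<open>y\<close> next to the function, and each costs one \<open>mult_bound M\<close>. The
  binomial coefficient comes from 2 \<alpha> = m + 1: it is the coefficient of q^k in (1 - q)^(-(m +
  1)), which majorizes the expansion of |1 - t w|^(-2 \<alpha>) term by term. The weight leaves no
  trace in the estimate, because what remains of the integrand is W(y) |y|^(2 - 2 \<alpha>), whose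
  integral is C. The constant C is itself found by applying the argument to the constant function 1,
  which is monogenic. The Taylor parts are identified on each ray separately, by uniqueness of the
  coefficients of a power series in one real variable. Since only partial derivatives are given,
  continuity of the function, its derivatives in other directions and the symmetry of second
  derivatives have to be established before it can be differentiated repeatedly along a ray.\<close>

lemma has_vector_derivative_at_0_iff:
  fixes g :: "real \<Rightarrow> 'a::real_normed_vector"
  shows "(g has_vector_derivative L) (at 0) \<longleftrightarrow>
    ((\<lambda>t. inverse t *\<^sub>R (g t - g 0)) \<longlongrightarrow> L) (at 0)"
proof -
  have "((\<lambda>t. inverse t *\<^sub>R (g t - g 0)) \<longlongrightarrow> L) (at 0) \<longleftrightarrow>
      ((\<lambda>t. norm (inverse t *\<^sub>R (g t - g 0) - L)) \<longlongrightarrow> 0) (at 0)"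
    by (simp only: tendsto_norm_zero_iff LIM_zero_iff)
  also have "\<dots> \<longleftrightarrow>
      ((\<lambda>t. norm (g t - g 0 - (t - 0) *\<^sub>R L) / norm (t - 0)) \<longlongrightarrow> 0) (at 0)"
  proof (rule tendsto_cong)
    have "norm (inverse t *\<^sub>R (g t - g 0) - L) = norm (g t - g 0 - (t - 0) *\<^sub>R L) / norm (t - 0)"
      if "t \<noteq> 0" for t
    proof -
      have "inverse t *\<^sub>R (g t - g 0) - L = inverse t *\<^sub>R (g t - g 0 - t *\<^sub>R L)"
        using that by (simp add: scaleR_diff_right)
      then show ?thesis
        by (simp add: divide_inverse_commute)
    qed
    then show "\<forall>\<^sub>F t in at 0. norm (inverse t *\<^sub>R (g t - g 0) - L) =
        norm (g t - g 0 - (t - 0) *\<^sub>R L) / norm (t - 0)"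
      by (auto simp: eventually_at_filter)
  qed
  also have "\<dots> \<longleftrightarrow> (g has_vector_derivative L) (at 0)"
    unfolding has_vector_derivative_def has_derivative_iff_norm
    by (simp add: bounded_linear_scaleR_left)
  finally show ?thesis ..
qed

lemma partial_quotient_tendsto_iff:
  "(partial_quotient w f x \<longlongrightarrow> L) (at 0) \<longleftrightarrow>
     ((\<lambda>t. f (x + t *\<^sub>R w)) has_vector_derivative L) (at 0)"
  unfolding has_vector_derivative_at_0_iff partial_quotient_def[abs_def] by simp

lemma partial_deriv_eqI:
  assumes "((\<lambda>t. f (x + t *\<^sub>R w)) has_vector_derivative L) (at 0)"
  shows "partial_deriv w f x = L"
  using assms unfolding partial_deriv_def partial_quotient_tendsto_iff[symmetric]
  by (intro tendsto_Lim) auto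

text \<open>Derivatives are recorded at parameter 0 and arbitrary base point; moving the base point
  along the line yields them at every \<open>t\<close>, as the mean value inequality and
  differentiation under the integral require.\<close>

lemma has_vector_derivative_shift_line:
  fixes x w :: "'b::real_vector"
  shows "((\<lambda>s. f (x + s *\<^sub>R w)) has_vector_derivative L) (at t) \<longleftrightarrow>
   ((\<lambda>s. f ((x + t *\<^sub>R w) + s *\<^sub>R w)) has_vector_derivative L) (at 0)"
proof
  assume "((\<lambda>s. f (x + s *\<^sub>R w)) has_vector_derivative L) (at t)"
  then have "(((\<lambda>s. f (x + s *\<^sub>R w)) \<circ> (\<lambda>s. t + s)) has_vector_derivative (1 *\<^sub>R L)) (at 0)"
    by (intro vector_diff_chain_at) (auto intro!: derivative_eq_intros)
  then show "((\<lambda>s. f ((x + t *\<^sub>R w) + s *\<^sub>R w)) has_vector_derivative L) (at 0)"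
    by (simp add: o_def scaleR_add_left add.assoc)
next
  assume "((\<lambda>s. f ((x + t *\<^sub>R w) + s *\<^sub>R w)) has_vector_derivative L) (at 0)"
  then have "(((\<lambda>s. f ((x + t *\<^sub>R w) + s *\<^sub>R w)) \<circ> (\<lambda>s. s - t)) has_vector_derivative (1 *\<^sub>R L)) (at t)"
    by (intro vector_diff_chain_at) (auto intro!: derivative_eq_intros)
  then show "((\<lambda>s. f (x + s *\<^sub>R w)) has_vector_derivative L) (at t)"
    by (simp add: o_def algebra_simps)
qed

lemma norm_increment_le:
  fixes f :: "real \<Rightarrow> 'a::real_normed_vector"
  assumes "\<And>t. t \<in> closed_segment 0 h \<Longrightarrow> (f has_vector_derivative f' t) (at t)"
    and "\<And>t. t \<in> closed_segment 0 h \<Longrightarrow> norm (f' t) \<le> B"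
  shows "norm (f h - f 0) \<le> B * \<bar>h\<bar>"
proof -
  have "norm (f h - f 0) \<le> B * norm (h - 0)"
  proof (rule differentiable_bound)
    show "(f has_derivative (\<lambda>s. s *\<^sub>R f' t)) (at t within closed_segment 0 h)"
      if "t \<in> closed_segment 0 h" for t
      using assms(1)[OF that] unfolding has_vector_derivative_def by (rule has_derivative_at_withinI)
    show "onorm (\<lambda>s. s *\<^sub>R f' t) \<le> B" if "t \<in> closed_segment 0 h" for t
    proof (rule onorm_le)
      show "norm (s *\<^sub>R f' t) \<le> B * norm s" for s
        using mult_right_mono[OF assms(2)[OF that], of "norm s"] by (simp add: mult.commute)
    qed
  qed auto
  then show ?thesis by simp
qed

text \<open>Dominated convergence along the filter \<open>at x\<close>, reduced to sequences by
  first countability. Measurability and domination are required only near \<open>x\<close>, hence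
  the initial segment of length \<open>N0\<close> is dropped.\<close>

lemma tendsto_integral_at:
  fixes f :: "'b \<Rightarrow> 'c::{banach, second_countable_topology}"
    and s :: "'x::first_countable_topology \<Rightarrow> 'b \<Rightarrow> 'c"
  assumes meas: "\<forall>\<^sub>F t in at x. s t \<in> borel_measurable N" "f \<in> borel_measurable N"
    and w: "integrable N w"
    and lim: "\<And>y. y \<in> space N \<Longrightarrow> ((\<lambda>t. s t y) \<longlongrightarrow> f y) (at x)"
    and bound: "\<forall>\<^sub>F t in at x. \<forall>y\<in>space N. norm (s t y) \<le> w y"
  shows "((\<lambda>t. integral\<^sup>L N (s t)) \<longlongrightarrow> integral\<^sup>L N f) (at x)"
  unfolding tendsto_at_iff_sequentially comp_def
proof (intro allI impI)
  fix X :: "nat \<Rightarrow> 'x" assume X1: "\<forall>i. X i \<in> UNIV - {x}" and X2: "X \<longlonglongrightarrow> x"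
  then have X: "filterlim X (at x) sequentially"
    by (auto simp: filterlim_at)
  obtain N0 where N0: "\<And>n. N0 \<le> n \<Longrightarrow>
      s (X n) \<in> borel_measurable N \<and> (\<forall>y\<in>space N. norm (s (X n) y) \<le> w y)"
    using filterlim_iff[THEN iffD1, OF X, rule_format, OF eventually_conj[OF meas(1) bound]]
    by (auto simp: eventually_sequentially)
  show "(\<lambda>n. integral\<^sup>L N (s (X n))) \<longlonglongrightarrow> integral\<^sup>L N f"
  proof (rule LIMSEQ_offset[of _ N0], rule integral_dominated_convergence)
    show "AE y in N. norm (s (X (n + N0)) y) \<le> w y" for n
      using N0[of "n + N0"] by simp
    show "AE y in N. (\<lambda>n. s (X (n + N0)) y) \<longlonglongrightarrow> f y"
      using filterlim_compose[OF lim X] by (intro AE_I2 LIMSEQ_ignore_initial_segment)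
    show "s (X (n + N0)) \<in> borel_measurable N" for n
      using N0[of "n + N0"] by simp
  qed fact+
qed

lemma has_vector_derivative_integral:
  fixes k :: "real \<Rightarrow> 'b \<Rightarrow> 'c::{banach, second_countable_topology}"
  assumes \<eta>: "0 < \<eta>"
    and int: "\<And>t. \<bar>t\<bar> < \<eta> \<Longrightarrow> integrable N (k t)"
    and deriv: "\<And>t y. \<bar>t\<bar> < \<eta> \<Longrightarrow> y \<in> space N \<Longrightarrow> ((\<lambda>t. k t y) has_vector_derivative k' t y) (at t)"
    and bound: "\<And>t y. \<bar>t\<bar> < \<eta> \<Longrightarrow> y \<in> space N \<Longrightarrow> norm (k' t y) \<le> w y"
    and meas: "k' 0 \<in> borel_measurable N"
    and w: "integrable N w"
  shows "((\<lambda>t. integral\<^sup>L N (k t)) has_vector_derivative integral\<^sup>L N (k' 0)) (at 0)"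
proof -
  let ?Q = "\<lambda>t y. inverse t *\<^sub>R (k t y - k 0 y)"
  have near: "\<forall>\<^sub>F t in at (0::real). \<bar>t\<bar> < \<eta>"
    using \<eta> by (auto simp: eventually_at intro!: exI[of _ \<eta>])
  have "((\<lambda>t. integral\<^sup>L N (?Q t)) \<longlongrightarrow> integral\<^sup>L N (k' 0)) (at 0)"
  proof (rule tendsto_integral_at[OF _ meas w])
    show "\<forall>\<^sub>F t in at 0. ?Q t \<in> borel_measurable N"
      using near
    proof eventually_elim
      case (elim t)
      then show ?case using int[of t] int[of 0] \<eta> by auto
    qed
    show "((\<lambda>t. ?Q t y) \<longlongrightarrow> k' 0 y) (at 0)" if "y \<in> space N" for y
    proof -
      have "((\<lambda>t. k (0 + t *\<^sub>R 1) y) has_vector_derivative k' 0 y) (at 0)"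
        using deriv[of 0 y] that \<eta> by simp
      then show ?thesis
        unfolding has_vector_derivative_at_0_iff by simp
    qed
    show "\<forall>\<^sub>F t in at 0. \<forall>y\<in>space N. norm (?Q t y) \<le> w y"
      using near
    proof eventually_elim
      case (elim t)
      show ?case
      proof
        fix y assume y: "y \<in> space N"
        have seg: "\<bar>s\<bar> < \<eta>" if "s \<in> closed_segment 0 t" for s
          using that elim by (auto simp: closed_segment_eq_real_ivl split: if_splits)
        have "norm (k t y - k 0 y) \<le> w y * \<bar>t\<bar>"
          \<comment> \<open>The mean value inequality on the segment from 0 to \<open>t\<close>
            passes the bound of the derivative on to the difference quotients.\<close>
          by (rule norm_increment_le[where f' = "\<lambda>s. k' s y"]) (use deriv bound y seg in auto)
        moreover have "0 \<le> w y"
          using order_trans[OF norm_ge_zero bound[of 0 y]] y \<eta> by simp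
        ultimately show "norm (?Q t y) \<le> w y"
          by (cases "t = 0") (simp_all add: inverse_eq_divide pos_divide_le_eq)
      qed
    qed
  qed
  moreover have "\<forall>\<^sub>F t in at 0. integral\<^sup>L N (?Q t) =
      inverse t *\<^sub>R (integral\<^sup>L N (k t) - integral\<^sup>L N (k 0))"
    using near
  proof eventually_elim
    case (elim t)
    then show ?case
      using int[of t] int[of 0] \<eta> by simp
  qed
  ultimately have "((\<lambda>t. inverse t *\<^sub>R (integral\<^sup>L N (k t) - integral\<^sup>L N (k 0))) \<longlongrightarrow> integral\<^sup>L N (k' 0)) (at 0)"
    by (rule Lim_transform_eventually)
  then show ?thesis
    unfolding has_vector_derivative_at_0_iff .
qed

section \<open>A continuously differentiable cutoff on the real line\<close>

definition ramp :: "real \<Rightarrow> real" where "ramp x = (max 0 x)\<^sup>2"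

lemma DERIV_ramp: "(ramp has_real_derivative 2 * max 0 x) (at x)"
proof -
  consider "x < 0" | "x > 0" | "x = 0" by linarith
  then show ?thesis
  proof cases
    case 1
    have "((\<lambda>_. 0) has_real_derivative 0) (at x)" by simp
    then have "(ramp has_real_derivative 0) (at x)"
      by (rule has_field_derivative_transform_within[of _ _ _ _ "-x"])
         (use 1 in \<open>auto simp: ramp_def dist_real_def\<close>)
    then show ?thesis using 1 by simp
  next
    case 2
    have "((\<lambda>x. x\<^sup>2) has_real_derivative 2 * x) (at x)" by (auto intro!: derivative_eq_intros)
    then have "(ramp has_real_derivative 2 * x) (at x)"
      by (rule has_field_derivative_transform_within[of _ _ _ _ x])
         (use 2 in \<open>auto simp: ramp_def dist_real_def max_def abs_if split: if_splits\<close>)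
    then show ?thesis using 2 by simp
  next
    case 3
    have "((\<lambda>y. (ramp y - ramp 0) / (y - 0)) \<longlongrightarrow> 0) (at 0)"
    proof (rule Lim_null_comparison)
      show "\<forall>\<^sub>F y in at 0. norm ((ramp y - ramp 0) / (y - 0)) \<le> \<bar>y\<bar>"
        by (auto simp: ramp_def eventually_at_filter max_def power2_eq_square)
      show "((\<lambda>y::real. \<bar>y\<bar>) \<longlongrightarrow> 0) (at 0)" by (intro tendsto_eq_intros) auto
    qed
    then show ?thesis using 3 by (simp add: has_field_derivative_iff)
  qed
qed

text \<open>Squares of positive parts are continuously differentiable, and one derivative of the
  cutoff is all that the divergence argument takes.\<close>

definition cutoff :: "real \<Rightarrow> real \<Rightarrow> real \<Rightarrow> real" where
  "cutoff a b t = ramp (1 - ramp (t - a) / (b - a)\<^sup>2)"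

text \<open>The derivative of \<open>cutoff\<close> with reversed sign, hence nonnegative: it
  becomes the weight on the shell.\<close>

definition cutoff' :: "real \<Rightarrow> real \<Rightarrow> real \<Rightarrow> real" where
  "cutoff' a b t = 4 * max 0 (1 - ramp (t - a) / (b - a)\<^sup>2) * max 0 (t - a) / (b - a)\<^sup>2"

lemma DERIV_cutoff: "(cutoff a b has_real_derivative - cutoff' a b t) (at t)"
proof -
  have 0: "((\<lambda>t. t - a) has_real_derivative 1) (at t)"
    by (auto intro!: derivative_eq_intros)
  have 1: "((\<lambda>t. ramp (t - a)) has_real_derivative 2 * max 0 (t - a)) (at t)"
    using DERIV_chain2[OF DERIV_ramp 0] by simp
  have "((\<lambda>t. 1 - ramp (t - a) / (b - a)\<^sup>2) has_real_derivative - (2 * max 0 (t - a) / (b - a)\<^sup>2)) (at t)"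
    by (rule DERIV_cong[OF DERIV_diff[OF DERIV_const DERIV_cdivide[OF 1]]]) simp
  from DERIV_chain2[OF DERIV_ramp this]
  show ?thesis unfolding cutoff_def[abs_def] cutoff'_def by (simp add: mult.assoc)
qed

lemma cutoff_eq_1: "t \<le> a \<Longrightarrow> cutoff a b t = 1"
  by (simp add: cutoff_def ramp_def)

lemma
  assumes "a < b" "b \<le> t"
  shows cutoff_eq_0: "cutoff a b t = 0" and cutoff'_eq_0: "cutoff' a b t = 0"
proof -
  have "(b - a)\<^sup>2 \<le> ramp (t - a)"
    using assms by (simp add: ramp_def power_mono)
  then have "1 - ramp (t - a) / (b - a)\<^sup>2 \<le> 0"
    using assms by (simp add: field_simps)
  then show "cutoff a b t = 0" "cutoff' a b t = 0"
    by (simp_all add: cutoff_def cutoff'_def ramp_def[of "1 - _"] max_def)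
qed

lemma cutoff'_eq_0': "t \<le> a \<Longrightarrow> cutoff' a b t = 0"
  by (simp add: cutoff'_def)

lemma cutoff_nonneg: "0 \<le> cutoff a b t"
  by (simp add: cutoff_def ramp_def)

lemma cutoff'_nonneg: "0 \<le> cutoff' a b t"
  by (simp add: cutoff'_def)

lemma cutoff'_pos:
  assumes "a < t" "t < b"
  shows "0 < cutoff' a b t"
proof -
  have "ramp (t - a) < (b - a)\<^sup>2"
    using assms by (simp add: ramp_def power_strict_mono)
  then have "0 < 1 - ramp (t - a) / (b - a)\<^sup>2"
    using assms by (simp add: field_simps)
  then show ?thesis using assms unfolding cutoff'_def
    by (intro divide_pos_pos mult_pos_pos) auto
qed

lemma continuous_ramp: "continuous_on S ramp"
  unfolding ramp_def by (intro continuous_intros)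

lemma continuous_cutoff: "continuous_on S (cutoff a b)"
  using DERIV_cutoff by (rule DERIV_continuous_on[OF has_field_derivative_at_within])

lemma continuous_cutoff': "continuous_on S (cutoff' a b)"
proof -
  have "continuous_on S (\<lambda>t. K * max 0 (1 - ramp (t - a) * L) * max 0 (t - a))" for K L
    by (intro continuous_intros
        continuous_on_compose2[OF continuous_ramp[of UNIV], of _ "\<lambda>t. t - a"]) auto
  from this[of "4 / (b - a)\<^sup>2" "1 / (b - a)\<^sup>2"] show ?thesis
    unfolding cutoff'_def[abs_def] by simp
qed

text \<open>Inner products with basis vectors are scalar power series, which may be differentiated
  termwise; the induction replaces \<open>c'\<close> by \<open>diffs c'\<close> and drops the first
  function. Only \<open>f 0\<close> is given with a series, those of the later \<open>f n\<close>
  come out of the induction.\<close>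

lemma powser_coeff_eq_deriv:
  fixes f :: "nat \<Rightarrow> real \<Rightarrow> 'a::euclidean_space" and c :: "nat \<Rightarrow> 'a"
  assumes \<tau>: "0 < \<tau>"
    and sums: "\<And>t. \<bar>t\<bar> < \<tau> \<Longrightarrow> (\<lambda>n. t ^ n *\<^sub>R c n) sums f 0 t"
    and deriv: "\<And>n t. \<bar>t\<bar> < \<tau> \<Longrightarrow> (f n has_vector_derivative f (Suc n) t) (at t)"
  shows "f n 0 = fact n *\<^sub>R c n"
proof (rule euclidean_eqI)
  fix e :: 'a assume "e \<in> Basis"
  have *: "g n 0 = fact n * c' n"
    if "\<And>t. \<bar>t\<bar> < \<tau> \<Longrightarrow> (\<lambda>n. c' n * t ^ n) sums g 0 t"
      and "\<And>n t. \<bar>t\<bar> < \<tau> \<Longrightarrow> (g n has_real_derivative g (Suc n) t) (at t)"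
    for c' :: "nat \<Rightarrow> real" and g
    using that
  proof (induction n arbitrary: c' g)
    case 0
    then show ?case using sums_unique2[OF 0(1)[of 0] powser_sums_zero[of c']] \<tau> by simp
  next
    case (Suc n)
    have "(\<lambda>n. diffs c' n * t ^ n) sums g (Suc 0) t" if t: "\<bar>t\<bar> < \<tau>" for t
    proof -
      have 1: "((\<lambda>z. \<Sum>n. c' n * z^n) has_field_derivative (\<Sum>n. diffs c' n * t^n)) (at t)"
        by (rule termdiffs_strong'[of \<tau>]) (use Suc.prems(1) t in \<open>auto simp: sums_iff\<close>)
      have 2: "((\<lambda>z. \<Sum>n. c' n * z^n) has_field_derivative g (Suc 0) t) (at t)"
        by (rule has_field_derivative_transform_within[OF Suc.prems(2)[OF t, of 0], of "\<tau> - \<bar>t\<bar>"])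
           (use Suc.prems(1) t in \<open>auto simp: sums_iff dist_real_def\<close>)
      have "summable (\<lambda>n. diffs c' n * t^n)"
        by (rule termdiff_converges[of _ \<tau>]) (use Suc.prems(1) t in \<open>auto simp: sums_iff\<close>)
      with DERIV_unique[OF 1 2] show ?thesis by (simp add: sums_iff)
    qed
    from Suc.IH[of "diffs c'" "\<lambda>n. g (Suc n)", OF this Suc.prems(2)]
    show ?case by (simp add: diffs_def)
  qed
  have "f n 0 \<bullet> e = fact n * (c n \<bullet> e)"
  proof (rule *[of "\<lambda>n. c n \<bullet> e" "\<lambda>n t. f n t \<bullet> e"])
    show "(\<lambda>n. (c n \<bullet> e) * t ^ n) sums (f 0 t \<bullet> e)" if "\<bar>t\<bar> < \<tau>" for t
      using bounded_linear.sums[OF bounded_linear_inner_left sums[OF that], of e]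
      by (simp add: mult.commute)
    show "((\<lambda>t. f n t \<bullet> e) has_real_derivative f (Suc n) t \<bullet> e) (at t)" if "\<bar>t\<bar> < \<tau>" for n t
      using bounded_linear.has_vector_derivative[OF bounded_linear_inner_left deriv[OF that], of n e]
      by (simp add: has_real_derivative_iff_has_vector_derivative)
  qed
  then show "f n 0 \<bullet> e = (fact n *\<^sub>R c n) \<bullet> e" by simp
qed

lemma max_on_attained:
  fixes f :: "'b::topological_space \<Rightarrow> real"
  assumes "compact S" "S \<noteq> {}" "continuous_on S f"
  shows "max_on S f \<in> f ` S" and "\<And>x. x \<in> S \<Longrightarrow> f x \<le> max_on S f"
proof -
  obtain x where x: "x \<in> S" "\<And>y. y \<in> S \<Longrightarrow> f y \<le> f x"
    using continuous_attains_sup[OF assms] by auto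
  then have "max_on S f = f x"
    unfolding max_on_def by (intro Greatest_equality) auto
  with x show "max_on S f \<in> f ` S" "\<And>x. x \<in> S \<Longrightarrow> f x \<le> max_on S f" by auto
qed

section \<open>The regularized Cauchy kernel\<close>

text \<open>The norm is not assumed to be submultiplicative, so continuity of the multiplication is
  taken from bilinearity in finite dimension.\<close>

lemma bounded_bilinear_times:
  "bounded_bilinear ((*) :: 'a::{real_algebra_1, euclidean_space} \<Rightarrow> 'a \<Rightarrow> 'a)"
  by (simp flip: bilinear_conv_bounded_bilinear
        add: bilinear_def linear_iff algebra_simps)

lemmas continuous_on_times = bounded_bilinear.continuous_on[OF bounded_bilinear_times]
lemmas tendsto_times = bounded_bilinear.tendsto[OF bounded_bilinear_times]
lemmas bounded_linear_times_left = bounded_bilinear.bounded_linear_left[OF bounded_bilinear_times]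
lemmas bounded_linear_times_right = bounded_bilinear.bounded_linear_right[OF bounded_bilinear_times]

lemma has_vector_derivative_times_const:
  fixes f :: "real \<Rightarrow> 'a::{real_algebra_1, euclidean_space}"
  assumes "(f has_vector_derivative f') (at x within S)"
  shows "((\<lambda>t. f t * c) has_vector_derivative f' * c) (at x within S)"
    and "((\<lambda>t. c * f t) has_vector_derivative c * f') (at x within S)"
  using bounded_linear.has_vector_derivative[OF bounded_linear_times_left assms]
    bounded_linear.has_vector_derivative[OF bounded_linear_times_right assms] by auto

lemma has_vector_derivative_times:
  fixes f g :: "real \<Rightarrow> 'a::{real_algebra_1, euclidean_space}"
  assumes "(f has_vector_derivative f') (at x within S)" "(g has_vector_derivative g') (at x within S)"
  shows "((\<lambda>t. f t * g t) has_vector_derivative f x * g' + f' * g x) (at x within S)"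
  using bounded_bilinear.has_vector_derivative[OF bounded_bilinear_times assms] .

lemma emeasure_lborel_open_pos:
  fixes S :: "'a::euclidean_space set"
  assumes "open S" "S \<noteq> {}"
  shows "0 < emeasure lborel S"
proof -
  obtain x r where r: "0 < r" "ball x r \<subseteq> S"
    using assms by (meson equals0I open_contains_ball)
  have "0 < emeasure lborel (ball x r)"
    using content_ball_pos[OF r(1), of x] by (simp add: emeasure_lborel_ball_finite measure_def enn2real_positive_iff)
  also have "\<dots> \<le> emeasure lborel S"
    using r assms by (intro emeasure_mono) auto
  finally show ?thesis .
qed

text \<open>What the analysis takes from the star algebra: the involution enters through
  \<open>v_sq\<close>, and orthonormality is demanded of the basis of \<open>M\<close>
  alone.\<close>

locale hypercomplex_frame =
  fixes M :: "'a::{real_algebra_1, euclidean_space} set" and v :: "nat \<Rightarrow> 'a" and m :: nat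
  assumes m_ge_1: "1 \<le> m"
    and v_0: "v 0 = 1"
    and v_sq: "s \<in> {1..m} \<Longrightarrow> v s * v s = - 1"
    and v_anticommute: "s \<in> {1..m} \<Longrightarrow> u \<in> {1..m} \<Longrightarrow> s \<noteq> u \<Longrightarrow> v s * v u = - (v u * v s)"
    and inner_v: "i \<le> m \<Longrightarrow> j \<le> m \<Longrightarrow> v i \<bullet> v j = (if i = j then 1 else 0)"
    and span_v: "span (v ` {0..m}) = M"
begin

lemma subspace_M: "subspace M"
  using span_v by (auto simp flip: span_v)

lemma closed_M: "closed M"
  by (rule closed_subspace[OF subspace_M])

lemma v_in_M: "s \<le> m \<Longrightarrow> v s \<in> M"
  by (auto simp flip: span_v intro: span_base)

lemma one_in_M: "1 \<in> M"
  using v_in_M[of 0] v_0 by simp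

lemma inner_1_1: "(1::'a) \<bullet> 1 = 1" and norm_1: "norm (1::'a) = 1"
  using inner_v[of 0 0] by (simp_all add: v_0 norm_eq_sqrt_inner)

definition proj :: "'a \<Rightarrow> 'a" where
  "proj x = (\<Sum>s\<le>m. (x \<bullet> v s) *\<^sub>R v s)"

lemma proj_in_M: "proj x \<in> M"
  unfolding proj_def by (intro subspace_sum subspace_scale subspace_M v_in_M) auto

lemma linear_proj: "linear proj"
  unfolding proj_def
  by (intro linearI) (simp_all add: inner_add_left scaleR_add_left sum.distrib scaleR_sum_right)

lemma proj_v: "s \<le> m \<Longrightarrow> proj (v s) = v s"
proof -
  assume s: "s \<le> m"
  have "proj (v s) = (\<Sum>u\<le>m. if u = s then v s else 0)"
    unfolding proj_def using s by (intro sum.cong) (auto simp: inner_v)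
  then show ?thesis using s by simp
qed

lemma proj_M: "x \<in> M \<Longrightarrow> proj x = x"
  unfolding span_v[symmetric]
proof (induction rule: span_induct)
  case base
  then show ?case
    using linear_proj by (auto simp: subspace_def linear_0 linear_add linear_scale)
next
  case (step x)
  then show ?case using proj_v by auto
qed

lemma expand: "x \<in> M \<Longrightarrow> (\<Sum>s\<le>m. (x \<bullet> v s) *\<^sub>R v s) = x"
  using proj_M by (simp add: proj_def)

lemma continuous_proj: "continuous_on S proj"
  by (rule linear_continuous_on[OF linear_conv_bounded_linear[THEN iffD1, OF linear_proj]])

lemma proj_add: "proj (x + y) = proj x + proj y"
  by (rule linear_add[OF linear_proj])

text \<open>On \<open>M\<close> this agrees with the involution; on the whole algebra it is the
  isometry that fixes 1 and negates its orthogonal complement.\<close>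

definition cj :: "'a \<Rightarrow> 'a" where "cj z = (2 * (z \<bullet> 1)) *\<^sub>R 1 - z"

lemma linear_cj: "linear cj"
  unfolding cj_def by (intro linearI) (simp_all add: algebra_simps inner_add_left)

lemma continuous_cj: "continuous_on S cj"
  unfolding cj_def by (intro continuous_intros)

lemma norm_cj: "norm (cj z) = norm z"
proof -
  have "cj z \<bullet> cj z = z \<bullet> z"
    by (simp add: cj_def inner_diff_left inner_diff_right inner_1_1 inner_commute[of 1 z] power2_eq_square algebra_simps)
  then show ?thesis by (simp add: norm_eq_sqrt_inner)
qed

text \<open>With \<open>z = a 0 + q\<close>, where \<open>q\<close> is the part along
  \<open>v 1, ..., v m\<close>, the factor \<open>cj z\<close> is \<open>a 0 - q\<close> and the
  mixed terms cancel. The square of \<open>q\<close> is averaged over both orders of the double sum,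
  so that anticommutation removes the terms off the diagonal.\<close>

lemma cj_mult_self:
  assumes "z \<in> M"
  shows "cj z * z = (z \<bullet> z) *\<^sub>R 1"
proof -
  define a where "a s = z \<bullet> v s" for s
  define q where "q = (\<Sum>s=1..m. a s *\<^sub>R v s)"
  have atMost: "{..m} = insert 0 {1..m}" by auto
  have z: "z = a 0 *\<^sub>R 1 + q"
    using expand[OF assms] unfolding atMost by (simp add: q_def a_def v_0)
  have "cj z = a 0 *\<^sub>R 1 - q"
    unfolding cj_def by (subst (2) z) (simp add: a_def v_0 scaleR_2 flip: scaleR_scaleR)
  then have "cj z * z = (a 0 *\<^sub>R 1 - q) * (a 0 *\<^sub>R 1 + q)"
    using z by metis
  then have 1: "cj z * z = (a 0 * a 0) *\<^sub>R 1 - q * q"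
    by (simp add: algebra_simps)
  have qq1: "q * q = (\<Sum>s=1..m. \<Sum>u=1..m. (a s * a u) *\<^sub>R (v s * v u))"
    unfolding q_def sum_product
    by (intro sum.cong refl) (simp add: mult.commute[where 'a = real])
  have qq2: "q * q = (\<Sum>s=1..m. \<Sum>u=1..m. (a s * a u) *\<^sub>R (v u * v s))"
    unfolding qq1 by (subst sum.swap) (simp only: mult.commute[where 'a = real])
  have "2 *\<^sub>R (q * q) = q * q + q * q" by (rule scaleR_2)
  also have "\<dots> = (\<Sum>s=1..m. \<Sum>u=1..m. (a s * a u) *\<^sub>R (v s * v u + v u * v s))"
    by (subst (2) qq2, subst qq1) (simp add: scaleR_add_right sum.distrib)
  also have "\<dots> = (\<Sum>s=1..m. \<Sum>u=1..m. if u = s then - (2 * a s * a s) *\<^sub>R 1 else 0)"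
  proof (intro sum.cong refl)
    fix s u assume s: "s \<in> {1..m}" and u: "u \<in> {1..m}"
    show "(a s * a u) *\<^sub>R (v s * v u + v u * v s) = (if u = s then - (2 * a s * a s) *\<^sub>R 1 else 0)"
    proof (cases "u = s")
      case True
      then show ?thesis using v_sq[OF s] by (simp flip: scaleR_2)
    next
      case False
      then have "v s * v u + v u * v s = 0"
        using v_anticommute[OF s u] by (simp only: add.left_inverse not_sym)
      then show ?thesis using False by simp
    qed
  qed
  also have "\<dots> = (\<Sum>s=1..m. - (2 * a s * a s) *\<^sub>R 1)"
    by simp
  also have "\<dots> = 2 *\<^sub>R - ((\<Sum>s=1..m. a s * a s) *\<^sub>R 1)"
    by (simp add: sum_negf scaleR_sum_left scaleR_sum_right mult.assoc)
  finally have qq: "q * q = - ((\<Sum>s=1..m. a s * a s) *\<^sub>R 1)"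
    by (simp only: scaleR_cancel_left) simp
  have "z \<bullet> z = (\<Sum>s\<le>m. a s *\<^sub>R v s) \<bullet> z"
    using expand[OF assms] by (simp add: a_def)
  also have "\<dots> = (\<Sum>s\<le>m. a s * a s)"
    unfolding inner_sum_left by (intro sum.cong refl) (simp add: a_def inner_commute)
  also have "\<dots> = a 0 * a 0 + (\<Sum>s=1..m. a s * a s)"
    unfolding atMost by simp
  finally show ?thesis
    using 1 qq by (simp add: scaleR_add_left)
qed

text \<open>Half the real dimension of \<open>M\<close>, so that
  \<open>(z \<bullet> z) powr (- alpha)\<close> is the power \<open>-(m + 1)\<close> of the norm, as
  in the classical Cauchy kernel.\<close>

definition alpha :: real where "alpha = (real m + 1) / 2"

definition ker :: "real \<Rightarrow> 'a \<Rightarrow> 'a" where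
  "ker \<delta> z = (z \<bullet> z + \<delta>) powr (- alpha) *\<^sub>R cj z"

text \<open>The derivative of \<open>ker \<delta>\<close> in direction \<open>w\<close>;
  \<open>ker2 w u\<close> is the derivative of \<open>ker1 0 w\<close> in direction
  \<open>u\<close>. From the explicit formulas one reads off linearity in \<open>w\<close> and the
  symmetry of \<open>ker2\<close>, the source of commuting partial derivatives.\<close>

definition ker1 :: "real \<Rightarrow> 'a \<Rightarrow> 'a \<Rightarrow> 'a" where
  "ker1 \<delta> w z = (z \<bullet> z + \<delta>) powr (- alpha) *\<^sub>R cj w
     - (2 * alpha * (z \<bullet> w) * (z \<bullet> z + \<delta>) powr (- alpha - 1)) *\<^sub>R cj z"

definition ker2 :: "'a \<Rightarrow> 'a \<Rightarrow> 'a \<Rightarrow> 'a" where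
  "ker2 w u z = - (2 * alpha * (z \<bullet> z) powr (- alpha - 1)) *\<^sub>R
       ((z \<bullet> u) *\<^sub>R cj w + (z \<bullet> w) *\<^sub>R cj u + (w \<bullet> u) *\<^sub>R cj z)
     + (4 * alpha * (alpha + 1) * (z \<bullet> w) * (z \<bullet> u) * (z \<bullet> z) powr (- alpha - 2)) *\<^sub>R cj z"

lemma ker2_commute: "ker2 w u = ker2 u w"
  by (simp add: fun_eq_iff ker2_def inner_commute algebra_simps)

lemma cj_line: "cj (z + t *\<^sub>R w) = cj z + t *\<^sub>R cj w"
  by (simp add: linear_add[OF linear_cj] linear_scale[OF linear_cj])

lemma powr_line_deriv:
  assumes "0 < z \<bullet> z + \<delta>"
  shows "((\<lambda>t. ((z + t *\<^sub>R w) \<bullet> (z + t *\<^sub>R w) + \<delta>) powr r)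
    has_real_derivative r * (z \<bullet> z + \<delta>) powr (r - 1) * (2 * (z \<bullet> w))) (at 0)"
proof -
  have eq: "(z + t *\<^sub>R w) \<bullet> (z + t *\<^sub>R w) + \<delta> = z \<bullet> z + \<delta> + 2 * t * (z \<bullet> w) + t\<^sup>2 * (w \<bullet> w)" for t
    by (simp add: inner_add_left inner_add_right inner_commute power2_eq_square)
  have "((\<lambda>t. z \<bullet> z + \<delta> + 2 * t * (z \<bullet> w) + t\<^sup>2 * (w \<bullet> w)) has_real_derivative 2 * (z \<bullet> w)) (at 0)"
    by (auto intro!: derivative_eq_intros)
  from DERIV_chain2[OF has_real_derivative_powr this, of r] assms
  show ?thesis unfolding eq by simp
qed

lemma ker_line_deriv:
  assumes "0 < z \<bullet> z + \<delta>"
  shows "((\<lambda>t. ker \<delta> (z + t *\<^sub>R w)) has_vector_derivative ker1 \<delta> w z) (at 0)"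
proof -
  have "((\<lambda>t. cj z + t *\<^sub>R cj w) has_vector_derivative cj w) (at 0)"
    by (auto intro!: derivative_eq_intros)
  from has_vector_derivative_scaleR[OF powr_line_deriv[OF assms, of w "- alpha"] this]
  show ?thesis
    unfolding ker_def cj_line ker1_def by (simp add: algebra_simps)
qed

lemma ker1_line_deriv:
  assumes "z \<noteq> 0"
  shows "((\<lambda>t. ker1 0 w (z + t *\<^sub>R u)) has_vector_derivative ker2 w u z) (at 0)"
proof -
  have z: "0 < z \<bullet> z + 0" using assms by simp
  have 0: "((\<lambda>t. cj z + t *\<^sub>R cj u) has_vector_derivative cj u) (at 0)"
    by (auto intro!: derivative_eq_intros)
  have "((\<lambda>t. 2 * alpha * (z \<bullet> w + t * (u \<bullet> w))) has_real_derivative 2 * alpha * (u \<bullet> w)) (at 0)"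
    by (auto intro!: derivative_eq_intros)
  from DERIV_mult[OF this powr_line_deriv[OF z, of u "- alpha - 1"]]
  have 1: "((\<lambda>t. 2 * alpha * ((z + t *\<^sub>R u) \<bullet> w) * ((z + t *\<^sub>R u) \<bullet> (z + t *\<^sub>R u) + 0) powr (- alpha - 1))
      has_real_derivative 2 * alpha * (u \<bullet> w) * (z \<bullet> z) powr (- alpha - 1)
       - 4 * alpha * (alpha + 1) * (z \<bullet> w) * (z \<bullet> u) * (z \<bullet> z) powr (- alpha - 2)) (at 0)"
    by (simp add: algebra_simps inner_add_left)
  have 2: "((\<lambda>t. ((z + t *\<^sub>R u) \<bullet> (z + t *\<^sub>R u) + 0) powr (- alpha) *\<^sub>R cj w) has_vector_derivative
      (- (2 * alpha * (z \<bullet> u)) * (z \<bullet> z) powr (- alpha - 1)) *\<^sub>R cj w) (at 0)"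
    using has_vector_derivative_scaleR[OF powr_line_deriv[OF z, of u "- alpha"] has_vector_derivative_const]
    by (simp add: algebra_simps)
  from has_vector_derivative_diff[OF 2 has_vector_derivative_scaleR[OF 1 0]]
  show ?thesis
    unfolding ker1_def cj_line ker2_def by (simp add: algebra_simps inner_commute)
qed

lemma continuous_ker: "continuous_on {z. 0 < z \<bullet> z + \<delta>} (ker \<delta>)"
  unfolding ker_def by (intro continuous_intros continuous_cj) auto

lemma continuous_ker1: "continuous_on {z. 0 < z \<bullet> z + \<delta>} (ker1 \<delta> w)"
  unfolding ker1_def by (intro continuous_intros continuous_cj) auto

lemma continuous_ker2: "continuous_on {z. z \<noteq> 0} (ker2 w u)"
  unfolding ker2_def by (intro continuous_intros continuous_cj) auto

text \<open>The right divergence of the regularized kernel. It tends to 0 off the origin as \<delta>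
  tends to 0, while rescaling by \<open>sqrt \<delta>\<close> shows that its integral over
  \<open>M\<close> does not depend on \<delta>: an approximate identity without
  normalization.\<close>

definition mass :: "real \<Rightarrow> 'a \<Rightarrow> real" where
  "mass \<delta> z = (real m + 1) * \<delta> * (z \<bullet> z + \<delta>) powr (- alpha - 1)"

text \<open>With \<open>N = z \<bullet> z + \<delta>\<close> the derivatives of \<open>cj\<close>
  contribute \<open>(m + 1) N\<close> and those of the power
  \<open>- 2 alpha (z \<bullet> z)\<close>, both times \<open>N powr (- alpha - 1)\<close>. By
  \<open>2 alpha = m + 1\<close> only \<open>(m + 1) \<delta>\<close> is left; for
  \<open>\<delta> = 0\<close> the kernel is right monogenic off the origin.\<close>

lemma sum_ker1:
  assumes "z \<in> M" "0 < z \<bullet> z + \<delta>"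
  shows "(\<Sum>s\<le>m. ker1 \<delta> (v s) z * v s) = mass \<delta> z *\<^sub>R 1"
proof -
  let ?N = "z \<bullet> z + \<delta>"
  have "(\<Sum>s\<le>m. ker1 \<delta> (v s) z * v s) = ?N powr (- alpha) *\<^sub>R (\<Sum>s\<le>m. cj (v s) * v s)
      - (2 * alpha * ?N powr (- alpha - 1)) *\<^sub>R (cj z * (\<Sum>s\<le>m. (z \<bullet> v s) *\<^sub>R v s))"
    unfolding ker1_def
    by (simp add: algebra_simps sum_subtractf scaleR_sum_right sum_distrib_left)
  also have "(\<Sum>s\<le>m. cj (v s) * v s) = (real m + 1) *\<^sub>R 1"
    by (simp add: cj_mult_self v_in_M inner_v scaleR_conv_of_real)
  also have "cj z * (\<Sum>s\<le>m. (z \<bullet> v s) *\<^sub>R v s) = (z \<bullet> z) *\<^sub>R 1"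
    using expand[OF assms(1)] cj_mult_self[OF assms(1)] by simp
  also have "?N powr (- alpha) = ?N * ?N powr (- alpha - 1)"
    using assms(2) powr_mult_base[of ?N "- alpha - 1"] by simp
  also have "(?N * ?N powr (- alpha - 1)) *\<^sub>R (real m + 1) *\<^sub>R (1::'a)
      - (2 * alpha * ?N powr (- alpha - 1)) *\<^sub>R (z \<bullet> z) *\<^sub>R 1 = mass \<delta> z *\<^sub>R 1"
    unfolding mass_def scaleR_scaleR scaleR_diff_left[symmetric]
    by (rule arg_cong[where f = "\<lambda>r. r *\<^sub>R 1"]) (simp add: alpha_def field_simps)
  finally show ?thesis .
qed

end

section \<open>A translation invariant measure on the subspace\<close>

context hypercomplex_frame
begin

text \<open>
  The measure is the image of Lebesgue measure on the slab of width 1 around \<open>M\<close> under the orthogonal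
  projection, so that translation invariance along \<open>M\<close> is inherited from Lebesgue measure.
\<close>

definition slab :: "'a set" where "slab = {y. norm (y - proj y) \<le> 1}"

definition mu :: "'a measure" where
  "mu = distr (restrict_space lborel slab) (restrict_space borel M) proj"

lemma slab_sets [measurable]: "slab \<in> sets borel"
proof -
  have "closed slab"
    unfolding slab_def by (intro closed_Collect_le continuous_intros continuous_proj)
  then show ?thesis by simp
qed

lemma sets_mu: "sets mu = sets (restrict_space borel M)"
  and space_mu: "space mu = M"
  by (simp_all add: mu_def space_restrict_space)

lemma measurable_mu: "borel_measurable mu = borel_measurable (restrict_space borel M)"
  by (rule measurable_cong_sets) (simp_all add: sets_mu)

lemma continuous_imp_measurable_mu: "continuous_on M f \<Longrightarrow> f \<in> borel_measurable mu"
  by (simp add: measurable_mu borel_measurable_continuous_on_restrict)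

lemma proj_borel [measurable]: "proj \<in> borel_measurable borel"
  by (rule borel_measurable_continuous_onI[OF continuous_proj])

lemma proj_measurable [measurable]: "proj \<in> measurable borel (restrict_space borel M)"
  by (rule measurable_restrict_space2) (auto simp: proj_in_M)

lemma proj_measurable_slab [measurable]:
  "proj \<in> measurable (restrict_space lborel slab) (restrict_space borel M)"
  by (rule measurable_restrict_space1) simp

lemma integral_mu:
  fixes f :: "'a \<Rightarrow> 'c::{banach, second_countable_topology}"
  assumes "f \<in> borel_measurable mu"
  shows "integral\<^sup>L mu f = integral\<^sup>L lborel (\<lambda>y. indicator slab y *\<^sub>R f (proj y))"
proof -
  have "integral\<^sup>L mu f = integral\<^sup>L (restrict_space lborel slab) (\<lambda>y. f (proj y))"
    using assms unfolding mu_def by (intro integral_distr) (auto simp: measurable_mu simp flip: mu_def)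
  also have "\<dots> = integral\<^sup>L lborel (\<lambda>y. indicator slab y *\<^sub>R f (proj y))"
    by (rule integral_restrict_space) simp
  finally show ?thesis .
qed

lemma emeasure_mu:
  assumes "A \<in> sets mu"
  shows "emeasure mu A = emeasure lborel (slab \<inter> proj -` A)"
proof -
  have "emeasure mu A = emeasure (restrict_space lborel slab) (proj -` A \<inter> slab)"
    using assms unfolding mu_def
    by (subst emeasure_distr) (auto simp: space_restrict_space Int_commute)
  also have "\<dots> = emeasure lborel (slab \<inter> proj -` A)"
    by (subst emeasure_restrict_space) (auto simp: Int_commute)
  finally show ?thesis .
qed

lemma shift_measurable:
  assumes "a \<in> M"
  shows "(\<lambda>y. y + a) \<in> measurable mu mu"
proof -
  have "(\<lambda>y. y + a) \<in> measurable (restrict_space borel M) (restrict_space borel M)"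
    by (rule measurable_restrict_space3)
       (use assms subspace_M in \<open>auto simp: subspace_add intro!: borel_measurable_continuous_onI continuous_intros\<close>)
  then show ?thesis
    using measurable_cong_sets[OF sets_mu sets_mu] by blast
qed

lemma integral_mu_shift:
  fixes f :: "'a \<Rightarrow> 'c::{banach, second_countable_topology}"
  assumes f: "f \<in> borel_measurable mu" and a: "a \<in> M"
  shows "integral\<^sup>L mu (\<lambda>y. f (y + a)) = integral\<^sup>L mu f"
proof -
  let ?h = "\<lambda>y. indicator slab y *\<^sub>R f (proj y)"
  have fa: "(\<lambda>y. f (y + a)) \<in> borel_measurable mu"
    using measurable_compose[OF shift_measurable[OF a] f] .
  have [measurable]: "(\<lambda>y. f (proj y)) \<in> borel_measurable borel"
    using measurable_compose[OF proj_measurable] f by (simp add: measurable_mu)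
  have slab: "indicator slab (a + y) = (indicator slab y :: real)" for y
    by (simp add: slab_def indicator_def proj_add proj_M[OF a])
  have "integral\<^sup>L mu (\<lambda>y. f (y + a)) = integral\<^sup>L lborel (\<lambda>y. ?h (a + y))"
    unfolding integral_mu[OF fa] slab by (simp add: proj_add proj_M[OF a] add.commute)
  also have "\<dots> = integral\<^sup>L (distr lborel borel ((+) a)) ?h"
    by (subst integral_distr) auto
  also have "\<dots> = integral\<^sup>L mu f"
    unfolding lborel_distr_plus integral_mu[OF f] ..
  finally show ?thesis .
qed

lemma ball_sets_mu: "{y \<in> M. norm y \<le> r} \<in> sets mu"
proof -
  have "{y \<in> M. norm y \<le> r} = M \<inter> cball 0 r" by auto
  also have "\<dots> \<in> sets mu"
    unfolding sets_mu by (simp add: sets_restrict_space)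
  finally show ?thesis .
qed

lemma emeasure_mu_ball: "emeasure mu {y \<in> M. norm y \<le> r} < \<infinity>"
proof -
  have "slab \<inter> proj -` {y \<in> M. norm y \<le> r} \<subseteq> cball 0 (r + 1)"
  proof
    fix y assume "y \<in> slab \<inter> proj -` {y \<in> M. norm y \<le> r}"
    then show "y \<in> cball 0 (r + 1)"
      using norm_triangle_ineq[of "y - proj y" "proj y"] by (simp add: slab_def)
  qed
  then have "emeasure lborel (slab \<inter> proj -` {y \<in> M. norm y \<le> r}) \<le> emeasure lborel (cball (0::'a) (r + 1))"
    by (intro emeasure_mono) auto
  also have "\<dots> < \<infinity>" by (rule emeasure_lborel_cball_finite)
  finally show ?thesis
    by (simp add: emeasure_mu[OF ball_sets_mu])
qed

lemma integrable_mu_bounded: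
  fixes f :: "'a \<Rightarrow> 'c::{banach, second_countable_topology}"
  assumes "f \<in> borel_measurable mu"
    and "\<And>y. y \<in> M \<Longrightarrow> norm y \<le> r \<Longrightarrow> norm (f y) \<le> B"
    and "\<And>y. y \<in> M \<Longrightarrow> r < norm y \<Longrightarrow> f y = 0"
  shows "integrable mu f"
  by (rule integrableI_bounded_set[OF ball_sets_mu[of r] assms(1) emeasure_mu_ball, of B])
     (use assms in \<open>auto simp: space_mu not_le intro!: AE_I2\<close>)

lemma compact_ball_M: "compact {y \<in> M. norm y \<le> r}"
proof -
  have "{y \<in> M. norm y \<le> r} = M \<inter> cball 0 r" by auto
  then show ?thesis
    using closed_M by (simp add: closed_Int_compact)
qed

lemma bounded_on_ball_M:
  fixes f :: "'a \<Rightarrow> 'c::real_normed_vector"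
  assumes "continuous_on {y \<in> M. norm y \<le> r} f"
  obtains B where "0 \<le> B" "\<And>y. y \<in> M \<Longrightarrow> norm y \<le> r \<Longrightarrow> norm (f y) \<le> B"
proof -
  have "bounded (f ` {y \<in> M. norm y \<le> r})"
    by (rule compact_imp_bounded[OF compact_continuous_image[OF assms compact_ball_M]])
  then obtain B where "\<And>y. y \<in> M \<Longrightarrow> norm y \<le> r \<Longrightarrow> norm (f y) \<le> B"
    unfolding bounded_iff by blast
  then show thesis
    by (intro that[of "max 0 B"]) (auto simp: le_max_iff_disj)
qed

lemma integrable_mu_continuous:
  fixes f :: "'a \<Rightarrow> 'c::{banach, second_countable_topology}"
  assumes f: "continuous_on M f" and "\<And>y. y \<in> M \<Longrightarrow> r < norm y \<Longrightarrow> f y = 0"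
  shows "integrable mu f"
proof -
  obtain B where "\<And>y. y \<in> M \<Longrightarrow> norm y \<le> r \<Longrightarrow> norm (f y) \<le> B"
    using bounded_on_ball_M[OF continuous_on_subset[OF f], of r] by blast
  then show ?thesis
    using assms by (intro integrable_mu_bounded[of f r B] continuous_imp_measurable_mu) auto
qed

lemma integral_mu_pos:
  fixes f :: "'a \<Rightarrow> real"
  assumes f: "continuous_on M f" "\<And>y. y \<in> M \<Longrightarrow> 0 \<le> f y" and int: "integrable mu f"
    and x: "x \<in> M" "0 < f x"
  shows "0 < integral\<^sup>L mu f"
proof -
  let ?P = "{y \<in> M. 0 < f y}"
  have AE_nonneg: "AE y in mu. 0 \<le> f y"
    using f(2) by (intro AE_I2) (simp add: space_mu)
  have meas: "f \<in> borel_measurable mu"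
    by (rule continuous_imp_measurable_mu[OF f(1)])
  have P: "?P \<in> sets mu"
    using borel_measurable_le[of "\<lambda>_. 0", OF _ meas] measurable_sets[OF meas, of "{0<..}"]
    by (simp add: space_mu vimage_def Int_def conj_commute)
  \<comment> \<open>The strict inequality for the distance to \<open>M\<close> makes the thickened
    set open in the whole algebra, where nonempty open sets have positive Lebesgue measure.\<close>
  have open_P: "open {y. norm (y - proj y) < 1 \<and> 0 < f (proj y)}"
    by (intro open_Collect_conj open_Collect_less continuous_intros continuous_proj
        continuous_on_compose2[OF f(1) continuous_proj]) (auto simp: proj_in_M)
  have "0 < emeasure lborel {y. norm (y - proj y) < 1 \<and> 0 < f (proj y)}"
    by (rule emeasure_lborel_open_pos[OF open_P]) (use x in \<open>auto simp: proj_M intro!: exI[of _ x]\<close>)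
  also have "\<dots> \<le> emeasure lborel (slab \<inter> proj -` ?P)"
  proof (rule emeasure_mono)
    show "slab \<inter> proj -` ?P \<in> sets lborel"
      using measurable_sets[OF proj_measurable, of ?P] P by (simp add: sets_mu)
  qed (auto simp: slab_def proj_in_M)
  also have "\<dots> = emeasure mu ?P"
    by (rule emeasure_mu[OF P, symmetric])
  finally have pos: "0 < emeasure mu ?P" .
  have "integral\<^sup>L mu f \<noteq> 0"
  proof
    assume "integral\<^sup>L mu f = 0"
    then have "AE y in mu. f y = 0"
      using integral_nonneg_eq_0_iff_AE[OF int AE_nonneg] by simp
    then have "AE y in mu. y \<notin> ?P" by eventually_elim auto
    then have "emeasure mu ?P = 0"
      using P by (subst (asm) AE_iff_measurable[OF P]) (auto simp: space_mu)
    with pos show False by simp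
  qed
  moreover have "0 \<le> integral\<^sup>L mu f"
    by (rule integral_nonneg_AE[OF AE_nonneg])
  ultimately show ?thesis by simp
qed

text \<open>By translation invariance the integral of \<open>F (y + t w)\<close> does not depend on
  \<open>t\<close>, and its derivative at \<open>t = 0\<close> is the integral of \<open>F'\<close>.
  This is the form of the divergence theorem behind the Cauchy formula.\<close>

lemma integral_line_deriv_eq_0:
  fixes F F' :: "'a \<Rightarrow> 'c::euclidean_space"
  assumes w: "w \<in> M"
    and deriv: "\<And>y. y \<in> M \<Longrightarrow> ((\<lambda>t. F (y + t *\<^sub>R w)) has_vector_derivative F' y) (at 0)"
    and F: "continuous_on M F" "\<And>y. y \<in> M \<Longrightarrow> r < norm y \<Longrightarrow> F y = 0"
    and F': "continuous_on M F'" "\<And>y. y \<in> M \<Longrightarrow> r < norm y \<Longrightarrow> F' y = 0"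
  shows "integral\<^sup>L mu F' = 0"
proof -
  obtain B where B: "0 \<le> B" "\<And>y. y \<in> M \<Longrightarrow> norm y \<le> r \<Longrightarrow> norm (F' y) \<le> B"
    using bounded_on_ball_M[OF continuous_on_subset[OF F'(1)], of r] by blast
  have B': "norm (F' y) \<le> B" if "y \<in> M" for y
    using B F'(2)[OF that] that by (cases "norm y \<le> r") auto
  have in_M: "y + t *\<^sub>R w \<in> M" if "y \<in> M" for y t
    using that w subspace_M by (simp add: subspace_add subspace_scale)
  have shift_int: "integrable mu F"
    by (rule integrable_mu_continuous[OF F])
  have meas: "F \<in> borel_measurable mu" by (rule continuous_imp_measurable_mu[OF F(1)])
  \<comment> \<open>For \<open>|t| < 1\<close> all translates vanish beyond radius \<open>R\<close>,
    so one indicator function dominates them.\<close>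
  define R where "R = r + norm w"
  have far: "r < norm (y + t *\<^sub>R w)" if "\<bar>t\<bar> < 1" "R < norm y" for t y
  proof -
    have "norm (t *\<^sub>R w) \<le> norm w"
      using that(1) by (simp add: mult_left_le_one_le)
    then show ?thesis
      using that(2) norm_triangle_ineq4[of "y + t *\<^sub>R w" "t *\<^sub>R w"] by (simp add: R_def)
  qed
  have "((\<lambda>t. integral\<^sup>L mu (\<lambda>y. F (y + t *\<^sub>R w))) has_vector_derivative
      integral\<^sup>L mu (\<lambda>y. F' (y + 0 *\<^sub>R w))) (at 0)"
  proof (rule has_vector_derivative_integral[where \<eta> = 1 and w = "\<lambda>y. indicator {y \<in> M. norm y \<le> R} y * B"
        and k' = "\<lambda>t y. F' (y + t *\<^sub>R w)"])
    show "integrable mu (\<lambda>y. F (y + t *\<^sub>R w))" if "\<bar>t\<bar> < 1" for t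
      by (rule integrable_mu_continuous[where r = R])
         (use in_M far[OF that] F(2) in \<open>auto intro!: continuous_on_compose2[OF F(1)] continuous_intros\<close>)
    show "((\<lambda>s. F (y + s *\<^sub>R w)) has_vector_derivative F' (y + t *\<^sub>R w)) (at t)"
      if "y \<in> space mu" for t y
      using deriv[OF in_M, of y t] that by (simp add: space_mu has_vector_derivative_shift_line[of F y w])
    show "norm (F' (y + t *\<^sub>R w)) \<le> indicator {y \<in> M. norm y \<le> R} y * B"
      if "\<bar>t\<bar> < 1" "y \<in> space mu" for t y
    proof (cases "norm y \<le> R")
      case True
      then show ?thesis using B' in_M that by (simp add: space_mu)
    next
      case False
      then show ?thesis using F'(2) in_M far[OF that(1)] that by (simp add: space_mu)
    qed
    show "integrable mu (\<lambda>y. indicator {y \<in> M. norm y \<le> R} y * B)"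
      using emeasure_mu_ball[of R] ball_sets_mu[of R]
      by (intro integrable_mult_left) (simp add: integrable_indicator_iff)
  qed (use F'(1) in \<open>auto intro: continuous_imp_measurable_mu\<close>)
  moreover have "integral\<^sup>L mu (\<lambda>y. F (y + t *\<^sub>R w)) = integral\<^sup>L mu F" for t
    using integral_mu_shift[OF meas, of "t *\<^sub>R w"] w subspace_M by (simp add: subspace_scale)
  ultimately have "((\<lambda>t::real. integral\<^sup>L mu F) has_vector_derivative integral\<^sup>L mu F') (at 0)"
    by simp
  then show ?thesis
    using vector_derivative_unique_at has_vector_derivative_const by blast
qed

end

section \<open>The Cauchy formula\<close>

context hypercomplex_frame
begin

lemma norm_v: "s \<le> m \<Longrightarrow> norm (v s) = 1"
  using inner_v[of s s] by (simp add: norm_eq_sqrt_inner)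

lemma line_in_M: "y \<in> M \<Longrightarrow> w \<in> M \<Longrightarrow> y + t *\<^sub>R w \<in> M"
  using subspace_M by (simp add: subspace_add subspace_scale)

lemma add_in_M: "y \<in> M \<Longrightarrow> x \<in> M \<Longrightarrow> y + x \<in> M"
  and diff_in_M: "y \<in> M \<Longrightarrow> x \<in> M \<Longrightarrow> y - x \<in> M"
  using subspace_M by (simp_all add: subspace_add subspace_diff)

lemma relatively_openE:
  assumes "openin (top_of_set M) U" "x \<in> U"
  obtains e where "0 < e" "\<And>y. y \<in> M \<Longrightarrow> norm (y - x) < e \<Longrightarrow> y \<in> U"
  using assms unfolding openin_euclidean_subtopology_iff dist_norm by blast

text \<open>Functions are controlled only in the ball of radius \<rho>, while integration runs over
  all of \<open>M\<close>. A cut-off product is constant on the relatively open set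
  \<open>b < y \<bullet> y\<close>, which together with the ball covers \<open>M\<close>.\<close>

lemma continuous_on_M_extend:
  fixes h :: "'a \<Rightarrow> 'c::topological_space"
  assumes h: "continuous_on {y \<in> M. norm y < \<rho>} h" and b: "b < \<rho>\<^sup>2" "0 < \<rho>"
    and 0: "\<And>y. y \<in> M \<Longrightarrow> b \<le> y \<bullet> y \<Longrightarrow> h y = c"
  shows "continuous_on M h"
proof -
  let ?S = "{y \<in> M. norm y < \<rho>}" and ?T = "{y \<in> M. b < y \<bullet> y}"
  have "\<rho>\<^sup>2 \<le> y \<bullet> y" if "\<not> norm y < \<rho>" for y :: 'a
    using that b by (simp add: power2_norm_eq_inner[symmetric] power_mono)
  then have M: "M = ?S \<union> ?T" using b by force
  have "?S = M \<inter> {y. norm y < \<rho>}" "?T = M \<inter> {y. b < y \<bullet> y}" by auto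
  moreover have "open {y::'a. norm y < \<rho>}" "open {y::'a. b < y \<bullet> y}"
    by (intro open_Collect_less continuous_intros)+
  ultimately have "openin (top_of_set M) ?S" "openin (top_of_set M) ?T"
    by (metis openin_open_Int)+
  moreover have "continuous_on ?T h"
    by (rule continuous_on_eq[OF continuous_on_const[of _ c]]) (use 0 in auto)
  ultimately show ?thesis
    using h M continuous_on_Un_local_open[of ?S ?T h] by metis
qed

text \<open>The factor 2 stems from differentiating \<open>y \<bullet> y\<close>: the cutoff of
  \<open>y \<bullet> y\<close> has derivative \<open>- weight a b y * (y \<bullet> v s)\<close>
  along \<open>v s\<close>.\<close>

definition weight :: "real \<Rightarrow> real \<Rightarrow> 'a \<Rightarrow> real" where
  "weight a b y = 2 * cutoff' a b (y \<bullet> y)"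

definition shell_density :: "real \<Rightarrow> real \<Rightarrow> ('a \<Rightarrow> 'a) \<Rightarrow> 'a \<Rightarrow> 'a" where
  "shell_density a b f y = weight a b y *\<^sub>R (y * f y)"

definition total :: "real \<Rightarrow> real \<Rightarrow> real" where
  "total a b = integral\<^sup>L mu (\<lambda>y. weight a b y * (y \<bullet> y) powr (1 - alpha))"

lemma continuous_weight: "continuous_on S (weight a b)"
  unfolding weight_def by (intro continuous_intros continuous_on_compose2[OF continuous_cutoff'[of UNIV]]) auto

lemma weight_nonneg: "0 \<le> weight a b y"
  by (simp add: weight_def cutoff'_nonneg)

lemma continuous_mass: "0 < \<delta> \<Longrightarrow> continuous_on S (mass \<delta>)"
  unfolding mass_def by (intro continuous_intros) (auto simp: add_nonneg_eq_0_iff)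

lemma continuous_ker_UNIV: "0 < \<delta> \<Longrightarrow> continuous_on S (ker \<delta>)"
  by (rule continuous_on_subset[OF continuous_ker]) (auto simp: add_nonneg_pos)

lemma continuous_ker1_UNIV: "0 < \<delta> \<Longrightarrow> continuous_on S (ker1 \<delta> w)"
  by (rule continuous_on_subset[OF continuous_ker1]) (auto simp: add_nonneg_pos)

end

text \<open>The centre is moved to the origin, and the partial derivatives are a parameter
  \<open>D\<close>, so that the constant function 1 is an instance with \<open>D\<close> equal to 0.
  The numbers \<open>a\<close> and \<open>b\<close> are squares of radii, \<rho> is a
  radius.\<close>

locale monogenic_ball = hypercomplex_frame M v m
  for M :: "'a::{real_algebra_1, euclidean_space} set" and v m +
  fixes f :: "'a \<Rightarrow> 'a" and D :: "nat \<Rightarrow> 'a \<Rightarrow> 'a" and \<rho> a b :: real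
  assumes a_pos: "0 < a" and a_less_b: "a < b" and b_less: "b < \<rho>\<^sup>2" and \<rho>_pos: "0 < \<rho>"
    and deriv: "s \<le> m \<Longrightarrow> y \<in> M \<Longrightarrow> norm y < \<rho> \<Longrightarrow>
      ((\<lambda>t. f (y + t *\<^sub>R v s)) has_vector_derivative D s y) (at 0)"
    and continuous_D: "s \<le> m \<Longrightarrow> continuous_on {y \<in> M. norm y < \<rho>} (D s)"
    and continuous_f: "continuous_on {y \<in> M. norm y < \<rho>} f"
    and monogenic: "y \<in> M \<Longrightarrow> norm y < \<rho> \<Longrightarrow> (\<Sum>s\<le>m. v s * D s y) = 0"
begin

definition chi :: "'a \<Rightarrow> real" where "chi y = cutoff a b (y \<bullet> y)"

definition cut_fun :: "'a \<Rightarrow> 'a" where "cut_fun y = chi y *\<^sub>R f y"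

definition cut_deriv :: "nat \<Rightarrow> 'a \<Rightarrow> 'a" where
  "cut_deriv s y = chi y *\<^sub>R D s y - (weight a b y * (y \<bullet> v s)) *\<^sub>R f y"

lemma continuous_chi: "continuous_on S chi"
  unfolding chi_def by (intro continuous_intros continuous_on_compose2[OF continuous_cutoff[of UNIV]]) auto

lemma outside: "b \<le> y \<bullet> y \<Longrightarrow> chi y = 0" "b \<le> y \<bullet> y \<Longrightarrow> weight a b y = 0"
  using a_less_b by (simp_all add: chi_def weight_def cutoff_eq_0 cutoff'_eq_0)

lemma inside: "y \<bullet> y \<le> a \<Longrightarrow> chi y = 1" "y \<bullet> y \<le> a \<Longrightarrow> weight a b y = 0"
  by (simp_all add: chi_def weight_def cutoff_eq_1 cutoff'_eq_0')

lemma sqrt_outside: "sqrt b < norm y \<Longrightarrow> b \<le> y \<bullet> y"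
  using real_sqrt_less_iff[of b "y \<bullet> y"] by (simp add: norm_eq_sqrt_inner)

lemma continuous_cut_fun: "continuous_on M cut_fun"
  by (rule continuous_on_M_extend[where \<rho> = \<rho> and b = b and c = 0])
     (use b_less \<rho>_pos in \<open>auto simp: cut_fun_def outside intro!: continuous_intros continuous_chi continuous_f\<close>)

lemma continuous_cut_deriv: "s \<le> m \<Longrightarrow> continuous_on M (cut_deriv s)"
  by (rule continuous_on_M_extend[where \<rho> = \<rho> and b = b and c = 0])
     (use b_less \<rho>_pos in \<open>auto simp: cut_deriv_def[abs_def] outside
        intro!: continuous_intros continuous_chi continuous_weight continuous_f continuous_D\<close>)

lemma continuous_shell_density: "continuous_on M (shell_density a b f)"
  by (rule continuous_on_M_extend[where \<rho> = \<rho> and b = b and c = 0])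
     (use b_less \<rho>_pos in \<open>auto simp: shell_density_def[abs_def] outside
        intro!: continuous_intros continuous_on_times continuous_weight continuous_f\<close>)

lemma shell_density_outside: "sqrt b < norm y \<Longrightarrow> shell_density a b f y = 0"
  by (simp add: shell_density_def outside sqrt_outside)

lemma far:
  assumes "\<not> norm y < \<rho>" shows "b < y \<bullet> y"
proof -
  have "\<rho>\<^sup>2 \<le> y \<bullet> y"
    using assms \<rho>_pos by (simp add: power2_norm_eq_inner[symmetric] power_mono)
  then show ?thesis using b_less by simp
qed

lemma cut_fun_deriv:
  assumes s: "s \<le> m" and y: "y \<in> M"
  shows "((\<lambda>t. cut_fun (y + t *\<^sub>R v s)) has_vector_derivative cut_deriv s y) (at 0)"
proof (cases "norm y < \<rho>")
  case True
  have eq: "(y + t *\<^sub>R v s) \<bullet> (y + t *\<^sub>R v s) = y \<bullet> y + 2 * t * (y \<bullet> v s) + t\<^sup>2" for t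
    using inner_v[OF s s] by (simp add: inner_add_left inner_add_right inner_commute power2_eq_square)
  have "((\<lambda>t. y \<bullet> y + 2 * t * (y \<bullet> v s) + t\<^sup>2) has_real_derivative 2 * (y \<bullet> v s)) (at 0)"
    by (auto intro!: derivative_eq_intros)
  from DERIV_chain2[OF DERIV_cutoff this, of a b]
  have "((\<lambda>t. chi (y + t *\<^sub>R v s)) has_real_derivative - (weight a b y * (y \<bullet> v s))) (at 0)"
    by (simp add: chi_def eq weight_def mult.assoc mult.left_commute)
  from has_vector_derivative_scaleR[OF this deriv[OF s y True]]
  show ?thesis by (simp add: cut_fun_def cut_deriv_def)
next
  case False
  have "((\<lambda>t. 0) has_vector_derivative (0::'a)) (at (0::real))" by simp
  then have "((\<lambda>t. cut_fun (y + t *\<^sub>R v s)) has_vector_derivative 0) (at 0)"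
  proof (rule has_vector_derivative_transform_within_open)
    show "open {t. b < (y + t *\<^sub>R v s) \<bullet> (y + t *\<^sub>R v s)}"
      by (intro open_Collect_less continuous_intros)
  qed (use far[OF False] in \<open>auto simp: cut_fun_def outside\<close>)
  then show ?thesis using far[OF False] by (simp add: cut_deriv_def outside)
qed

lemma sum_cut_deriv: "y \<in> M \<Longrightarrow> (\<Sum>s\<le>m. v s * cut_deriv s y) = - shell_density a b f y"
proof (cases "norm y < \<rho>")
  case True
  assume y: "y \<in> M"
  have "(\<Sum>s\<le>m. v s * cut_deriv s y) = chi y *\<^sub>R (\<Sum>s\<le>m. v s * D s y) -
      weight a b y *\<^sub>R ((\<Sum>s\<le>m. (y \<bullet> v s) *\<^sub>R v s) * f y)"
    by (simp add: cut_deriv_def algebra_simps sum_subtractf scaleR_sum_right sum_distrib_right)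
  then show ?thesis
    using monogenic[OF y True] expand[OF y] by (simp add: shell_density_def)
next
  case False
  then show ?thesis using far[OF False] by (simp add: cut_deriv_def shell_density_def outside)
qed

text \<open>For each \<open>s\<close> the product \<open>ker * v s * cut_fun\<close> has bounded
  support, so its derivative along \<open>v s\<close> integrates to 0. Summed over \<open>s\<close>,
  the derivatives of the kernel give \<open>mass\<close> and those of \<open>cut_fun\<close> the
  negative shell density.\<close>

lemma regularized_formula:
  assumes \<delta>: "0 < \<delta>" and x: "x \<in> M"
  shows "integral\<^sup>L mu (\<lambda>y. mass \<delta> (y - x) *\<^sub>R cut_fun y) = integral\<^sup>L mu (\<lambda>y. ker \<delta> (y - x) * shell_density a b f y)"
proof -
  let ?k = "\<lambda>s y. ker \<delta> (y - x) * v s * cut_fun y"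
  let ?k' = "\<lambda>s y. ker1 \<delta> (v s) (y - x) * v s * cut_fun y + ker \<delta> (y - x) * v s * cut_deriv s y"
  have cont: "continuous_on M (\<lambda>y. ker \<delta> (y - x))" "continuous_on M (\<lambda>y. ker1 \<delta> w (y - x))"
     "continuous_on M (\<lambda>y. mass \<delta> (y - x))" for w
    using continuous_ker_UNIV[OF \<delta>, of UNIV] continuous_ker1_UNIV[OF \<delta>, of UNIV w] continuous_mass[OF \<delta>, of UNIV]
    by (auto intro!: continuous_on_compose2[of UNIV _ M "\<lambda>y. y - x"] continuous_intros)
  have k'_cont: "continuous_on M (?k' s)" if "s \<le> m" for s
    by (intro continuous_intros continuous_on_times cont continuous_cut_fun continuous_cut_deriv[OF that])
  have zero: "cut_fun y = 0" "cut_deriv s y = 0" "shell_density a b f y = 0" if "sqrt b < norm y" for y s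
    using sqrt_outside[OF that] by (simp_all add: cut_fun_def cut_deriv_def shell_density_def outside)
  have "integral\<^sup>L mu (?k' s) = 0" if s: "s \<le> m" for s
  proof (rule integral_line_deriv_eq_0[where r = "sqrt b", OF v_in_M[OF s]])
    fix y assume y: "y \<in> M"
    have "0 < (y - x) \<bullet> (y - x) + \<delta>" using \<delta> by (simp add: add_nonneg_pos)
    from has_vector_derivative_times[OF has_vector_derivative_times_const(1)[OF ker_line_deriv[OF this, of "v s"]]
        cut_fun_deriv[OF s y], of "v s"]
    show "((\<lambda>t. ?k s (y + t *\<^sub>R v s)) has_vector_derivative ?k' s y) (at 0)"
      by (simp add: algebra_simps)
  qed (use zero k'_cont[OF s] in \<open>auto intro!: continuous_on_times continuous_intros cont continuous_cut_fun\<close>)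
  then have "0 = (\<Sum>s\<le>m. integral\<^sup>L mu (?k' s))" by simp
  also have "\<dots> = integral\<^sup>L mu (\<lambda>y. \<Sum>s\<le>m. ?k' s y)"
    by (rule Bochner_Integration.integral_sum[symmetric], rule integrable_mu_continuous[where r = "sqrt b"])
       (use zero k'_cont in auto)
  also have "\<dots> = integral\<^sup>L mu (\<lambda>y. mass \<delta> (y - x) *\<^sub>R cut_fun y - ker \<delta> (y - x) * shell_density a b f y)"
  proof (rule Bochner_Integration.integral_cong[OF refl])
    fix y assume "y \<in> space mu"
    then have y: "y \<in> M" by (simp add: space_mu)
    have "(\<Sum>s\<le>m. ?k' s y) = (\<Sum>s\<le>m. ker1 \<delta> (v s) (y - x) * v s) * cut_fun y + ker \<delta> (y - x) * (\<Sum>s\<le>m. v s * cut_deriv s y)"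
      by (simp add: sum.distrib sum_distrib_left sum_distrib_right mult.assoc)
    then show "(\<Sum>s\<le>m. ?k' s y) = mass \<delta> (y - x) *\<^sub>R cut_fun y - ker \<delta> (y - x) * shell_density a b f y"
      using sum_ker1[OF diff_in_M[OF y x], of \<delta>] sum_cut_deriv[OF y] \<delta> by (simp add: add_nonneg_pos)
  qed
  also have "\<dots> = integral\<^sup>L mu (\<lambda>y. mass \<delta> (y - x) *\<^sub>R cut_fun y) - integral\<^sup>L mu (\<lambda>y. ker \<delta> (y - x) * shell_density a b f y)"
    by (rule Bochner_Integration.integral_diff; rule integrable_mu_continuous[where r = "sqrt b"])
       (use zero in \<open>auto intro!: continuous_intros continuous_on_times cont continuous_cut_fun continuous_shell_density\<close>)
  finally show ?thesis by simp
qed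

lemma norm_ge_outside: 
  assumes "x \<bullet> x < a" "shell_density a b f y \<noteq> 0"
  shows "sqrt a - norm x \<le> norm (y - x)"
proof -
  have "a < y \<bullet> y"
    using assms(2) inside(2)[of y] by (force simp: shell_density_def)
  then have "sqrt a \<le> norm y" by (simp add: norm_eq_sqrt_inner)
  then show ?thesis using norm_triangle_ineq2[of y x] by simp
qed

lemma gap_pos: "x \<bullet> x < a \<Longrightarrow> 0 < sqrt a - norm x"
  by (simp add: norm_eq_sqrt_inner)

text \<open>The density lives where \<open>a < y \<bullet> y\<close>, so \<open>y - x\<close> keeps
  the distance \<open>sqrt a - norm x\<close> from the singularity; this bounds the regularized
  kernels uniformly in \<open>n\<close>.\<close>

lemma kernel_limit:
  assumes x: "x \<in> M" "x \<bullet> x < a"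
  shows "(\<lambda>n. integral\<^sup>L mu (\<lambda>y. ker (1 / real (Suc n)) (y - x) * shell_density a b f y))
      \<longlonglongrightarrow> integral\<^sup>L mu (\<lambda>y. ker 0 (y - x) * shell_density a b f y)"
proof -
  obtain K where K: "0 < K" "\<And>a b::'a. norm (a * b) \<le> norm a * norm b * K"
    using bounded_bilinear.pos_bounded[OF bounded_bilinear_times] by blast
  define \<eta> where "\<eta> = sqrt a - norm x"
  have \<eta>: "0 < \<eta>" using gap_pos[OF x(2)] by (simp add: \<eta>_def)
  have cont: "continuous_on M (\<lambda>y. ker (1 / real (Suc n)) (y - x))" for n
    using continuous_ker_UNIV[of "1 / real (Suc n)" UNIV]
    by (auto intro!: continuous_on_compose2[of UNIV _ M "\<lambda>y. y - x"] continuous_intros)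
  have meas: "(\<lambda>y. ker (1 / real (Suc n)) (y - x) * shell_density a b f y) \<in> borel_measurable mu" for n
    by (intro continuous_imp_measurable_mu continuous_on_times cont continuous_shell_density)
  have lim: "(\<lambda>n. ker (1 / real (Suc n)) (y - x) * shell_density a b f y) \<longlonglongrightarrow> ker 0 (y - x) * shell_density a b f y" for y
  proof (cases "shell_density a b f y = 0")
    case False
    then have "y - x \<noteq> 0" using norm_ge_outside[OF x(2) False] \<eta> by (auto simp: \<eta>_def)
    moreover have "(\<lambda>n. 1 / real (Suc n)) \<longlonglongrightarrow> 0"
      using LIMSEQ_inverse_real_of_nat by (simp only: inverse_eq_divide)
    ultimately show ?thesis
      unfolding ker_def
      by (intro tendsto_times tendsto_scaleR tendsto_const tendsto_powr tendsto_add) auto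
  qed simp
  show ?thesis
  proof (rule integral_dominated_convergence)
    let ?w = "\<lambda>y. K * (\<eta>\<^sup>2) powr (- alpha) * ((norm y + norm x) * norm (shell_density a b f y))"
    show "integrable mu ?w"
      by (rule integrable_mu_continuous[where r = "sqrt b"])
         (auto simp: shell_density_outside intro!: continuous_intros continuous_shell_density)
    show "AE y in mu. norm (ker (1 / real (Suc n)) (y - x) * shell_density a b f y) \<le> ?w y" for n
    proof (rule AE_I2)
      fix y
      show "norm (ker (1 / real (Suc n)) (y - x) * shell_density a b f y) \<le> ?w y"
      proof (cases "shell_density a b f y = 0")
        case False
        have "\<eta>\<^sup>2 \<le> (norm (y - x))\<^sup>2"
          using norm_ge_outside[OF x(2) False] \<eta> by (intro power_mono) (auto simp: \<eta>_def)
        also have "\<dots> \<le> (y - x) \<bullet> (y - x) + 1 / real (Suc n)" by (simp add: power2_norm_eq_inner)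
        finally have "((y - x) \<bullet> (y - x) + 1 / real (Suc n)) powr (- alpha) \<le> (\<eta>\<^sup>2) powr (- alpha)"
          using \<eta> by (intro powr_mono2') (auto simp: alpha_def)
        then have "norm (ker (1 / real (Suc n)) (y - x)) \<le> (\<eta>\<^sup>2) powr (- alpha) * (norm y + norm x)"
          unfolding ker_def norm_scaleR norm_cj using norm_triangle_ineq4[of y x] by (intro mult_mono) auto
        then have "norm (ker (1 / real (Suc n)) (y - x)) * norm (shell_density a b f y) * K \<le>
            (\<eta>\<^sup>2) powr (- alpha) * (norm y + norm x) * norm (shell_density a b f y) * K"
          using K(1) by (intro mult_right_mono) auto
        with K(2) show ?thesis by (fastforce simp: mult_ac intro: order_trans)
      qed simp
    qed
    show "(\<lambda>y. ker 0 (y - x) * shell_density a b f y) \<in> borel_measurable mu"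
      using borel_measurable_LIMSEQ_metric[OF meas lim] .
  qed (use meas lim in auto)
qed


text \<open>The limit of the mass against the cutoff is kept as an unknown \<open>T\<close>. After a
  shift, \<open>cut_fun (y + x)\<close> is compared with \<open>chi y *\<^sub>R cut_fun x\<close>
  and not with the constant \<open>cut_fun x\<close>: then the difference \<open>H\<close> has
  bounded support, and the subtracted integral is the one that tends to \<open>T\<close>.\<close>

lemma concentration:
  assumes x: "x \<in> M" "x \<bullet> x < a"
    and T: "(\<lambda>n. integral\<^sup>L mu (\<lambda>y. mass (1 / real (Suc n)) y * chi y)) \<longlonglongrightarrow> T"
  shows "(\<lambda>n. integral\<^sup>L mu (\<lambda>y. mass (1 / real (Suc n)) (y - x) *\<^sub>R cut_fun y)) \<longlonglongrightarrow> T *\<^sub>R f x"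
proof -
  define dl where "dl n = 1 / real (Suc n)" for n
  have dl: "0 < dl n" for n by (simp add: dl_def)
  have dl_lim: "dl \<longlonglongrightarrow> 0"
    unfolding dl_def using LIMSEQ_inverse_real_of_nat by (simp only: inverse_eq_divide)
  define H where "H y = cut_fun (y + x) - chi y *\<^sub>R cut_fun x" for y
  define r where "r = sqrt b + norm x"
  have H_cont: "continuous_on M H"
    unfolding H_def using x(1)
    by (intro continuous_intros continuous_on_compose2[OF continuous_cut_fun] continuous_chi) (auto intro: add_in_M)
  have H_zero: "H y = 0" if "r < norm y" for y
  proof -
    have "sqrt b < norm (y + x)"
      using that norm_triangle_ineq4[of "y + x" x] by (simp add: r_def)
    moreover have "sqrt b < norm y" using that norm_ge_zero[of x] unfolding r_def by linarith
    ultimately show ?thesis by (simp add: H_def cut_fun_def outside sqrt_outside)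
  qed
  have chi_zero: "chi y = 0" if "r < norm y" for y
  proof -
    have "sqrt b < norm y" using that norm_ge_zero[of x] unfolding r_def by linarith
    then show ?thesis by (simp add: outside sqrt_outside)
  qed
  have "H 0 = 0"
    using a_pos by (simp add: H_def inside)
  have mass_nonneg: "0 \<le> mass (dl n) y" for n y
    using less_imp_le[OF dl[of n]] by (simp add: mass_def)
  have cont_mass: "continuous_on M (mass (dl n))" for n by (rule continuous_mass[OF dl])
  have int_H: "integrable mu (\<lambda>y. mass (dl n) y *\<^sub>R H y)" for n
    by (rule integrable_mu_continuous[where r = r]) (auto intro!: continuous_intros cont_mass H_cont H_zero)
  have int_chi: "integrable mu (\<lambda>y. mass (dl n) y * chi y)" for n
    by (rule integrable_mu_continuous[where r = r]) (auto intro!: continuous_intros cont_mass continuous_chi chi_zero)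
  have int_nH: "integrable mu (\<lambda>y. norm (H y))"
    by (rule integrable_mu_continuous[where r = r]) (auto intro!: continuous_intros H_cont simp: H_zero)
  have T_nonneg: "0 \<le> T"
    by (rule LIMSEQ_le_const[OF T[folded dl_def]])
       (auto intro!: exI[of _ 0] Bochner_Integration.integral_nonneg mult_nonneg_nonneg mass_nonneg simp: chi_def cutoff_nonneg)
  have "(\<lambda>n. integral\<^sup>L mu (\<lambda>y. mass (dl n) y *\<^sub>R H y)) \<longlonglongrightarrow> 0"
    unfolding tendsto_iff dist_norm
  proof (intro allI impI)
    fix e :: real assume e: "0 < e"
    \<comment> \<open>Then \<open>e' * T\<close> is at most \<open>e / 2\<close>; the summand 1
      covers \<open>T = 0\<close>.\<close>
    define e' where "e' = e / (2 * (T + 1))"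
    have e': "0 < e'" using e T_nonneg by (simp add: e'_def)
    have "0 \<in> M" using subspace_M by (rule subspace_0)
    then obtain d0 where d0: "0 < d0" "\<And>y. y \<in> M \<Longrightarrow> norm y < d0 \<Longrightarrow> norm (H y) < e'"
      using H_cont[unfolded continuous_on_iff, rule_format, of 0 e'] e' \<open>H 0 = 0\<close> by (auto simp: dist_norm)
    \<comment> \<open>The bound by \<open>sqrt a\<close> makes the cutoff equal to 1 on the ball of
      radius \<open>d\<close>, whose contribution is thus controlled by the integrals tending to
      \<open>T\<close>.\<close>
    define d where "d = min d0 (sqrt a)"
    have d: "0 < d" using d0(1) a_pos by (simp add: d_def)
    \<comment> \<open>Outside radius \<open>d\<close> the mass is at most a constant times
      \<open>dl n\<close>.\<close>
    define C where "C = (real m + 1) * (d\<^sup>2) powr (- alpha - 1) * integral\<^sup>L mu (\<lambda>y. norm (H y))"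
    have bound: "norm (integral\<^sup>L mu (\<lambda>y. mass (dl n) y *\<^sub>R H y)) \<le>
        e' * integral\<^sup>L mu (\<lambda>y. mass (dl n) y * chi y) + C * dl n" for n
    proof -
      let ?g = "\<lambda>y. e' * (mass (dl n) y * chi y) + (dl n * ((real m + 1) * (d\<^sup>2) powr (- alpha - 1))) * norm (H y)"
      have "norm (integral\<^sup>L mu (\<lambda>y. mass (dl n) y *\<^sub>R H y)) \<le> integral\<^sup>L mu ?g"
      proof (rule Bochner_Integration.integral_norm_bound_integral[OF int_H])
        show "integrable mu ?g" using int_chi int_nH by simp
        fix y assume "y \<in> space mu"
        then have y: "y \<in> M" by (simp add: space_mu)
        have chi: "0 \<le> chi y" by (simp add: chi_def cutoff_nonneg)
        show "norm (mass (dl n) y *\<^sub>R H y) \<le> ?g y"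
        proof (cases "norm y < d")
          case True
          then have "chi y = 1"
            by (intro inside(1)) (use a_pos in \<open>simp add: d_def norm_eq_sqrt_inner\<close>)
          moreover have "mass (dl n) y * norm (H y) \<le> mass (dl n) y * e'"
            using d0(2)[OF y] True by (intro mult_left_mono mass_nonneg) (auto simp: d_def)
          ultimately show ?thesis
            using less_imp_le[OF dl[of n]] mass_nonneg[of n y] by (simp add: mult.commute add_increasing2)
        next
          case False
          then have "d\<^sup>2 \<le> (norm y)\<^sup>2" using d by (intro power_mono) auto
          also have "\<dots> \<le> y \<bullet> y + dl n" using less_imp_le[OF dl[of n]] by (simp add: power2_norm_eq_inner)
          finally have "(y \<bullet> y + dl n) powr (- alpha - 1) \<le> (d\<^sup>2) powr (- alpha - 1)"
            using d by (intro powr_mono2') (auto simp: alpha_def)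
          then have "mass (dl n) y \<le> dl n * ((real m + 1) * (d\<^sup>2) powr (- alpha - 1))"
            using less_imp_le[OF dl[of n]] by (simp add: mass_def mult_left_mono mult_ac)
          then have "mass (dl n) y * norm (H y) \<le> dl n * ((real m + 1) * (d\<^sup>2) powr (- alpha - 1)) * norm (H y)"
            by (intro mult_right_mono) auto
          moreover have "0 \<le> e' * (mass (dl n) y * chi y)"
            using e' mass_nonneg[of n y] chi by simp
          ultimately show ?thesis using mass_nonneg[of n y] by simp
        qed
      qed
      also have "integral\<^sup>L mu ?g = e' * integral\<^sup>L mu (\<lambda>y. mass (dl n) y * chi y) + C * dl n"
        using int_chi int_nH by (simp add: C_def)
      finally show ?thesis .
    qed
    have "(\<lambda>n. e' * integral\<^sup>L mu (\<lambda>y. mass (dl n) y * chi y) + C * dl n) \<longlonglongrightarrow> e' * T + C * 0"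
      by (intro tendsto_intros T[folded dl_def] dl_lim)
    moreover have "e' * T + C * 0 < e"
    proof -
      have "e' * T \<le> e / 2" using e T_nonneg by (simp add: e'_def field_simps)
      then show ?thesis using e by simp
    qed
    ultimately have "\<forall>\<^sub>F n in sequentially. e' * integral\<^sup>L mu (\<lambda>y. mass (dl n) y * chi y) + C * dl n < e"
      by (rule order_tendstoD(2))
    then show "\<forall>\<^sub>F n in sequentially. norm (integral\<^sup>L mu (\<lambda>y. mass (dl n) y *\<^sub>R H y) - 0) < e"
      by eventually_elim (use bound in \<open>auto intro: le_less_trans\<close>)
  qed
  moreover have "integral\<^sup>L mu (\<lambda>y. mass (dl n) y *\<^sub>R H y) =
      integral\<^sup>L mu (\<lambda>y. mass (dl n) (y - x) *\<^sub>R cut_fun y) - integral\<^sup>L mu (\<lambda>y. mass (dl n) y * chi y) *\<^sub>R cut_fun x" for n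
  proof -
    have int_F: "integrable mu (\<lambda>y. mass (dl n) y *\<^sub>R cut_fun (y + x))"
    proof -
      have "integrable mu (\<lambda>y. mass (dl n) y *\<^sub>R H y + (mass (dl n) y * chi y) *\<^sub>R cut_fun x)"
        using int_H int_chi by simp
      then show ?thesis by (simp add: H_def scaleR_diff_right)
    qed
    have meas: "(\<lambda>y. mass (dl n) (y - x) *\<^sub>R cut_fun y) \<in> borel_measurable mu"
      by (intro continuous_imp_measurable_mu continuous_intros continuous_cut_fun
          continuous_on_compose2[OF continuous_mass[OF dl, of UNIV]]) auto
    show ?thesis
      using integral_mu_shift[OF meas x(1)] int_F int_chi
      by (simp add: H_def scaleR_diff_right)
  qed
  ultimately have *: "(\<lambda>n. integral\<^sup>L mu (\<lambda>y. mass (dl n) (y - x) *\<^sub>R cut_fun y)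
      - integral\<^sup>L mu (\<lambda>y. mass (dl n) y * chi y) *\<^sub>R cut_fun x) \<longlonglongrightarrow> 0" by simp
  have Fx: "cut_fun x = f x" using x(2) by (simp add: cut_fun_def inside)
  from tendsto_add[OF * tendsto_scaleR[OF T[folded dl_def] tendsto_const[of "cut_fun x"]]]
  show ?thesis unfolding Fx dl_def by simp
qed

lemma monogenic_ball_one: "monogenic_ball M v m (\<lambda>_. 1) (\<lambda>_ _. 0) \<rho> a b"
  by unfold_locales (use a_pos a_less_b b_less \<rho>_pos in \<open>auto intro!: continuous_intros\<close>)

lemma weight_scaled: "weight a b y *\<^sub>R (ker 0 y * y) = (weight a b y * (y \<bullet> y) powr (1 - alpha)) *\<^sub>R 1" if "y \<in> M"
proof (cases "y = 0")
  case True
  then show ?thesis using inside(2)[of 0] a_pos by simp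
next
  case False
  have "(y \<bullet> y) powr (1 - alpha) = (y \<bullet> y) powr (- alpha) * (y \<bullet> y)"
    using False powr_mult_base[of "y \<bullet> y" "- alpha"] by (simp add: mult.commute)
  then show ?thesis
    using cj_mult_self[OF that] by (simp add: ker_def)
qed

text \<open>The power may be singular at 0, but the weight vanishes for
  \<open>y \<bullet> y \<le> a\<close>, which permits replacing \<open>y \<bullet> y\<close> by
  \<open>max a (y \<bullet> y)\<close>.\<close>

lemma continuous_weight_powr: "continuous_on S (\<lambda>y. weight a b y * (y \<bullet> y) powr q)"
proof (rule continuous_on_eq)
  show "continuous_on S (\<lambda>y. weight a b y * (max a (y \<bullet> y)) powr q)"
    using a_pos by (intro continuous_intros continuous_weight) (auto simp: max_def)
  show "weight a b y * (max a (y \<bullet> y)) powr q = weight a b y * (y \<bullet> y) powr q" for y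
    using inside(2)[of y] by (cases "y \<bullet> y \<le> a") (auto simp: max_def)
qed

text \<open>The regularized formula for the constant function 1 at \<open>x = 0\<close>. Since
  \<open>ker 0 y * y\<close> is a real multiple of 1, the kernel integral tends to
  \<open>total a b\<close>, and the other side is the mass against the cutoff. This determines the
  \<open>T\<close> of \<open>concentration\<close>.\<close>

lemma total_limit:
  "(\<lambda>n. integral\<^sup>L mu (\<lambda>y. mass (1 / real (Suc n)) y * chi y)) \<longlonglongrightarrow> total a b"
proof -
  interpret one: monogenic_ball M v m "\<lambda>_. 1" "\<lambda>_ _. 0" \<rho> a b
    by (rule monogenic_ball_one)
  have zero: "0 \<in> M" "(0::'a) \<bullet> 0 < a" using subspace_M a_pos by (simp_all add: subspace_0)
  have int: "integrable mu (\<lambda>y. mass (1 / real (Suc n)) y * chi y)" for n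
    by (rule integrable_mu_continuous[where r = "sqrt b"])
       (auto intro!: continuous_intros continuous_mass continuous_chi simp: outside sqrt_outside)
  have "integral\<^sup>L mu (\<lambda>y. ker 0 (y - 0) * shell_density a b (\<lambda>_. 1) y) = integral\<^sup>L mu (\<lambda>y. (weight a b y * (y \<bullet> y) powr (1 - alpha)) *\<^sub>R 1)"
    by (rule Bochner_Integration.integral_cong[OF refl]) (simp add: shell_density_def weight_scaled space_mu)
  also have "\<dots> = total a b *\<^sub>R 1"
    unfolding total_def
  proof (rule integral_scaleR_left)
    show "integrable mu (\<lambda>y. weight a b y * (y \<bullet> y) powr (1 - alpha))"
      by (rule integrable_mu_continuous[where r = "sqrt b", OF continuous_weight_powr])
        (simp add: outside sqrt_outside)
  qed
  finally have "(\<lambda>n. integral\<^sup>L mu (\<lambda>y. mass (1 / real (Suc n)) (y - 0) *\<^sub>R one.cut_fun y)) \<longlonglongrightarrow> total a b *\<^sub>R 1"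
    using one.kernel_limit[OF zero] one.regularized_formula[OF _ zero(1)] by simp
  moreover have "integral\<^sup>L mu (\<lambda>y. mass (1 / real (Suc n)) (y - 0) *\<^sub>R one.cut_fun y) =
      integral\<^sup>L mu (\<lambda>y. mass (1 / real (Suc n)) y * chi y) *\<^sub>R 1" for n
    using int[of n] by (simp add: one.cut_fun_def)
  ultimately have "(\<lambda>n. (integral\<^sup>L mu (\<lambda>y. mass (1 / real (Suc n)) y * chi y) *\<^sub>R 1) \<bullet> (1::'a)) \<longlonglongrightarrow> (total a b *\<^sub>R 1) \<bullet> (1::'a)"
    by (intro tendsto_inner tendsto_const) simp
  then show ?thesis by (simp add: inner_1_1)
qed

lemma total_pos: "0 < total a b"
proof -
  \<comment> \<open>A real point strictly inside the shell, where the weight is positive.\<close>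
  define x where "x = sqrt ((a + b) / 2) *\<^sub>R (1::'a)"
  have xx: "x \<bullet> x = (a + b) / 2"
    using a_pos a_less_b by (simp add: x_def inner_1_1)
  moreover have "0 < weight a b x"
    unfolding weight_def xx using a_less_b by (intro mult_pos_pos cutoff'_pos) auto
  moreover have "x \<in> M"
    using one_in_M subspace_M by (simp add: x_def subspace_scale)
  ultimately show ?thesis
    unfolding total_def using a_pos a_less_b
    by (intro integral_mu_pos[of _ x] continuous_weight_powr mult_nonneg_nonneg weight_nonneg
          integrable_mu_continuous[where r = "sqrt b"] mult_pos_pos)
       (auto simp: outside sqrt_outside)
qed

theorem cauchy_formula:
  assumes x: "x \<in> M" "x \<bullet> x < a"
  shows "total a b *\<^sub>R f x = integral\<^sup>L mu (\<lambda>y. ker 0 (y - x) * shell_density a b f y)"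
proof (rule LIMSEQ_unique)
  show "(\<lambda>n. integral\<^sup>L mu (\<lambda>y. mass (1 / real (Suc n)) (y - x) *\<^sub>R cut_fun y)) \<longlonglongrightarrow> total a b *\<^sub>R f x"
    by (rule concentration[OF x total_limit])
  show "(\<lambda>n. integral\<^sup>L mu (\<lambda>y. mass (1 / real (Suc n)) (y - x) *\<^sub>R cut_fun y))
      \<longlonglongrightarrow> integral\<^sup>L mu (\<lambda>y. ker 0 (y - x) * shell_density a b f y)"
    using kernel_limit[OF x] regularized_formula[OF _ x(1)] by simp
qed

end

section \<open>Continuity and differentiability of integrals against the kernel\<close>

context hypercomplex_frame
begin

text \<open>Two overlapping relatively open sets cover \<open>M\<close>: for
  \<open>x \<bullet> x < y \<bullet> y\<close> the argument of \<open>e\<close> is nonzero, and for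
  \<open>y \<bullet> y < a\<close> the product vanishes, also at \<open>y = x\<close>.\<close>

lemma continuous_kernel_product:
  fixes e \<Psi> :: "'a \<Rightarrow> 'a"
  assumes e: "continuous_on {z. z \<noteq> 0} e" and x: "x \<bullet> x < a"
    and \<Psi>: "continuous_on M \<Psi>" "\<And>y. y \<bullet> y \<le> a \<Longrightarrow> \<Psi> y = 0"
  shows "continuous_on M (\<lambda>y. e (y - x) * \<Psi> y)"
proof -
  let ?S = "M \<inter> {y. x \<bullet> x < y \<bullet> y}" and ?T = "M \<inter> {y. y \<bullet> y < a}"
  have M: "M = ?S \<union> ?T" using x by force
  have "open {y. x \<bullet> x < y \<bullet> y}" "open {y::'a. y \<bullet> y < a}"
    by (intro open_Collect_less continuous_intros)+
  then have "openin (top_of_set M) ?S" "openin (top_of_set M) ?T"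
    by (auto intro: openin_open_Int)
  moreover have "continuous_on ?S (\<lambda>y. e (y - x) * \<Psi> y)"
    by (intro continuous_on_times continuous_on_compose2[OF e] continuous_intros
         continuous_on_subset[OF \<Psi>(1)]) auto
  moreover have "continuous_on ?T (\<lambda>y. e (y - x) * \<Psi> y)"
    by (rule continuous_on_eq[OF continuous_on_const[of _ 0]]) (simp add: \<Psi>(2))
  ultimately show ?thesis
    using M continuous_on_Un_local_open[of ?S ?T "\<lambda>y. e (y - x) * \<Psi> y"] by metis
qed

text \<open>Where \<Psi> is nonzero and \<open>norm x \<le> r\<close>, the argument
  \<open>y - x\<close> stays in a compact annulus on which \<open>e\<close> is bounded. Uniformity
  in \<open>x\<close> is what dominated convergence demands.\<close>

lemma kernel_product_bound:
  fixes e \<Psi> :: "'a \<Rightarrow> 'a"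
  assumes e: "continuous_on {z. z \<noteq> 0} e" and r: "r < sqrt a"
    and \<Psi>: "\<And>y. y \<bullet> y \<le> a \<Longrightarrow> \<Psi> y = 0" "\<And>y. sqrt b < norm y \<Longrightarrow> \<Psi> y = 0"
  obtains B where "\<And>x y. norm x \<le> r \<Longrightarrow> norm (e (y - x) * \<Psi> y) \<le> B * norm (\<Psi> y)"
proof -
  obtain K where K: "0 < K" "\<And>a b::'a. norm (a * b) \<le> norm a * norm b * K"
    using bounded_bilinear.pos_bounded[OF bounded_bilinear_times] by blast
  let ?Z = "{z::'a. sqrt a - r \<le> norm z} \<inter> cball 0 (sqrt b + r)"
  have "closed {z::'a. sqrt a - r \<le> norm z}"
    by (intro closed_Collect_le continuous_intros)
  then have "compact ?Z" by (intro closed_Int_compact) auto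
  moreover have "continuous_on ?Z e"
    by (rule continuous_on_subset[OF e]) (use r in auto)
  ultimately have "bounded (e ` ?Z)"
    by (intro compact_imp_bounded compact_continuous_image)
  then obtain C where C: "\<And>z. z \<in> ?Z \<Longrightarrow> norm (e z) \<le> C"
    unfolding bounded_iff by blast
  show thesis
  proof (rule that)
    fix x y :: 'a assume x: "norm x \<le> r"
    show "norm (e (y - x) * \<Psi> y) \<le> (C * K) * norm (\<Psi> y)"
    proof (cases "\<Psi> y = 0")
      case False
      then have y: "a < y \<bullet> y" "norm y \<le> sqrt b" using \<Psi> by (meson not_le)+
      then have "sqrt a < norm y" by (simp add: norm_eq_sqrt_inner)
      then have "y - x \<in> ?Z"
        using x y norm_triangle_ineq2[of y x] norm_triangle_ineq4[of y x] by auto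
      then have "norm (e (y - x)) * norm (\<Psi> y) * K \<le> C * norm (\<Psi> y) * K"
        using K(1) C by (intro mult_right_mono) auto
      with K(2)[of "e (y - x)" "\<Psi> y"] show ?thesis by (simp add: mult_ac)
    qed simp
  qed
qed

lemma ball_eq_inner: "0 < a \<Longrightarrow> x \<bullet> x < a \<longleftrightarrow> norm x < sqrt a"
  by (simp add: norm_eq_sqrt_inner)

lemma isCont_kernel_integral:
  fixes e \<Psi> :: "'a \<Rightarrow> 'a"
  assumes e: "continuous_on {z. z \<noteq> 0} e" and x: "x \<bullet> x < a" and a: "0 < a"
    and \<Psi>: "continuous_on M \<Psi>" "\<And>y. y \<bullet> y \<le> a \<Longrightarrow> \<Psi> y = 0" "\<And>y. sqrt b < norm y \<Longrightarrow> \<Psi> y = 0"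
  shows "isCont (\<lambda>x. integral\<^sup>L mu (\<lambda>y. e (y - x) * \<Psi> y)) x"
proof -
  define r where "r = (norm x + sqrt a) / 2"
  have r: "norm x < r" "r < sqrt a" using x a by (simp_all add: r_def ball_eq_inner)
  obtain B where B: "\<And>x y. norm x \<le> r \<Longrightarrow> norm (e (y - x) * \<Psi> y) \<le> B * norm (\<Psi> y)"
    using kernel_product_bound[where \<Psi> = \<Psi> and b = b, OF e r(2) \<Psi>(2,3)] by blast
  have "open {x'::'a. norm x' < r}"
    by (intro open_Collect_less continuous_intros)
  then have near: "\<forall>\<^sub>F x' in at x. norm x' < r"
    using eventually_at_topological r by blast
  have meas: "(\<lambda>y. e (y - x') * \<Psi> y) \<in> borel_measurable mu" if "norm x' < r" for x'
    by (intro continuous_imp_measurable_mu continuous_kernel_product[where a = a, OF e _ \<Psi>(1,2)])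
       (use that r a in \<open>simp add: ball_eq_inner\<close>)
  show ?thesis
    unfolding isCont_def
  proof (rule tendsto_integral_at)
    show "\<forall>\<^sub>F x' in at x. (\<lambda>y. e (y - x') * \<Psi> y) \<in> borel_measurable mu"
      using near by eventually_elim (rule meas)
    show "integrable mu (\<lambda>y. B * norm (\<Psi> y))"
      by (rule integrable_mu_continuous[where r = "sqrt b"]) (auto intro!: continuous_intros \<Psi>(1) simp: \<Psi>(3))
    show "\<forall>\<^sub>F x' in at x. \<forall>y\<in>space mu. norm (e (y - x') * \<Psi> y) \<le> B * norm (\<Psi> y)"
      using near by eventually_elim (auto intro!: B)
    show "((\<lambda>x'. e (y - x') * \<Psi> y) \<longlongrightarrow> e (y - x) * \<Psi> y) (at x)" for y
    proof (cases "y = x")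
      case True
      then have "\<Psi> y = 0" using x \<Psi>(2) by simp
      then show ?thesis by simp
    next
      case False
      have "open {z::'a. z \<noteq> 0}" by (simp add: open_Collect_neq)
      then have "isCont e (y - x)"
        using e False by (simp add: continuous_on_eq_continuous_at)
      then have "((\<lambda>x'. e (y - x')) \<longlongrightarrow> e (y - x)) (at x)"
        by (rule isCont_tendsto_compose) (intro tendsto_intros)
      then show ?thesis by (intro tendsto_times tendsto_const)
    qed
  qed (use meas r in auto)
qed

lemma kernel_integral_deriv:
  fixes e e' \<Psi> :: "'a \<Rightarrow> 'a"
  assumes e: "continuous_on {z. z \<noteq> 0} e" and e': "continuous_on {z. z \<noteq> 0} e'"
    and deriv: "\<And>z. z \<noteq> 0 \<Longrightarrow> ((\<lambda>t. e (z + t *\<^sub>R w)) has_vector_derivative e' z) (at 0)"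
    and x: "x \<bullet> x < a" and a: "0 < a"
    and \<Psi>: "continuous_on M \<Psi>" "\<And>y. y \<bullet> y \<le> a \<Longrightarrow> \<Psi> y = 0" "\<And>y. sqrt b < norm y \<Longrightarrow> \<Psi> y = 0"
  shows "((\<lambda>t. integral\<^sup>L mu (\<lambda>y. e (y - (x + t *\<^sub>R w)) * \<Psi> y)) has_vector_derivative
      - integral\<^sup>L mu (\<lambda>y. e' (y - x) * \<Psi> y)) (at 0)"
proof -
  define r where "r = (norm x + sqrt a) / 2"
  have r: "norm x < r" "r < sqrt a" using x a by (simp_all add: r_def ball_eq_inner)
  obtain B where B: "\<And>x y. norm x \<le> r \<Longrightarrow> norm (e' (y - x) * \<Psi> y) \<le> B * norm (\<Psi> y)"
    using kernel_product_bound[where \<Psi> = \<Psi> and b = b, OF e' r(2) \<Psi>(2,3)] by blast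
  \<comment> \<open>Keeps \<open>x + t w\<close> within radius \<open>r\<close> for
    \<open>|t| < \<eta>\<close>; the summand 1 covers \<open>w = 0\<close>.\<close>
  define \<eta> where "\<eta> = (r - norm x) / (norm w + 1)"
  have \<eta>: "0 < \<eta>" using r by (simp add: \<eta>_def add_nonneg_pos)
  have near: "norm (x + t *\<^sub>R w) \<le> r" if "\<bar>t\<bar> < \<eta>" for t
  proof -
    have "\<bar>t\<bar> * norm w \<le> \<eta> * (norm w + 1)" using that by (intro mult_mono) auto
    also have "\<dots> = r - norm x"
      using add_nonneg_pos[OF norm_ge_zero[of w] zero_less_one] by (simp add: \<eta>_def)
    finally show ?thesis using norm_triangle_ineq[of x "t *\<^sub>R w"] by simp
  qed
  have inner: "x' \<bullet> x' < a" if "norm x' \<le> r" for x'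
    using that r a by (simp add: ball_eq_inner)
  have "((\<lambda>t. integral\<^sup>L mu (\<lambda>y. e (y - (x + t *\<^sub>R w)) * \<Psi> y)) has_vector_derivative
      integral\<^sup>L mu (\<lambda>y. - (e' (y - (x + 0 *\<^sub>R w)) * \<Psi> y))) (at 0)"
  proof (rule has_vector_derivative_integral[OF \<eta>, where w = "\<lambda>y. B * norm (\<Psi> y)"
        and k' = "\<lambda>t y. - (e' (y - (x + t *\<^sub>R w)) * \<Psi> y)"])
    show "integrable mu (\<lambda>y. e (y - (x + t *\<^sub>R w)) * \<Psi> y)" if "\<bar>t\<bar> < \<eta>" for t
      by (rule integrable_mu_continuous[where r = "sqrt b"])
         (use continuous_kernel_product[OF e inner[OF near[OF that]] \<Psi>(1,2)] \<Psi>(3) in auto)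
    show "norm (- (e' (y - (x + t *\<^sub>R w)) * \<Psi> y)) \<le> B * norm (\<Psi> y)" if "\<bar>t\<bar> < \<eta>" for t y
      using B[OF near[OF that]] by simp
    show "(\<lambda>y. - (e' (y - (x + 0 *\<^sub>R w)) * \<Psi> y)) \<in> borel_measurable mu"
      using continuous_kernel_product[OF e' x \<Psi>(1,2)]
      by (intro continuous_imp_measurable_mu) (auto intro: continuous_intros)
    show "integrable mu (\<lambda>y. B * norm (\<Psi> y))"
      by (rule integrable_mu_continuous[where r = "sqrt b"]) (auto intro!: continuous_intros \<Psi>(1) simp: \<Psi>(3))
    fix t y assume t: "\<bar>t\<bar> < \<eta>"
    show "((\<lambda>t. e (y - (x + t *\<^sub>R w)) * \<Psi> y) has_vector_derivative - (e' (y - (x + t *\<^sub>R w)) * \<Psi> y)) (at t)"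
    proof (cases "\<Psi> y = 0")
      case False
      then have "y - (x + t *\<^sub>R w) \<noteq> 0"
        using inner[OF near[OF t]] \<Psi>(2) by force
      from deriv[OF this]
      have "((\<lambda>s. e (y - (x + t *\<^sub>R w) + s *\<^sub>R w)) has_vector_derivative e' (y - (x + t *\<^sub>R w))) (at (t - t))"
        by simp
      \<comment> \<open>Since \<open>x\<close> enters through \<open>y - x\<close>, the parameter is
        reversed by \<open>t - s\<close>, at the cost of a sign.\<close>
      then have "(((\<lambda>s. e (y - (x + t *\<^sub>R w) + s *\<^sub>R w)) \<circ> (\<lambda>s. t - s)) has_vector_derivative
           (-1) *\<^sub>R e' (y - (x + t *\<^sub>R w))) (at t)"
        by (intro vector_diff_chain_at) (auto intro!: derivative_eq_intros)
      moreover have "(\<lambda>s. e (y - (x + t *\<^sub>R w) + s *\<^sub>R w)) \<circ> (\<lambda>s. t - s) = (\<lambda>s. e (y - (x + s *\<^sub>R w)))"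
        by (simp add: fun_eq_iff algebra_simps)
      ultimately show ?thesis
        using has_vector_derivative_times_const(1)[of "\<lambda>s. e (y - (x + s *\<^sub>R w))" "(-1) *\<^sub>R e' (y - (x + t *\<^sub>R w))" t UNIV "\<Psi> y"]
        by simp
    qed simp
  qed
  then show ?thesis by simp
qed

lemma linear_ker1: "linear (\<lambda>w. ker1 \<delta> w z)"
  by (intro linearI) (simp_all add: ker1_def linear_add[OF linear_cj] linear_scale[OF linear_cj] algebra_simps inner_add_right)

end

context monogenic_ball
begin

text \<open>The derivatives of \<open>f\<close> as differentiated Cauchy integrals. Each
  differentiation in \<open>x\<close> brings one minus sign, so that \<open>kernel_deriv2\<close>
  has none.\<close>

definition kernel_deriv1 :: "'a \<Rightarrow> 'a \<Rightarrow> 'a" where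
  "kernel_deriv1 w x = - (inverse (total a b) *\<^sub>R integral\<^sup>L mu (\<lambda>y. ker1 0 w (y - x) * shell_density a b f y))"

definition kernel_deriv2 :: "'a \<Rightarrow> 'a \<Rightarrow> 'a \<Rightarrow> 'a" where
  "kernel_deriv2 w u x = inverse (total a b) *\<^sub>R integral\<^sup>L mu (\<lambda>y. ker2 w u (y - x) * shell_density a b f y)"

lemma shell_density_inside: "y \<bullet> y \<le> a \<Longrightarrow> shell_density a b f y = 0"
  by (simp add: shell_density_def inside)

lemma continuous_ker_off_0: "continuous_on {z. z \<noteq> 0} (ker 0)"
  and continuous_ker1_off_0: "continuous_on {z. z \<noteq> 0} (ker1 0 w)"
  using continuous_ker[of 0] continuous_ker1[of 0 w] by simp_all

lemma integrable_kernel: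
  assumes "continuous_on {z. z \<noteq> 0} e" "x \<bullet> x < a"
  shows "integrable mu (\<lambda>y. e (y - x) * shell_density a b f y)"
  by (rule integrable_mu_continuous[where r = "sqrt b",
        OF continuous_kernel_product[OF assms continuous_shell_density shell_density_inside]])
     (simp_all add: shell_density_outside)

lemma kernel_deriv2_commute: "kernel_deriv2 w u = kernel_deriv2 u w"
  by (simp add: fun_eq_iff kernel_deriv2_def ker2_commute)

lemma linear_kernel_deriv1: "x \<bullet> x < a \<Longrightarrow> linear (\<lambda>w. kernel_deriv1 w x)"
  unfolding kernel_deriv1_def
  by (intro linearI)
     (simp_all add: linear_add[OF linear_ker1] linear_scale[OF linear_ker1] distrib_right
       integrable_kernel[OF continuous_ker1_off_0] algebra_simps)

text \<open>Near \<open>x\<close> the Cauchy formula expresses \<open>f\<close> by an integral that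
  can be differentiated in any direction, whereas derivatives of \<open>f\<close> were given only
  along the basis.\<close>

lemma f_line_deriv:
  assumes x: "x \<in> M" "x \<bullet> x < a" and w: "w \<in> M"
  shows "((\<lambda>t. f (x + t *\<^sub>R w)) has_vector_derivative kernel_deriv1 w x) (at 0)"
proof -
  have "((\<lambda>t. inverse (total a b) *\<^sub>R integral\<^sup>L mu (\<lambda>y. ker 0 (y - (x + t *\<^sub>R w)) * shell_density a b f y)) has_vector_derivative kernel_deriv1 w x) (at 0)"
    unfolding kernel_deriv1_def scaleR_minus_right[symmetric]
    by (intro bounded_linear.has_vector_derivative[OF bounded_linear_scaleR_right]
        kernel_integral_deriv[OF continuous_ker_off_0 continuous_ker1_off_0 _ x(2) a_pos continuous_shell_density shell_density_inside shell_density_outside]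
        ker_line_deriv) simp_all
  then show ?thesis
  proof (rule has_vector_derivative_transform_within_open)
    show "open {t. (x + t *\<^sub>R w) \<bullet> (x + t *\<^sub>R w) < a}"
      by (intro open_Collect_less continuous_intros)
    fix t assume "t \<in> {t. (x + t *\<^sub>R w) \<bullet> (x + t *\<^sub>R w) < a}"
    then show "inverse (total a b) *\<^sub>R integral\<^sup>L mu (\<lambda>y. ker 0 (y - (x + t *\<^sub>R w)) * shell_density a b f y) = f (x + t *\<^sub>R w)"
      using cauchy_formula[OF line_in_M[OF x(1) w], of t, symmetric] total_pos by simp
  qed (use x in simp)
qed

lemma kernel_deriv1_line_deriv:
  assumes x: "x \<bullet> x < a"
  shows "((\<lambda>t. kernel_deriv1 w (x + t *\<^sub>R u)) has_vector_derivative kernel_deriv2 w u x) (at 0)"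
proof -
  have "((\<lambda>t. - (inverse (total a b) *\<^sub>R integral\<^sup>L mu (\<lambda>y. ker1 0 w (y - (x + t *\<^sub>R u)) * shell_density a b f y))) has_vector_derivative
     - (inverse (total a b) *\<^sub>R - integral\<^sup>L mu (\<lambda>y. ker2 w u (y - x) * shell_density a b f y))) (at 0)"
    by (intro has_vector_derivative_minus bounded_linear.has_vector_derivative[OF bounded_linear_scaleR_right]
        kernel_integral_deriv[OF continuous_ker1_off_0 continuous_ker2 _ x a_pos continuous_shell_density shell_density_inside shell_density_outside]
        ker1_line_deriv) simp_all
  then show ?thesis by (simp add: kernel_deriv1_def kernel_deriv2_def)
qed

lemma continuous_kernel_deriv2: "continuous_on {x. x \<bullet> x < a} (kernel_deriv2 w u)"
  unfolding kernel_deriv2_def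
  by (intro continuous_intros continuous_at_imp_continuous_on ballI
     isCont_kernel_integral[OF continuous_ker2 _ a_pos continuous_shell_density shell_density_inside shell_density_outside]) auto

end

section \<open>Regularity of monogenic functions\<close>

lemma partial_deriv_line_deriv:
  assumes "left_monogenic v m U f" "x \<in> U" "s \<le> m"
  shows "((\<lambda>t. f (x + t *\<^sub>R v s)) has_vector_derivative partial_deriv (v s) f x) (at 0)"
proof -
  obtain L where "((\<lambda>t. f (x + t *\<^sub>R v s)) has_vector_derivative L) (at 0)"
    using assms unfolding left_monogenic_def C1_wrt_def partial_quotient_tendsto_iff by blast
  with partial_deriv_eqI[OF this] show ?thesis by simp
qed

lemma continuous_on_partial_deriv:
  "left_monogenic v m U f \<Longrightarrow> s \<le> m \<Longrightarrow> continuous_on U (partial_deriv (v s) f)"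
  unfolding left_monogenic_def C1_wrt_def by blast

lemma left_monogenic_sum_0:
  "left_monogenic v m U f \<Longrightarrow> x \<in> U \<Longrightarrow> (\<Sum>s\<le>m. v s * partial_deriv (v s) f x) = 0"
  unfolding left_monogenic_def by (simp add: atLeast0AtMost)

lemma left_monogenicI:
  assumes "\<And>s x. s \<le> m \<Longrightarrow> x \<in> U \<Longrightarrow> \<exists>L. ((\<lambda>t. f (x + t *\<^sub>R v s)) has_vector_derivative L) (at 0)"
    and "\<And>s. s \<le> m \<Longrightarrow> continuous_on U (partial_deriv (v s) f)"
    and "\<And>x. x \<in> U \<Longrightarrow> (\<Sum>s\<le>m. v s * partial_deriv (v s) f x) = 0"
  shows "left_monogenic v m U f"
  using assms unfolding left_monogenic_def C1_wrt_def partial_quotient_tendsto_iff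
  by (auto simp: atLeast0AtMost)

context hypercomplex_frame
begin

lemma abs_inner_v_le: "s \<le> m \<Longrightarrow> \<bar>h \<bullet> v s\<bar> \<le> norm h"
  using Cauchy_Schwarz_ineq2[of h "v s"] by (simp add: norm_v)

text \<open>The definition provides continuous partial derivatives; continuity of \<open>f\<close>
  itself is an input of the Cauchy formula. One moves from \<open>x\<close> to \<open>y\<close>
  along one basis vector at a time, each step costing at most a local bound of the partial
  derivatives times its length.\<close>

lemma left_monogenic_continuous:
  assumes mono: "left_monogenic v m U f" and U: "openin (top_of_set M) U"
  shows "continuous_on U f"
  unfolding continuous_on_iff
proof (intro ballI allI impI)
  fix x \<epsilon> assume x: "x \<in> U" and \<epsilon>: "(0::real) < \<epsilon>"
  have UM: "U \<subseteq> M" using U by (rule openin_imp_subset)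
  obtain e where e: "0 < e" "\<And>y. y \<in> M \<Longrightarrow> norm (y - x) < e \<Longrightarrow> y \<in> U"
    using relatively_openE[OF U x] by blast
  have "\<exists>d>0. \<forall>y\<in>U. norm (y - x) < d \<longrightarrow> norm (partial_deriv (v s) f y - partial_deriv (v s) f x) < 1"
    if "s \<le> m" for s
    using continuous_on_partial_deriv[OF mono that] x
    unfolding continuous_on_iff dist_norm by (metis zero_less_one)
  then obtain d where d: "\<And>s. s \<le> m \<Longrightarrow> 0 < d s"
    "\<And>s y. s \<le> m \<Longrightarrow> y \<in> U \<Longrightarrow> norm (y - x) < d s \<Longrightarrow>
        norm (partial_deriv (v s) f y - partial_deriv (v s) f x) < 1"
    by metis
  define r where "r = Min (insert e (d ` {..m}))"
  have r: "0 < r" "r \<le> e"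
    using e(1) d(1) by (auto simp: r_def)
  have r_d: "r \<le> d s" if "s \<le> m" for s
    unfolding r_def by (rule Min_le) (use that in auto)
  define B where "B = 1 + (\<Sum>s\<le>m. norm (partial_deriv (v s) f x))"
  have B: "norm (partial_deriv (v s) f y) \<le> B" if "s \<le> m" "y \<in> M" "norm (y - x) < r" for s y
  proof -
    have "norm (partial_deriv (v s) f y - partial_deriv (v s) f x) < 1"
      using that r(2) r_d[OF that(1)] by (intro d(2)[OF that(1)] e(2)) auto
    moreover have "norm (partial_deriv (v s) f x) \<le> (\<Sum>s\<le>m. norm (partial_deriv (v s) f x))"
      using that(1) by (intro member_le_sum) auto
    ultimately show ?thesis
      using norm_triangle_ineq2[of "partial_deriv (v s) f y" "partial_deriv (v s) f x"] by (simp add: B_def)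
  qed
  have B1: "0 < B" by (simp add: B_def add_pos_nonneg sum_nonneg)
  have bound: "norm (f y - f x) \<le> real (m + 1) * B * norm (y - x)"
    if y: "y \<in> M" "real (m + 1) * norm (y - x) < r" for y
  proof -
    define h where "h s = (y - x) \<bullet> v s" for s
    \<comment> \<open>The corners of the staircase path from \<open>x\<close> to \<open>y\<close>.
      It stays within \<open>real (m + 1) * norm (y - x)\<close> of \<open>x\<close>, hence the
      smallness condition on \<open>y\<close>.\<close>
    define z where "z j = x + (\<Sum>s<j. h s *\<^sub>R v s)" for j
    have xM: "x \<in> M" using x UM by blast
    have zM: "z j \<in> M" if "j \<le> Suc m" for j
      unfolding z_def using that subspace_M xM v_in_M
      by (intro subspace_add subspace_sum subspace_scale) auto
    have h: "\<bar>h s\<bar> \<le> norm (y - x)" if "s \<le> m" for s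
      using abs_inner_v_le[OF that] by (simp add: h_def)
    have z_norm: "norm (z j - x) \<le> real j * norm (y - x)" if "j \<le> Suc m" for j
    proof -
      have "norm (\<Sum>s<j. h s *\<^sub>R v s) \<le> (\<Sum>s<j. norm (y - x))"
        by (rule sum_norm_le) (use h that in \<open>auto simp: norm_v\<close>)
      then show ?thesis by (simp add: z_def)
    qed
    have step: "norm (f (z (Suc j)) - f (z j)) \<le> B * norm (y - x)" if j: "j \<le> m" for j
    proof -
      have "norm (f (z j + h j *\<^sub>R v j) - f (z j + 0 *\<^sub>R v j)) \<le> B * \<bar>h j\<bar>"
      proof (rule norm_increment_le[where f = "\<lambda>t. f (z j + t *\<^sub>R v j)"])
        fix t assume "t \<in> closed_segment 0 (h j)"
        then have t: "\<bar>t\<bar> \<le> \<bar>h j\<bar>" by (auto simp: closed_segment_eq_real_ivl split: if_splits)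
        have M: "z j + t *\<^sub>R v j \<in> M" using zM v_in_M j by (intro line_in_M) auto
        have "norm (z j + t *\<^sub>R v j - x) \<le> norm (z j - x) + \<bar>t\<bar>"
          using norm_triangle_ineq[of "z j - x" "t *\<^sub>R v j"] norm_v[OF j] by (simp add: algebra_simps)
        also have "\<dots> \<le> real j * norm (y - x) + norm (y - x)"
          using z_norm[of j] t h[OF j] j by simp
        also have "\<dots> \<le> real (m + 1) * norm (y - x)"
          using mult_right_mono[of "real j + 1" "real m + 1" "norm (y - x)"] j by (simp add: algebra_simps)
        finally have near: "norm (z j + t *\<^sub>R v j - x) < r" using y(2) by simp
        then have "z j + t *\<^sub>R v j \<in> U" using e(2) M r(2) by simp
        from partial_deriv_line_deriv[OF mono this j]
        show "((\<lambda>t. f (z j + t *\<^sub>R v j)) has_vector_derivative partial_deriv (v j) f (z j + t *\<^sub>R v j)) (at t)"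
          by (simp add: has_vector_derivative_shift_line[of f "z j" "v j" _ t])
        show "norm (partial_deriv (v j) f (z j + t *\<^sub>R v j)) \<le> B" by (rule B[OF j M near])
      qed
      also have "\<dots> \<le> B * norm (y - x)" using h[OF j] B1 by simp
      finally show ?thesis by (simp add: z_def add.assoc)
    qed
    have "z (Suc m) = y"
      using expand[OF diff_in_M[OF y(1) xM]] by (simp add: z_def h_def lessThan_Suc_atMost)
    then have "f y - f x = (\<Sum>j<Suc m. f (z (Suc j)) - f (z j))"
      by (subst sum_lessThan_telescope) (simp add: z_def)
    also have "norm \<dots> \<le> (\<Sum>j<Suc m. B * norm (y - x))"
      by (rule sum_norm_le) (use step in auto)
    finally show ?thesis by (simp add: algebra_simps)
  qed
  define d' where "d' = min (r / real (m + 1)) (\<epsilon> / (real (m + 1) * B))"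
  show "\<exists>d'>0. \<forall>y\<in>U. dist y x < d' \<longrightarrow> dist (f y) (f x) < \<epsilon>"
  proof (intro exI[of _ d'] conjI ballI impI)
    show "0 < d'" using r(1) \<epsilon> B1 by (simp add: d'_def)
    fix y assume y: "y \<in> U" "dist y x < d'"
    then have 1: "norm (y - x) < r / real (m + 1)" and 2: "norm (y - x) < \<epsilon> / (real (m + 1) * B)"
      by (simp_all add: d'_def dist_norm)
    have "real (m + 1) * norm (y - x) < r"
      using 1 by (subst (asm) pos_less_divide_eq) (auto simp: mult.commute)
    moreover have "real (m + 1) * B * norm (y - x) < \<epsilon>"
      using 2 B1 by (subst (asm) pos_less_divide_eq) (auto simp: mult_ac)
    ultimately show "dist (f y) (f x) < \<epsilon>"
      using bound[of y] UM y by (force simp: dist_norm)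
  qed
qed

lemma monogenic_ball_shift:
  assumes mono: "left_monogenic v m U f" and U: "openin (top_of_set M) U"
    and p: "p \<in> M" and ball: "{x \<in> M. norm (x - p) < \<rho>} \<subseteq> U"
    and ab: "0 < a" "a < b" "b < \<rho>\<^sup>2" "0 < \<rho>"
  shows "monogenic_ball M v m (\<lambda>y. f (p + y)) (\<lambda>s y. partial_deriv (v s) f (p + y)) \<rho> a b"
proof
  have in_U: "p + y \<in> U" if "y \<in> M" "norm y < \<rho>" for y
    using that ball add_in_M[OF p] by auto
  show "((\<lambda>t. f (p + (y + t *\<^sub>R v s))) has_vector_derivative partial_deriv (v s) f (p + y)) (at 0)"
    if "s \<le> m" "y \<in> M" "norm y < \<rho>" for s y
    using partial_deriv_line_deriv[OF mono in_U that(1)] that by (simp add: add.assoc)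
  show "continuous_on {y \<in> M. norm y < \<rho>} (\<lambda>y. partial_deriv (v s) f (p + y))" if "s \<le> m" for s
    by (rule continuous_on_compose2[OF continuous_on_partial_deriv[OF mono that]])
       (auto intro!: continuous_intros in_U)
  show "continuous_on {y \<in> M. norm y < \<rho>} (\<lambda>y. f (p + y))"
    by (rule continuous_on_compose2[OF left_monogenic_continuous[OF mono U]])
       (auto intro!: continuous_intros in_U)
  show "(\<Sum>s\<le>m. v s * partial_deriv (v s) f (p + y)) = 0" if "y \<in> M" "norm y < \<rho>" for y
    by (rule left_monogenic_sum_0[OF mono in_U[OF that]])
qed (use ab in auto)

text \<open>Hides the integral representation near \<open>x0\<close>: the study of regularity uses
  only that these derivatives exist, with linearity of the first and symmetry and continuity of the
  second.\<close>

lemma local_second_derivatives: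
  assumes mono: "left_monogenic v m U f" and U: "openin (top_of_set M) U" and x0: "x0 \<in> U"
  obtains r g1 g2 where "0 < r" "\<And>x. x \<in> M \<Longrightarrow> norm (x - x0) < r \<Longrightarrow> x \<in> U"
    "\<And>x w. x \<in> M \<Longrightarrow> w \<in> M \<Longrightarrow> norm (x - x0) < r \<Longrightarrow> ((\<lambda>t. f (x + t *\<^sub>R w)) has_vector_derivative g1 w x) (at 0)"
    "\<And>x w u. norm (x - x0) < r \<Longrightarrow> ((\<lambda>t. g1 w (x + t *\<^sub>R u)) has_vector_derivative g2 w u x) (at 0)"
    "\<And>x. norm (x - x0) < r \<Longrightarrow> linear (\<lambda>w. g1 w x)"
    "\<And>w u. g2 w u = g2 u w"
    "\<And>w u. continuous_on {x. norm (x - x0) < r} (g2 w u)"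
proof -
  obtain \<rho> where \<rho>: "0 < \<rho>" "\<And>y. y \<in> M \<Longrightarrow> norm (y - x0) < \<rho> \<Longrightarrow> y \<in> U"
    using relatively_openE[OF U x0] by blast
  have x0M: "x0 \<in> M" using x0 openin_imp_subset[OF U] by blast
  define r where "r = \<rho> / 2"
  have "r\<^sup>2 < \<rho>\<^sup>2" using \<rho>(1) by (simp add: r_def power_strict_mono)
  then obtain b where b: "r\<^sup>2 < b" "b < \<rho>\<^sup>2" using dense by blast
  have r: "0 < r" "r \<le> \<rho>" using \<rho>(1) by (simp_all add: r_def)
  interpret B: monogenic_ball M v m "\<lambda>y. f (x0 + y)" "\<lambda>s y. partial_deriv (v s) f (x0 + y)" \<rho> "r\<^sup>2" b
    by (rule monogenic_ball_shift[OF mono U x0M]) (use \<rho> b r in auto)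
  have small: "(x - x0) \<bullet> (x - x0) < r\<^sup>2" if "norm (x - x0) < r" for x
    using that r(1) by (simp add: power2_norm_eq_inner[symmetric] power_strict_mono)
  show thesis
  proof (rule that[of r "\<lambda>w x. B.kernel_deriv1 w (x - x0)" "\<lambda>w u x. B.kernel_deriv2 w u (x - x0)"])
    show "((\<lambda>t. f (x + t *\<^sub>R w)) has_vector_derivative B.kernel_deriv1 w (x - x0)) (at 0)"
      if "x \<in> M" "w \<in> M" "norm (x - x0) < r" for x w
    proof -
      have "x0 + (x - x0 + t *\<^sub>R w) = x + t *\<^sub>R w" for t by simp
      with B.f_line_deriv[OF diff_in_M[OF that(1) x0M] small[OF that(3)] that(2)]
      show ?thesis by simp
    qed
    show "((\<lambda>t. B.kernel_deriv1 w (x + t *\<^sub>R u - x0)) has_vector_derivative B.kernel_deriv2 w u (x - x0)) (at 0)"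
      if "norm (x - x0) < r" for x w u
      using B.kernel_deriv1_line_deriv[OF small[OF that], of w u] by (simp only: diff_add_eq)
    show "linear (\<lambda>w. B.kernel_deriv1 w (x - x0))" if "norm (x - x0) < r" for x
      by (rule B.linear_kernel_deriv1[OF small[OF that]])
    show "(\<lambda>x. B.kernel_deriv2 w u (x - x0)) = (\<lambda>x. B.kernel_deriv2 u w (x - x0))" for w u
      by (simp add: B.kernel_deriv2_commute)
    show "continuous_on {x. norm (x - x0) < r} (\<lambda>x. B.kernel_deriv2 w u (x - x0))" for w u
      by (rule continuous_on_compose2[OF B.continuous_kernel_deriv2]) (use small in \<open>auto intro!: continuous_intros\<close>)
  qed (use r \<rho> in auto)
qed

text \<open>The derivative along \<open>w\<close> is linear in \<open>w\<close>, because the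
  differentiated kernel is, and is therefore determined by its values on the basis.\<close>

lemma left_monogenic_directional:
  assumes mono: "left_monogenic v m U f" and U: "openin (top_of_set M) U" and x: "x \<in> U" and w: "w \<in> M"
  shows "((\<lambda>t. f (x + t *\<^sub>R w)) has_vector_derivative (\<Sum>s\<le>m. (w \<bullet> v s) *\<^sub>R partial_deriv (v s) f x)) (at 0)"
proof -
  obtain r g1 where r: "0 < r"
    and g1: "\<And>x' w. x' \<in> M \<Longrightarrow> w \<in> M \<Longrightarrow> norm (x' - x) < r \<Longrightarrow>
          ((\<lambda>t. f (x' + t *\<^sub>R w)) has_vector_derivative g1 w x') (at 0)"
    and lin: "\<And>x'. norm (x' - x) < r \<Longrightarrow> linear (\<lambda>w. g1 w x')"
    by (rule local_second_derivatives[OF mono U x]) blast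
  have xM: "x \<in> M" using x openin_imp_subset[OF U] by blast
  have g: "g1 (v s) x = partial_deriv (v s) f x" if "s \<le> m" for s
    using partial_deriv_eqI[OF g1[OF xM v_in_M[OF that]]] r by simp
  have L: "linear (\<lambda>w. g1 w x)" using lin[of x] r by simp
  have "g1 w x = g1 (\<Sum>s\<le>m. (w \<bullet> v s) *\<^sub>R v s) x" using expand[OF w] by simp
  also have "\<dots> = (\<Sum>s\<le>m. (w \<bullet> v s) *\<^sub>R partial_deriv (v s) f x)"
    using linear_sum[OF L, of "\<lambda>s. (w \<bullet> v s) *\<^sub>R v s" "{..m}"] linear_scale[OF L] g by simp
  finally show ?thesis using g1[OF xM w] r by simp
qed

text \<open>Identities between derivatives hold only on \<open>U\<close> while functions are total,
  so this is applied at each further differentiation. Points without a derivative are covered: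
  eventually equal quotients have the same limits, hence the same \<open>Lim\<close>.\<close>

lemma partial_deriv_cong:
  assumes U: "openin (top_of_set M) U" and x: "x \<in> U" and w: "w \<in> M" and eq: "\<And>y. y \<in> U \<Longrightarrow> f y = g y"
  shows "partial_deriv w f x = partial_deriv w g x"
proof -
  obtain r where r: "0 < r" "\<And>y. y \<in> M \<Longrightarrow> norm (y - x) < r \<Longrightarrow> y \<in> U"
    using relatively_openE[OF U x] by blast
  have xM: "x \<in> M" using x openin_imp_subset[OF U] by blast
  have "open {t. norm (t *\<^sub>R w) < r}"
    by (intro open_Collect_less continuous_intros)
  then have "\<forall>\<^sub>F t in at 0. norm (t *\<^sub>R w) < r"
    unfolding eventually_at_topological
    by (intro exI[of _ "{t. norm (t *\<^sub>R w) < r}"]) (use r(1) in auto)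
  then have ev: "\<forall>\<^sub>F t in at 0. partial_quotient w f x t = partial_quotient w g x t"
  proof eventually_elim
    case (elim t)
    then have "x + t *\<^sub>R w \<in> U" using r(2) line_in_M[OF xM w] by simp
    then show ?case using eq x by (simp add: partial_quotient_def)
  qed
  have lim: "(partial_quotient w f x \<longlongrightarrow> L) (at 0) \<longleftrightarrow> (partial_quotient w g x \<longlongrightarrow> L) (at 0)" for L
    by (rule tendsto_cong[OF ev])
  show ?thesis
    unfolding partial_deriv_def Topological_Spaces.Lim_def lim ..
qed

lemma local_partial_derivs:
  assumes mono: "left_monogenic v m U f" and U: "openin (top_of_set M) U" and x0: "x0 \<in> U"
  obtains r g2 where "0 < r"
    "\<And>s u x. s \<le> m \<Longrightarrow> u \<le> m \<Longrightarrow> x \<in> M \<Longrightarrow> norm (x - x0) < r \<Longrightarrow>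
        ((\<lambda>t. partial_deriv (v s) f (x + t *\<^sub>R v u)) has_vector_derivative g2 (v s) (v u) x) (at 0)"
    "\<And>s x. s \<le> m \<Longrightarrow> x \<in> M \<Longrightarrow> norm (x - x0) < r \<Longrightarrow> (\<Sum>u\<le>m. v u * g2 (v s) (v u) x) = 0"
    "\<And>w u. g2 w u = g2 u w"
    "\<And>w u. continuous_on {x. norm (x - x0) < r} (g2 w u)"
proof -
  obtain r g1 g2 where r: "0 < r" "\<And>x. x \<in> M \<Longrightarrow> norm (x - x0) < r \<Longrightarrow> x \<in> U"
    and g1: "\<And>x w. x \<in> M \<Longrightarrow> w \<in> M \<Longrightarrow> norm (x - x0) < r \<Longrightarrow> ((\<lambda>t. f (x + t *\<^sub>R w)) has_vector_derivative g1 w x) (at 0)"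
    and g2: "\<And>x w u. norm (x - x0) < r \<Longrightarrow> ((\<lambda>t. g1 w (x + t *\<^sub>R u)) has_vector_derivative g2 w u x) (at 0)"
    and lin: "\<And>x. norm (x - x0) < r \<Longrightarrow> linear (\<lambda>w. g1 w x)"
    and sym: "\<And>w u. g2 w u = g2 u w"
    and cont: "\<And>w u. continuous_on {x. norm (x - x0) < r} (g2 w u)"
    by (rule local_second_derivatives[OF mono U x0]) blast
  have pd: "partial_deriv (v s) f x = g1 (v s) x" if "s \<le> m" "x \<in> M" "norm (x - x0) < r" for s x
    by (rule partial_deriv_eqI[OF g1[OF that(2) v_in_M[OF that(1)] that(3)]])
  have op: "open {t. norm (x + t *\<^sub>R w - x0) < r}" for x w
    by (intro open_Collect_less continuous_intros)
  have d2: "((\<lambda>t. partial_deriv (v s) f (x + t *\<^sub>R v u)) has_vector_derivative g2 (v s) (v u) x) (at 0)"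
    if "s \<le> m" "u \<le> m" "x \<in> M" "norm (x - x0) < r" for s u x
    by (rule has_vector_derivative_transform_within_open[OF g2[OF that(4)] op[of x "v u"]])
       (use that in \<open>auto simp: pd line_in_M v_in_M\<close>)
  have "(\<Sum>u\<le>m. v u * g2 (v s) (v u) x) = 0" if "s \<le> m" "x \<in> M" "norm (x - x0) < r" for s x
  proof -
    \<comment> \<open>The equation for \<open>f\<close> is differentiated along \<open>v s\<close>;
      symmetry of \<open>g2\<close> then turns it into the equation for
      \<open>partial_deriv (v s) f\<close>.\<close>
    have "((\<lambda>t. \<Sum>u\<le>m. v u * g1 (v u) (x + t *\<^sub>R v s)) has_vector_derivative (\<Sum>u\<le>m. v u * g2 (v u) (v s) x)) (at 0)"
      by (intro has_vector_derivative_sum has_vector_derivative_times_const g2 that)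
    moreover have "((\<lambda>t. \<Sum>u\<le>m. v u * g1 (v u) (x + t *\<^sub>R v s)) has_vector_derivative 0) (at 0)"
    proof (rule has_vector_derivative_transform_within_open[OF has_vector_derivative_const op[of x "v s"]])
      fix t assume "t \<in> {t. norm (x + t *\<^sub>R v s - x0) < r}"
      then have t: "norm (x + t *\<^sub>R v s - x0) < r" by simp
      have xt: "x + t *\<^sub>R v s \<in> M" using that v_in_M by (intro line_in_M) auto
      show "0 = (\<Sum>u\<le>m. v u * g1 (v u) (x + t *\<^sub>R v s))"
        using left_monogenic_sum_0[OF mono r(2)[OF xt t]] pd[OF _ xt t] by simp
    qed (use that in simp)
    ultimately have "(\<Sum>u\<le>m. v u * g2 (v u) (v s) x) = 0"
      by (rule vector_derivative_unique_at)
    then show ?thesis by (simp only: sym[of "v s"])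
  qed
  from that[of r g2, OF r(1) d2 this sym cont] show thesis .
qed

text \<open>Everything is local and read off \<open>g2\<close> near each point: the second
  derivatives exist, are continuous and symmetric, and satisfy the differentiated equation.
  Iteration gives partial derivatives of all orders.\<close>

lemma
  assumes mono: "left_monogenic v m U f" and U: "openin (top_of_set M) U" and s: "s \<le> m"
  shows left_monogenic_partial_deriv: "left_monogenic v m U (partial_deriv (v s) f)"
    and partial_deriv_commute: "\<And>x u. x \<in> U \<Longrightarrow> u \<le> m \<Longrightarrow>
      partial_deriv (v u) (partial_deriv (v s) f) x = partial_deriv (v s) (partial_deriv (v u) f) x"
proof -
  have UM: "U \<subseteq> M" using U by (rule openin_imp_subset)
  show "partial_deriv (v u) (partial_deriv (v s) f) x = partial_deriv (v s) (partial_deriv (v u) f) x"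
    if x: "x \<in> U" and u: "u \<le> m" for x u
  proof -
    obtain r g2 where r: "0 < r" and d: "\<And>s u y. s \<le> m \<Longrightarrow> u \<le> m \<Longrightarrow> y \<in> M \<Longrightarrow> norm (y - x) < r \<Longrightarrow>
        ((\<lambda>t. partial_deriv (v s) f (y + t *\<^sub>R v u)) has_vector_derivative g2 (v s) (v u) y) (at 0)"
      and sum: "\<And>s y. s \<le> m \<Longrightarrow> y \<in> M \<Longrightarrow> norm (y - x) < r \<Longrightarrow> (\<Sum>u\<le>m. v u * g2 (v s) (v u) y) = 0"
      and sym: "\<And>w u. g2 w u = g2 u w"
      and cont: "\<And>w u. continuous_on {y. norm (y - x) < r} (g2 w u)"
      by (rule local_partial_derivs[OF mono U x]) blast
    have xr: "x \<in> M" "norm (x - x) < r" using x UM r by auto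
    show ?thesis
      using partial_deriv_eqI[OF d[OF s u xr]] partial_deriv_eqI[OF d[OF u s xr]] sym[of "v s" "v u"] by simp
  qed
  show "left_monogenic v m U (partial_deriv (v s) f)"
  proof (rule left_monogenicI)
    show "\<exists>L. ((\<lambda>t. partial_deriv (v s) f (x + t *\<^sub>R v u)) has_vector_derivative L) (at 0)"
      if u: "u \<le> m" and x: "x \<in> U" for u x
    proof -
      obtain r g2 where r: "0 < r" and d: "\<And>s u y. s \<le> m \<Longrightarrow> u \<le> m \<Longrightarrow> y \<in> M \<Longrightarrow> norm (y - x) < r \<Longrightarrow>
        ((\<lambda>t. partial_deriv (v s) f (y + t *\<^sub>R v u)) has_vector_derivative g2 (v s) (v u) y) (at 0)"
      and sum: "\<And>s y. s \<le> m \<Longrightarrow> y \<in> M \<Longrightarrow> norm (y - x) < r \<Longrightarrow> (\<Sum>u\<le>m. v u * g2 (v s) (v u) y) = 0"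
      and sym: "\<And>w u. g2 w u = g2 u w"
      and cont: "\<And>w u. continuous_on {y. norm (y - x) < r} (g2 w u)"
      by (rule local_partial_derivs[OF mono U x]) blast
    have xr: "x \<in> M" "norm (x - x) < r" using x UM r by auto
      show ?thesis using d[OF s u xr] by blast
    qed
    show "(\<Sum>u\<le>m. v u * partial_deriv (v u) (partial_deriv (v s) f) x) = 0" if x: "x \<in> U" for x
    proof -
      obtain r g2 where r: "0 < r" and d: "\<And>s u y. s \<le> m \<Longrightarrow> u \<le> m \<Longrightarrow> y \<in> M \<Longrightarrow> norm (y - x) < r \<Longrightarrow>
        ((\<lambda>t. partial_deriv (v s) f (y + t *\<^sub>R v u)) has_vector_derivative g2 (v s) (v u) y) (at 0)"
      and sum: "\<And>s y. s \<le> m \<Longrightarrow> y \<in> M \<Longrightarrow> norm (y - x) < r \<Longrightarrow> (\<Sum>u\<le>m. v u * g2 (v s) (v u) y) = 0"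
      and sym: "\<And>w u. g2 w u = g2 u w"
      and cont: "\<And>w u. continuous_on {y. norm (y - x) < r} (g2 w u)"
      by (rule local_partial_derivs[OF mono U x]) blast
    have xr: "x \<in> M" "norm (x - x) < r" using x UM r by auto
      have "partial_deriv (v u) (partial_deriv (v s) f) x = g2 (v s) (v u) x" if "u \<le> m" for u
        by (rule partial_deriv_eqI[OF d[OF s that xr]])
      then show ?thesis using sum[OF s xr] by simp
    qed
    show "continuous_on U (partial_deriv (v u) (partial_deriv (v s) f))" if u: "u \<le> m" for u
      unfolding continuous_on_eq_continuous_within
    proof
      fix x0 assume x0: "x0 \<in> U"
      obtain r g2 where r: "0 < r" and d: "\<And>s u y. s \<le> m \<Longrightarrow> u \<le> m \<Longrightarrow> y \<in> M \<Longrightarrow> norm (y - x0) < r \<Longrightarrow>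
        ((\<lambda>t. partial_deriv (v s) f (y + t *\<^sub>R v u)) has_vector_derivative g2 (v s) (v u) y) (at 0)"
      and sum: "\<And>s y. s \<le> m \<Longrightarrow> y \<in> M \<Longrightarrow> norm (y - x0) < r \<Longrightarrow> (\<Sum>u\<le>m. v u * g2 (v s) (v u) y) = 0"
      and sym: "\<And>w u. g2 w u = g2 u w"
      and cont: "\<And>w u. continuous_on {y. norm (y - x0) < r} (g2 w u)"
      by (rule local_partial_derivs[OF mono U x0]) blast
      have eq: "g2 (v s) (v u) x = partial_deriv (v u) (partial_deriv (v s) f) x"
        if "x \<in> U" "norm (x - x0) < r" for x
        using partial_deriv_eqI[OF d[OF s u _ that(2)]] UM that(1) by auto
      have "open {x. norm (x - x0) < r}" by (intro open_Collect_less continuous_intros)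
      then have "isCont (g2 (v s) (v u)) x0"
        using cont r by (simp add: continuous_on_eq_continuous_at)
      then have "continuous (at x0 within U) (g2 (v s) (v u))"
        by (rule continuous_at_imp_continuous_at_within)
      then show "continuous (at x0 within U) (partial_deriv (v u) (partial_deriv (v s) f))"
        by (rule continuous_transform_within[OF _ r x0]) (auto simp: eq dist_norm)
    qed
  qed
qed

end

section \<open>Fueter polynomials and iterated line derivatives\<close>

lemma multi_indices_Suc:
  assumes "k \<in> multi_indices m n" "s \<in> {1..m}"
  shows "k(s := Suc (k s)) \<in> multi_indices m (Suc n)"
proof -
  have "(\<Sum>i=1..m. (k(s := Suc (k s))) i) = (\<Sum>i=1..m. k i + (if i = s then 1 else 0))"
    by (intro sum.cong) auto
  also have "\<dots> = (\<Sum>i=1..m. k i) + 1"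
    using assms(2) by (simp add: sum.distrib)
  finally show ?thesis using assms by (auto simp: multi_indices_def)
qed

lemma multi_indices_pred:
  assumes "k \<in> multi_indices m (Suc n)" "s \<in> {1..m}" "0 < k s"
  shows "k(s := k s - 1) \<in> multi_indices m n"
proof -
  have "(\<Sum>i=1..m. k i) = (\<Sum>i=1..m. (k(s := k s - 1)) i + (if i = s then 1 else 0))"
    using assms(3) by (intro sum.cong) auto
  also have "\<dots> = (\<Sum>i=1..m. (k(s := k s - 1)) i) + 1"
    using assms(2) by (simp only: sum.distrib) simp
  finally show ?thesis using assms by (auto simp: multi_indices_def)
qed

text \<open>For each \<open>s\<close> the terms with \<open>k s = 0\<close> vanish, and lowering
  \<open>k s\<close> by 1 maps the other multi-indices bijectively onto those of degree
  \<open>n\<close>.\<close>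

lemma sum_multi_indices_Suc:
  fixes g :: "(nat \<Rightarrow> nat) \<Rightarrow> nat \<Rightarrow> 'b::comm_monoid_add"
  assumes "\<And>k s. k s = 0 \<Longrightarrow> g k s = 0"
  shows "(\<Sum>k\<in>multi_indices m (Suc n). \<Sum>s=1..m. g k s) =
    (\<Sum>k\<in>multi_indices m n. \<Sum>s=1..m. g (k(s := Suc (k s))) s)"
proof -
  have "(\<Sum>k\<in>multi_indices m (Suc n). g k s) = (\<Sum>k\<in>multi_indices m n. g (k(s := Suc (k s))) s)"
    if s: "s \<in> {1..m}" for s
  proof -
    have "(\<Sum>k\<in>multi_indices m (Suc n). g k s) = (\<Sum>k\<in>{k \<in> multi_indices m (Suc n). 0 < k s}. g k s)"
      by (rule sum.mono_neutral_right) (use assms in \<open>auto simp: finite_multi_indices\<close>)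
    also have "\<dots> = (\<Sum>k\<in>multi_indices m n. g (k(s := Suc (k s))) s)"
      by (rule sum.reindex_bij_witness[of _ "\<lambda>k. k(s := Suc (k s))" "\<lambda>k. k(s := k s - 1)"])
         (use multi_indices_Suc multi_indices_pred s in auto)
    finally show ?thesis .
  qed
  then have "(\<Sum>s=1..m. \<Sum>k\<in>multi_indices m (Suc n). g k s) =
      (\<Sum>s=1..m. \<Sum>k\<in>multi_indices m n. g (k(s := Suc (k s))) s)"
    by (rule sum.cong[OF refl])
  then show ?thesis
    by (simp only: sum.swap[of _ "{1..m}"])
qed

lemma prod_fact_Suc:
  fixes k :: "nat \<Rightarrow> nat"
  assumes "s \<in> {1..m}"
  shows "(\<Prod>i=1..m. fact ((k(s := Suc (k s))) i) :: real) = real (Suc (k s)) * (\<Prod>i=1..m. fact (k i))"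
proof -
  have "(\<Prod>i=1..m. fact ((k(s := Suc (k s))) i) :: real) = (\<Prod>i=1..m. fact (k i) * (if i = s then real (Suc (k s)) else 1))"
    by (intro prod.cong) auto
  also have "\<dots> = (\<Prod>i=1..m. fact (k i)) * real (Suc (k s))"
    using assms by (simp only: prod.distrib prod.delta finite_atLeastAtMost if_True)
  finally show ?thesis by (simp add: mult.commute)
qed

lemma fueter_poly_Suc:
  assumes k: "k \<in> multi_indices m (Suc n)"
  shows "real (Suc n) *\<^sub>R fueter_poly v m (\<lambda>s. int (k s)) x =
    (\<Sum>s=1..m. real (k s) *\<^sub>R (fueter_poly v m (\<lambda>i. int ((k(s := k s - 1)) i)) x * fueter_var v m s x))"
proof -
  have sum: "(\<Sum>s=1..m. k s) = Suc n" using k by (simp add: multi_indices_def)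
  then have "\<exists>s\<in>{1..m}. k s \<noteq> 0" by (metis sum.neutral nat.distinct(1))
  then have "fueter_poly v m (\<lambda>s. int (k s)) x = inverse (of_int (\<Sum>s=1..m. int (k s))) *\<^sub>R
        (\<Sum>s=1..m. of_int (int (k s)) *\<^sub>R (fueter_poly v m ((\<lambda>s. int (k s))(s := int (k s) - 1)) x * fueter_var v m s x))"
    by (subst fueter_poly.simps) auto
  also have "(\<Sum>s=1..m. int (k s)) = int (Suc n)"
    using sum by (simp flip: of_nat_sum)
  also have "(\<Sum>s=1..m. of_int (int (k s)) *\<^sub>R (fueter_poly v m ((\<lambda>s. int (k s))(s := int (k s) - 1)) x * fueter_var v m s x)) =
     (\<Sum>s=1..m. real (k s) *\<^sub>R (fueter_poly v m (\<lambda>i. int ((k(s := k s - 1)) i)) x * fueter_var v m s x))"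
  proof (intro sum.cong refl)
    fix s
    show "of_int (int (k s)) *\<^sub>R (fueter_poly v m ((\<lambda>s. int (k s))(s := int (k s) - 1)) x * fueter_var v m s x) =
        real (k s) *\<^sub>R (fueter_poly v m (\<lambda>i. int ((k(s := k s - 1)) i)) x * fueter_var v m s x)"
    \<comment> \<open>For \<open>k s = 0\<close> the integer index drops to -1 and the natural one
      stays at 0; the coefficient \<open>k s\<close> removes both terms.\<close>
    proof (cases "k s = 0")
      case False
      then have "(\<lambda>s. int (k s))(s := int (k s) - 1) = (\<lambda>i. int ((k(s := k s - 1)) i))"
        by (auto simp: fun_eq_iff of_nat_diff)
      then show ?thesis by simp
    qed simp
  qed
  finally show ?thesis by simp
qed

lemma fueter_poly_0: "fueter_poly v m (\<lambda>_. 0) x = 1"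
  by (subst fueter_poly.simps) simp

lemma multi_indices_0: "multi_indices m 0 = {\<lambda>_. 0}"
proof (intro equalityI subsetI)
  fix k assume "k \<in> multi_indices m 0"
  then have "k s = 0" for s
    by (cases "s \<in> {1..m}") (auto simp: multi_indices_def)
  then show "k \<in> {\<lambda>_. 0}" by auto
qed (simp add: multi_indices_def)

lemma nabla_0: "nabla v m (\<lambda>_. 0) f = f"
proof -
  have "foldr (\<lambda>s. partial_deriv (v s) ^^ 0) ss f = f" for ss :: "nat list"
    by (induction ss) auto
  then show ?thesis by (simp add: nabla_def)
qed

context hypercomplex_frame
begin

lemma coord_eq_inner: 
  assumes x: "x \<in> M" and s: "s \<le> m"
  shows "coord v m s x = x \<bullet> v s"
proof -
  have inj: "inj_on v {0..m}"
    by (rule inj_onI) (metis inner_v atLeastAtMost_iff zero_neq_one)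
  have ind: "independent (v ` {0..m})"
    by (rule pairwise_orthogonal_independent)
       (use inner_v in \<open>force simp: pairwise_def orthogonal_def\<close>)+
  have "(\<Sum>b\<in>v ` {0..m}. representation (v ` {0..m}) x b *\<^sub>R b) = x"
    by (rule sum_representation_eq[OF ind]) (use x span_v in auto)
  then have "x = (\<Sum>u=0..m. coord v m u x *\<^sub>R v u)"
    by (simp add: sum.reindex[OF inj] coord_def)
  then have "x \<bullet> v s = (\<Sum>u=0..m. coord v m u x *\<^sub>R v u) \<bullet> v s" by simp
  also have "\<dots> = (\<Sum>u=0..m. if u = s then coord v m u x else 0)"
    unfolding inner_sum_left by (intro sum.cong refl) (use s in \<open>auto simp: inner_v\<close>)
  also have "\<dots> = coord v m s x" using s by simp
  finally show ?thesis ..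
qed

lemma fueter_var_eq: "x \<in> M \<Longrightarrow> s \<le> m \<Longrightarrow> fueter_var v m s x = (x \<bullet> v s) *\<^sub>R 1 - (x \<bullet> 1) *\<^sub>R v s"
  using coord_eq_inner[of x 0] v_0 by (simp add: fueter_var_def coord_eq_inner of_real_def)

text \<open>The equation expresses the derivative along \<open>v 0\<close> by the others; after
  substitution the coefficient of the derivative along \<open>v s\<close> is
  \<open>x_s - x_0 v_s\<close>, the Fueter variable.\<close>

lemma directional_fueter:
  assumes mono: "left_monogenic v m U f" and q: "q \<in> U" and x: "x \<in> M"
  shows "(\<Sum>s\<le>m. (x \<bullet> v s) *\<^sub>R partial_deriv (v s) f q) =
    (\<Sum>s=1..m. fueter_var v m s x * partial_deriv (v s) f q)"
proof -
  have atMost: "{..m} = insert 0 {1..m}" by auto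
  have "partial_deriv (v 0) f q + (\<Sum>s=1..m. v s * partial_deriv (v s) f q) = 0"
    using left_monogenic_sum_0[OF mono q] v_0 unfolding atMost by simp
  then have 0: "partial_deriv (v 0) f q = - (\<Sum>s=1..m. v s * partial_deriv (v s) f q)"
    by (simp add: eq_neg_iff_add_eq_0)
  have "(\<Sum>s=1..m. fueter_var v m s x * partial_deriv (v s) f q) =
     (\<Sum>s=1..m. (x \<bullet> v s) *\<^sub>R partial_deriv (v s) f q) - (x \<bullet> 1) *\<^sub>R (\<Sum>s=1..m. v s * partial_deriv (v s) f q)"
    unfolding scaleR_sum_right sum_subtractf[symmetric]
    by (intro sum.cong refl) (simp add: fueter_var_eq[OF x] left_diff_distrib)
  then show ?thesis
    unfolding atMost using 0 v_0 by simp
qed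

end

section \<open>Iterated partial derivatives and derivatives along rays\<close>

locale frame_open_set = hypercomplex_frame M v m
  for M :: "'a::{real_algebra_1, euclidean_space} set" and v m +
  fixes U :: "'a set"
  assumes U: "openin (top_of_set M) U"
begin

lemma left_monogenic_funpow:
  "left_monogenic v m U f \<Longrightarrow> s \<le> m \<Longrightarrow> left_monogenic v m U ((partial_deriv (v s) ^^ n) f)"
  by (induction n) (auto intro: left_monogenic_partial_deriv U)

lemma partial_deriv_funpow_cong:
  assumes "s \<le> m" "\<And>y. y \<in> U \<Longrightarrow> f y = g y" "x \<in> U"
  shows "(partial_deriv (v s) ^^ n) f x = (partial_deriv (v s) ^^ n) g x"
  using assms(3)
proof (induction n arbitrary: x)
  case (Suc n)
  then show ?case
    by (simp add: partial_deriv_cong[OF U Suc.prems v_in_M[OF assms(1)] Suc.IH])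
qed (use assms in simp)

lemma partial_deriv_funpow_commute:
  assumes mono: "left_monogenic v m U f" and s: "s \<le> m" and u: "u \<le> m" and "x \<in> U"
  shows "partial_deriv (v u) ((partial_deriv (v s) ^^ n) f) x = (partial_deriv (v s) ^^ n) (partial_deriv (v u) f) x"
  using \<open>x \<in> U\<close>
proof (induction n arbitrary: x)
  case (Suc n)
  then show ?case
    using partial_deriv_commute[OF left_monogenic_funpow[OF mono s] U s Suc.prems u]
    by (simp add: partial_deriv_cong[OF U Suc.prems v_in_M[OF s] Suc.IH])
qed simp

lemma left_monogenic_foldr:
  "left_monogenic v m U f \<Longrightarrow> set ss \<subseteq> {..m} \<Longrightarrow> left_monogenic v m U (foldr (\<lambda>s. partial_deriv (v s) ^^ h s) ss f)"
  by (induction ss) (auto intro: left_monogenic_funpow)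

lemma left_monogenic_nabla: "left_monogenic v m U f \<Longrightarrow> left_monogenic v m U (nabla v m h f)"
  unfolding nabla_def by (rule left_monogenic_foldr) auto

text \<open>The outer derivative is commuted inwards past the blocks of other variables until it
  meets its own. Commutation holds on \<open>U\<close> and for monogenic functions, which the inner
  blocks are; distinctness keeps the raised exponent from affecting the blocks behind.\<close>

lemma partial_deriv_foldr:
  assumes mono: "left_monogenic v m U f" and "distinct ss" "u \<in> set ss" "set ss \<subseteq> {..m}" "x \<in> U"
  shows "partial_deriv (v u) (foldr (\<lambda>s. partial_deriv (v s) ^^ h s) ss f) x =
    foldr (\<lambda>s. partial_deriv (v s) ^^ (h(u := Suc (h u))) s) ss f x"
  using assms(2-)
proof (induction ss arbitrary: x)
  case (Cons s ss)
  let ?D = "\<lambda>h ss. foldr (\<lambda>s. partial_deriv (v s) ^^ h s) ss f" and ?h = "h(u := Suc (h u))"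
  show ?case
  proof (cases "s = u")
    case True
    then have "?D ?h ss = ?D h ss"
      using Cons.prems(1) by (intro foldr_cong) auto
    then show ?thesis using True by simp
  next
    case False
    have mono': "left_monogenic v m U (?D h ss)"
      by (rule left_monogenic_foldr[OF mono]) (use Cons.prems in auto)
    have "partial_deriv (v u) ((partial_deriv (v s) ^^ h s) (?D h ss)) x = (partial_deriv (v s) ^^ h s) (partial_deriv (v u) (?D h ss)) x"
      by (rule partial_deriv_funpow_commute[OF mono']) (use Cons.prems in auto)
    also have "\<dots> = (partial_deriv (v s) ^^ h s) (?D ?h ss) x"
      by (rule partial_deriv_funpow_cong) (use Cons False in auto)
    finally show ?thesis using False by simp
  qed
qed simp

lemma partial_deriv_nabla:
  "left_monogenic v m U f \<Longrightarrow> u \<le> m \<Longrightarrow> x \<in> U \<Longrightarrow>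
    partial_deriv (v u) (nabla v m h f) x = nabla v m (h(u := Suc (h u))) f x"
  unfolding nabla_def by (rule partial_deriv_foldr) auto

text \<open>The multinomial formula for the \<open>n\<close>-th derivative at \<open>q\<close> in
  direction \<open>x\<close>, with Fueter polynomials, the symmetrized products of the noncommuting
  Fueter variables, in place of monomials.\<close>

definition line_deriv :: "('a \<Rightarrow> 'a) \<Rightarrow> nat \<Rightarrow> 'a \<Rightarrow> 'a \<Rightarrow> 'a" where
  "line_deriv f n x q = (\<Sum>k\<in>multi_indices m n.
     (fact n / (\<Prod>s=1..m. fact (k s))) *\<^sub>R (fueter_poly v m (\<lambda>s. int (k s)) x * nabla v m k f q))"

lemma line_deriv_0: "line_deriv f 0 x q = f q"
  by (simp add: line_deriv_def multi_indices_0 fueter_poly_0 nabla_0)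

text \<open>In the recursion of the Fueter polynomials the new variable stands on the right, next to
  \<open>nabla\<close>. That is the side on which differentiating \<open>nabla\<close> produces it,
  so associativity suffices to regroup the factors.\<close>

lemma line_deriv_Suc:
  "line_deriv f (Suc n) x q = (\<Sum>k\<in>multi_indices m n. (fact n / (\<Prod>s=1..m. fact (k s))) *\<^sub>R
     (fueter_poly v m (\<lambda>s. int (k s)) x * (\<Sum>s=1..m. fueter_var v m s x * nabla v m (k(s := Suc (k s))) f q)))"
proof -
  let ?P = "\<lambda>k. fueter_poly v m (\<lambda>s. int (k s)) x" and ?N = "\<lambda>k. nabla v m k f q"
  let ?g = "\<lambda>k s. (fact n * real (k s) / (\<Prod>s=1..m. fact (k s))) *\<^sub>R (?P (k(s := k s - 1)) * fueter_var v m s x * ?N k)"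
  have "line_deriv f (Suc n) x q = (\<Sum>k\<in>multi_indices m (Suc n). \<Sum>s=1..m. ?g k s)"
    unfolding line_deriv_def
  proof (intro sum.cong refl)
    fix k assume k: "k \<in> multi_indices m (Suc n)"
    have "(fact (Suc n) / (\<Prod>s=1..m. fact (k s))) *\<^sub>R (?P k * ?N k) =
        (fact n / (\<Prod>s=1..m. fact (k s))) *\<^sub>R ((real (Suc n) *\<^sub>R ?P k) * ?N k)"
      by (simp add: mult.commute)
    also have "\<dots> = (\<Sum>s=1..m. ?g k s)"
      unfolding fueter_poly_Suc[OF k] sum_distrib_right scaleR_sum_right by (simp add: mult.assoc)
    finally show "(fact (Suc n) / (\<Prod>s=1..m. fact (k s))) *\<^sub>R (?P k * ?N k) = (\<Sum>s=1..m. ?g k s)" .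
  qed
  also have "\<dots> = (\<Sum>k\<in>multi_indices m n. \<Sum>s=1..m. ?g (k(s := Suc (k s))) s)"
    by (rule sum_multi_indices_Suc) simp
  also have "\<dots> = (\<Sum>k\<in>multi_indices m n. (fact n / (\<Prod>s=1..m. fact (k s))) *\<^sub>R
     (?P k * (\<Sum>s=1..m. fueter_var v m s x * ?N (k(s := Suc (k s))))))"
  proof (intro sum.cong refl)
    fix k :: "nat \<Rightarrow> nat"
    have "?g (k(s := Suc (k s))) s = (fact n / (\<Prod>s=1..m. fact (k s))) *\<^sub>R (?P k * (fueter_var v m s x * ?N (k(s := Suc (k s)))))"
      if "s \<in> {1..m}" for s
    proof -
      have "(k(s := Suc (k s)))(s := (k(s := Suc (k s))) s - 1) = k" by simp
      moreover have "fact n * real ((k(s := Suc (k s))) s) / (\<Prod>i=1..m. fact ((k(s := Suc (k s))) i)) = fact n / (\<Prod>s=1..m. fact (k s))"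
        unfolding prod_fact_Suc[OF that] by simp
      ultimately show ?thesis by (simp only: mult.assoc)
    qed
    then show "(\<Sum>s=1..m. ?g (k(s := Suc (k s))) s) = (fact n / (\<Prod>s=1..m. fact (k s))) *\<^sub>R
       (?P k * (\<Sum>s=1..m. fueter_var v m s x * ?N (k(s := Suc (k s)))))"
      by (simp add: sum_distrib_left scaleR_sum_right)
  qed
  finally show ?thesis .
qed

lemma line_deriv_deriv:
  assumes mono: "left_monogenic v m U f" and x: "x \<in> M" and q: "p + t *\<^sub>R x \<in> U"
  shows "((\<lambda>t. line_deriv f n x (p + t *\<^sub>R x)) has_vector_derivative line_deriv f (Suc n) x (p + t *\<^sub>R x)) (at t)"
proof -
  have "((\<lambda>t. nabla v m k f (p + t *\<^sub>R x)) has_vector_derivative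
      (\<Sum>s=1..m. fueter_var v m s x * nabla v m (k(s := Suc (k s))) f (p + t *\<^sub>R x))) (at t)" for k
  proof -
    note mono' = left_monogenic_nabla[OF mono, of k]
    have "(\<Sum>s=1..m. fueter_var v m s x * partial_deriv (v s) (nabla v m k f) (p + t *\<^sub>R x)) =
        (\<Sum>s=1..m. fueter_var v m s x * nabla v m (k(s := Suc (k s))) f (p + t *\<^sub>R x))"
      by (intro sum.cong refl) (simp add: partial_deriv_nabla[OF mono _ q])
    then show ?thesis
      using left_monogenic_directional[OF mono' U q x] directional_fueter[OF mono' q x]
      by (simp add: has_vector_derivative_shift_line[of "nabla v m k f" p x _ t])
  qed
  then show ?thesis
    unfolding line_deriv_Suc unfolding line_deriv_def
    by (intro has_vector_derivative_sum bounded_linear.has_vector_derivative[OF bounded_linear_scaleR_right]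
         has_vector_derivative_times_const)
qed

lemma line_deriv_eq_taylor_part: "line_deriv f n x p = fact n *\<^sub>R taylor_part v m f p n (p + x)"
proof -
  have "k(0 := 0) = k" if "k \<in> multi_indices m n" for k
    using that by (auto simp: multi_indices_def fun_eq_iff)
  then show ?thesis
    unfolding line_deriv_def taylor_part_def taylor_coeff_def scaleR_sum_right
    by (intro sum.cong refl) (simp add: divide_inverse)
qed

end

section \<open>Expansion of the Cauchy kernel\<close>

text \<open>The coefficient of \<open>z ^ i\<close> in \<open>(1 - z) powr (- \<alpha>)\<close>: a
  generalized binomial coefficient with its alternating sign absorbed.\<close>

definition bcoeff :: "real \<Rightarrow> nat \<Rightarrow> real" where
  "bcoeff \<alpha> i = pochhammer \<alpha> i / fact i"

lemma bcoeff_nonneg: "0 \<le> \<alpha> \<Longrightarrow> 0 \<le> bcoeff \<alpha> i"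
  by (simp add: bcoeff_def pochhammer_prod prod_nonneg)

text \<open>Consecutive coefficients have quotient \<open>(\<alpha> + i) / (1 + i)\<close>. For
  \<open>alpha\<close> in the role of \<alpha> the condition amounts to
  \<open>1 \<le> m\<close>.\<close>

lemma bcoeff_mono: "1 \<le> \<alpha> \<Longrightarrow> bcoeff \<alpha> i \<le> bcoeff \<alpha> (Suc i)"
proof -
  assume \<alpha>: "1 \<le> \<alpha>"
  have "bcoeff \<alpha> (Suc i) = bcoeff \<alpha> i * ((\<alpha> + real i) / (1 + real i))"
    by (simp add: bcoeff_def pochhammer_Suc field_simps)
  moreover have "1 \<le> (\<alpha> + real i) / (1 + real i)" using \<alpha> by simp
  ultimately show ?thesis
    using bcoeff_nonneg[of \<alpha> i] \<alpha> mult_left_mono[of 1 "(\<alpha> + real i) / (1 + real i)" "bcoeff \<alpha> i"] by simp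
qed

lemma bcoeff_sums:
  fixes z :: complex
  assumes "norm z < 1"
  shows "(\<lambda>i. of_real (bcoeff \<alpha> i) * z ^ i) sums (1 - z) powr (- of_real \<alpha>)"
proof -
  have "(\<lambda>n. ((- of_real \<alpha>) gchoose n) * (- z) ^ n) sums (1 + (- z)) powr (- of_real \<alpha>)"
    by (rule gen_binomial_complex) (use assms in simp)
  moreover have "((- of_real \<alpha>) gchoose n) * (- z) ^ n = of_real (bcoeff \<alpha> n) * z ^ n" for n
  proof -
    have "(- 1) ^ n * (- 1) ^ n = (1::complex)" by (simp flip: power_mult_distrib)
    moreover have "((- of_real \<alpha>) gchoose n) * (- z) ^ n =
        ((- 1) ^ n * (- 1) ^ n) * (pochhammer (of_real \<alpha>) n / fact n * z ^ n)"
      unfolding gbinomial_pochhammer power_minus[of z] by simp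
    ultimately show ?thesis by (simp add: bcoeff_def pochhammer_of_real)
  qed
  ultimately show ?thesis by simp
qed

lemma bcoeff_summable:
  assumes "0 \<le> q" "q < 1"
  shows "summable (\<lambda>i. bcoeff \<alpha> i * q ^ i)"
proof -
  have "summable (\<lambda>i. of_real (bcoeff \<alpha> i * q ^ i) :: complex)"
    using bcoeff_sums[of "of_real q" \<alpha>] assms by (simp add: sums_iff)
  then show ?thesis by (simp only: summable_of_real_iff)
qed

text \<open>The coefficients of \<open>|1 - t w|\<^sup>-\<^sup>2\<^sup>\<alpha> = (1 - t w)\<^sup>-\<^sup>\<alpha> (1 - t cnj w)\<^sup>-\<^sup>\<alpha>\<close> as a power series in \<open>t\<close>.\<close>

definition bconv :: "real \<Rightarrow> complex \<Rightarrow> nat \<Rightarrow> complex" where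
  "bconv \<alpha> w k = (\<Sum>i\<le>k. of_real (bcoeff \<alpha> i * bcoeff \<alpha> (k - i)) * (w ^ i * cnj w ^ (k - i)))"

text \<open>Conjugation exchanges the summands \<open>i\<close> and \<open>k - i\<close>. For
  nonzero \<open>w\<close> and positive \<alpha> the value is \<open>norm w ^ k\<close> times a
  Gegenbauer polynomial in the cosine of the argument of \<open>w\<close>.\<close>

lemma bconv_of_real: "bconv \<alpha> w k = of_real (Re (bconv \<alpha> w k))"
proof -
  have "cnj (bconv \<alpha> w k) = bconv \<alpha> w k"
    unfolding bconv_def cnj_sum
    by (rule sum.reindex_bij_witness[of _ "\<lambda>i. k - i" "\<lambda>i. k - i"]) (auto simp: mult_ac)
  then show ?thesis
    using of_real_Re[of "bconv \<alpha> w k"] by (simp add: Reals_cnj_iff)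
qed

lemma bconv_1: "bconv \<alpha> 1 k = of_real (pochhammer (2 * \<alpha>) k / fact k)"
proof -
  have "(\<Sum>i\<le>k. bcoeff \<alpha> i * bcoeff \<alpha> (k - i)) = (\<Sum>i\<le>k. (real (k choose i) * pochhammer \<alpha> i * pochhammer \<alpha> (k - i)) / fact k)"
    by (intro sum.cong refl) (simp add: bcoeff_def binomial_fact)
  also have "\<dots> = pochhammer (2 * \<alpha>) k / fact k"
    using pochhammer_binomial_sum[of \<alpha> \<alpha> k] by (simp add: sum_divide_distrib)
  finally show ?thesis by (simp add: bconv_def flip: of_real_mult of_real_sum)
qed

lemma pochhammer_choose: "pochhammer (real m + 1) k / fact k = real ((k + m) choose m)"
proof -
  have "pochhammer 1 (m + k) = pochhammer 1 m * pochhammer (1 + real m) k"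
    by (rule pochhammer_product')
  then have "fact (k + m) = fact m * pochhammer (real m + 1) k"
    by (simp add: pochhammer_fact[symmetric] add.commute)
  then show ?thesis by (simp add: binomial_fact)
qed

lemma norm_bcoeff_summable:
  fixes z :: complex
  assumes "norm z < 1" "0 \<le> \<alpha>"
  shows "summable (\<lambda>i. norm (of_real (bcoeff \<alpha> i) * z ^ i))"
  using bcoeff_summable[of "norm z" \<alpha>] assms by (simp add: norm_mult norm_power bcoeff_nonneg)

text \<open>The Cauchy product of the series of \<open>(1 - z) powr (- \<alpha>)\<close> and its
  conjugate, whose value is a squared modulus.\<close>

lemma bconv_sums_aux:
  fixes z :: complex
  assumes z: "norm z < 1" and \<alpha>: "0 \<le> \<alpha>"
  shows "bconv \<alpha> z sums (of_real (norm (1 - z) powr (- 2 * \<alpha>)))"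
proof -
  let ?a = "\<lambda>i. of_real (bcoeff \<alpha> i) * z ^ i" and ?b = "\<lambda>i. of_real (bcoeff \<alpha> i) * cnj z ^ i"
  let ?S = "(1 - z) powr (- of_real \<alpha>)"
  have a: "?a sums ?S" by (rule bcoeff_sums[OF z])
  have b: "?b sums cnj ?S"
    using sums_cnj[THEN iffD2, OF a] by simp
  have "(\<lambda>k. \<Sum>i\<le>k. ?a i * ?b (k - i)) sums ((\<Sum>i. ?a i) * (\<Sum>i. ?b i))"
    by (rule Cauchy_product_sums) (use norm_bcoeff_summable[OF _ \<alpha>] z in simp_all)
  also have "(\<lambda>k. \<Sum>i\<le>k. ?a i * ?b (k - i)) = bconv \<alpha> z"
    by (simp add: bconv_def fun_eq_iff mult_ac)
  also have "(\<Sum>i. ?a i) * (\<Sum>i. ?b i) = of_real ((norm ?S)\<^sup>2)"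
    using a b complex_norm_square[of ?S] by (simp add: sums_iff)
  also have "norm ?S = norm (1 - z) powr (- \<alpha>)"
  proof -
    have "1 - z \<noteq> 0" using z by auto
    then show ?thesis by (simp add: powr_def norm_exp_eq_Re)
  qed
  also have "(norm (1 - z) powr (- \<alpha>))\<^sup>2 = norm (1 - z) powr (- 2 * \<alpha>)"
    by (simp add: power2_eq_square powr_add[symmetric])
  finally show ?thesis .
qed

lemma bconv_scale: "bconv \<alpha> (of_real t * w) k = of_real (t ^ k) * bconv \<alpha> w k"
proof -
  have "(of_real t * w) ^ i * cnj (of_real t * w) ^ (k - i) = of_real (t ^ k) * (w ^ i * cnj w ^ (k - i))"
    if "i \<le> k" for i
  proof -
    have "t ^ i * t ^ (k - i) = t ^ k" using that by (simp flip: power_add)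
    then have "of_real (t ^ i) * of_real (t ^ (k - i)) = (of_real (t ^ k) :: complex)"
      by (metis of_real_mult)
    moreover have "(of_real t * w) ^ i * cnj (of_real t * w) ^ (k - i) =
        (of_real (t ^ i) * of_real (t ^ (k - i))) * (w ^ i * cnj w ^ (k - i))"
      by (simp add: power_mult_distrib mult_ac)
    ultimately show ?thesis by (simp only:)
  qed
  then show ?thesis
    unfolding bconv_def sum_distrib_left by (intro sum.cong refl) (simp add: mult.left_commute)
qed

lemma bconv_sums:
  assumes "\<bar>t\<bar> * norm w < 1" "0 \<le> \<alpha>"
  shows "(\<lambda>k. t ^ k * Re (bconv \<alpha> w k)) sums (norm (1 - of_real t * w) powr (- 2 * \<alpha>))"
proof -
  have "bconv \<alpha> (of_real t * w) sums (of_real (norm (1 - of_real t * w) powr (- 2 * \<alpha>)))"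
    by (rule bconv_sums_aux) (use assms in \<open>simp_all add: norm_mult\<close>)
  then have "(\<lambda>k. Re (bconv \<alpha> (of_real t * w) k)) sums Re (of_real (norm (1 - of_real t * w) powr (- 2 * \<alpha>)))"
    by (rule sums_Re)
  then show ?thesis by (simp add: bconv_scale)
qed

text \<open>Coefficients of \<open>t\<close> times the series of \<open>bconv\<close>; they occur
  because \<open>cj (y - t x) = cj y - t cj x\<close> contributes a further factor
  \<open>t\<close>.\<close>

definition bconv' :: "real \<Rightarrow> complex \<Rightarrow> nat \<Rightarrow> complex" where
  "bconv' \<alpha> w k = (case k of 0 \<Rightarrow> 0 | Suc j \<Rightarrow> bconv \<alpha> w j)"

text \<open>
  The difference has the nonnegative coefficients \<open>c\<^sub>i - c\<^sub>i\<^sub>-\<^sub>1\<close> in place of \<open>c\<^sub>i\<close>, which avoids the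
  factor 2 of the triangle inequality.
\<close>

lemma norm_bconv_diff_le:
  assumes \<alpha>: "1 \<le> \<alpha>"
  shows "norm (bconv \<alpha> w k - w * bconv' \<alpha> w k) \<le> pochhammer (2 * \<alpha>) k / fact k * norm w ^ k"
proof -
  let ?c = "bcoeff \<alpha>"
  define d where "d i = (case i of 0 \<Rightarrow> 0 | Suc j \<Rightarrow> ?c j)" for i
  have d: "0 \<le> d i" "d i \<le> ?c i" for i
    using \<alpha> bcoeff_nonneg[of \<alpha>] bcoeff_mono[OF \<alpha>] by (auto simp: d_def split: nat.split)
  \<comment> \<open>Multiplication by \<open>w\<close> raises the power of \<open>w\<close> and not
    that of its conjugate, so only the first coefficient of each product is shifted.\<close>
  have "w * bconv' \<alpha> w k = (\<Sum>i\<le>k. of_real (d i * ?c (k - i)) * (w ^ i * cnj w ^ (k - i)))"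
  proof (cases k)
    case 0
    then show ?thesis by (simp add: bconv'_def d_def)
  next
    case (Suc j)
    have "(\<Sum>i\<le>Suc j. of_real (d i * ?c (Suc j - i)) * (w ^ i * cnj w ^ (Suc j - i))) =
        (\<Sum>i\<le>j. of_real (?c i * ?c (j - i)) * (w ^ Suc i * cnj w ^ (j - i)))"
      by (subst sum.atMost_Suc_shift) (simp add: d_def)
    then show ?thesis
      using Suc by (simp add: bconv'_def bconv_def sum_distrib_left mult_ac)
  qed
  then have "bconv \<alpha> w k - w * bconv' \<alpha> w k =
      (\<Sum>i\<le>k. of_real ((?c i - d i) * ?c (k - i)) * (w ^ i * cnj w ^ (k - i)))"
    by (simp add: bconv_def left_diff_distrib flip: sum_subtractf)
  also have "norm \<dots> \<le> (\<Sum>i\<le>k. ?c i * ?c (k - i) * norm w ^ k)"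
  proof (rule sum_norm_le)
    fix i assume "i \<in> {..k}"
    then have "norm w ^ i * norm w ^ (k - i) = norm w ^ k" by (simp flip: power_add)
    moreover have "\<bar>?c i - d i\<bar> \<le> ?c i" using d[of i] by simp
    ultimately show "norm (of_real ((?c i - d i) * ?c (k - i)) * (w ^ i * cnj w ^ (k - i))) \<le> ?c i * ?c (k - i) * norm w ^ k"
      using \<alpha> bcoeff_nonneg[of \<alpha>]
      by (simp add: norm_mult norm_power abs_mult mult_right_mono del: of_real_mult of_real_diff)
  qed
  also have "\<dots> = Re (bconv \<alpha> 1 k) * norm w ^ k"
    by (simp add: bconv_def sum_distrib_right)
  finally show ?thesis unfolding bconv_1 Re_complex_of_real .
qed

lemma Re_bconv_1: "Re (bconv ((real m + 1) / 2) 1 k) = real ((k + m) choose m)"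
proof -
  have "2 * ((real m + 1) / 2) = real m + 1" by simp
  then show ?thesis
    unfolding bconv_1 by (simp only: pochhammer_choose Re_complex_of_real)
qed

text \<open>At \<open>w = 1\<close> the expansion becomes the series of
  \<open>(1 - q) powr (- (m + 1))\<close>, whose coefficients these are.\<close>

lemma choose_power_summable:
  assumes "0 \<le> q" "q < 1"
  shows "summable (\<lambda>k. real ((k + m) choose m) * q ^ k)"
proof -
  have "(\<lambda>k. q ^ k * Re (bconv ((real m + 1) / 2) 1 k)) sums (norm (1 - of_real q * (1::complex)) powr (- 2 * ((real m + 1) / 2)))"
    by (rule bconv_sums) (use assms in simp_all)
  then show ?thesis
    unfolding Re_bconv_1 by (simp add: sums_iff mult.commute)
qed

context hypercomplex_frame
begin

text \<open>
  In the plane of \<open>x\<close> and \<open>y\<close>, \<open>ratio x y\<close> is the complex number \<open>x / y\<close> up to conjugation, so that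
  \<open>|y - t x| = |y| |1 - t ratio x y|\<close>.
\<close>

definition ratio :: "'a \<Rightarrow> 'a \<Rightarrow> complex" where
  "ratio x y = of_real (x \<bullet> y / (y \<bullet> y)) +
     \<i> * of_real (sqrt (x \<bullet> x / (y \<bullet> y) - (x \<bullet> y / (y \<bullet> y))\<^sup>2))"

lemma Re_ratio: "Re (ratio x y) = x \<bullet> y / (y \<bullet> y)"
  by (simp add: ratio_def)

lemma norm_ratio:
  assumes "y \<noteq> 0"
  shows "(norm (ratio x y))\<^sup>2 = x \<bullet> x / (y \<bullet> y)" and "norm (ratio x y) = norm x / norm y"
proof -
  \<comment> \<open>Cauchy-Schwarz makes the radicand in \<open>ratio\<close> nonnegative.\<close>
  have "(x \<bullet> y)\<^sup>2 \<le> (x \<bullet> x) * (y \<bullet> y)" by (rule Cauchy_Schwarz_ineq)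
  then have "(x \<bullet> y / (y \<bullet> y))\<^sup>2 \<le> x \<bullet> x / (y \<bullet> y)"
    using assms by (simp add: power_divide power2_eq_square divide_simps) 
  then show 1: "(norm (ratio x y))\<^sup>2 = x \<bullet> x / (y \<bullet> y)"
    by (simp add: cmod_power2 ratio_def)
  have "(norm (ratio x y))\<^sup>2 = (norm x / norm y)\<^sup>2"
    unfolding 1 by (simp add: power_divide power2_norm_eq_inner)
  then show "norm (ratio x y) = norm x / norm y"
    by (rule power2_eq_imp_eq) auto
qed

lemma continuous_ratio: "continuous_on {y. y \<noteq> 0} (ratio x)"
  unfolding ratio_def by (intro continuous_intros) auto

lemma norm_one_minus_ratio:
  assumes "y \<noteq> 0"
  shows "(y - t *\<^sub>R x) \<bullet> (y - t *\<^sub>R x) = (y \<bullet> y) * (norm (1 - of_real t * ratio x y))\<^sup>2"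
proof -
  have "(norm (1 - of_real t * ratio x y))\<^sup>2 = 1 - 2 * t * Re (ratio x y) + t\<^sup>2 * (norm (ratio x y))\<^sup>2"
    by (simp only: cmod_power2) (simp add: power2_eq_square algebra_simps)
  also have "\<dots> = 1 - 2 * t * (x \<bullet> y / (y \<bullet> y)) + t\<^sup>2 * (x \<bullet> x / (y \<bullet> y))"
    by (simp only: Re_ratio norm_ratio(1)[OF assms])
  finally have "(y \<bullet> y) * (norm (1 - of_real t * ratio x y))\<^sup>2 = y \<bullet> y - 2 * t * (x \<bullet> y) + t\<^sup>2 * (x \<bullet> x)"
    using assms by (simp add: distrib_left right_diff_distrib)
  moreover have "(y - t *\<^sub>R x) \<bullet> (y - t *\<^sub>R x) = y \<bullet> y - 2 * t * (x \<bullet> y) + t\<^sup>2 * (x \<bullet> x)"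
    by (simp add: inner_diff_left inner_diff_right inner_commute[of y x] power2_eq_square right_diff_distrib)
  ultimately show ?thesis by (simp only:)
qed

text \<open>The coefficient of \<open>t ^ k\<close> in \<open>ker 0 (y - t *\<^sub>R x)\<close>. As
  a real combination of \<open>cj y\<close> and \<open>cj x\<close> it lies in \<open>M\<close> for
  \<open>x\<close> and \<open>y\<close> in \<open>M\<close>, so that \<open>mult_bound\<close>
  applies.\<close>

definition kernel_coeff :: "nat \<Rightarrow> 'a \<Rightarrow> 'a \<Rightarrow> 'a" where
  "kernel_coeff k x y = (y \<bullet> y) powr (- alpha) *\<^sub>R
     (Re (bconv alpha (ratio x y) k) *\<^sub>R cj y - Re (bconv' alpha (ratio x y) k) *\<^sub>R cj x)"

lemma alpha_ge_1: "1 \<le> alpha"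
  using m_ge_1 by (simp add: alpha_def)

lemma cj_in_M: "z \<in> M \<Longrightarrow> cj z \<in> M"
  unfolding cj_def using one_in_M subspace_M by (simp add: subspace_diff subspace_scale)

lemma kernel_coeff_in_M: "x \<in> M \<Longrightarrow> y \<in> M \<Longrightarrow> kernel_coeff k x y \<in> M"
  unfolding kernel_coeff_def using subspace_M by (simp add: subspace_diff subspace_scale cj_in_M)

lemma kernel_coeff_sums:
  assumes "\<bar>t\<bar> * norm x < norm y"
  shows "(\<lambda>k. t ^ k *\<^sub>R kernel_coeff k x y) sums ker 0 (y - t *\<^sub>R x)"
proof -
  have "0 \<le> \<bar>t\<bar> * norm x" by simp
  with assms have y: "0 < norm y" by linarith
  then have y0: "y \<noteq> 0" by simp
  let ?w = "ratio x y" and ?n = "(y \<bullet> y) powr (- alpha)"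
  let ?S = "norm (1 - of_real t * ratio x y) powr (- 2 * alpha)"
  have 1: "(\<lambda>k. t ^ k * Re (bconv alpha ?w k)) sums ?S"
    using assms y alpha_ge_1 by (intro bconv_sums) (simp_all add: norm_ratio(2)[OF y0] field_simps)
  have "(\<lambda>k. t ^ Suc k * Re (bconv' alpha ?w (Suc k))) sums (t * ?S)"
    using sums_mult[OF 1, of t] by (simp add: bconv'_def mult.assoc)
  then have 2: "(\<lambda>k. t ^ k * Re (bconv' alpha ?w k)) sums (t * ?S)"
    using sums_Suc[of "\<lambda>k. t ^ k * Re (bconv' alpha ?w k)"] by (simp add: bconv'_def)
  have "(\<lambda>k. ?n *\<^sub>R ((t ^ k * Re (bconv alpha ?w k)) *\<^sub>R cj y - (t ^ k * Re (bconv' alpha ?w k)) *\<^sub>R cj x))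
      sums (?n *\<^sub>R (?S *\<^sub>R cj y - (t * ?S) *\<^sub>R cj x))"
    by (intro bounded_linear.sums[OF bounded_linear_scaleR_right] sums_diff
        bounded_linear.sums[OF bounded_linear_scaleR_left] 1 2)
  moreover have "?n *\<^sub>R (?S *\<^sub>R cj y - (t * ?S) *\<^sub>R cj x) = ker 0 (y - t *\<^sub>R x)"
  proof -
    have "((y - t *\<^sub>R x) \<bullet> (y - t *\<^sub>R x)) powr (- alpha) = ?n * ((norm (1 - of_real t * ?w))\<^sup>2) powr (- alpha)"
      unfolding norm_one_minus_ratio[OF y0] by (simp add: powr_mult)
    also have "((norm (1 - of_real t * ?w))\<^sup>2) powr (- alpha) = ?S"
    proof (cases "norm (1 - of_real t * ?w) = 0")
      case False
      then have "(norm (1 - of_real t * ?w))\<^sup>2 = norm (1 - of_real t * ?w) powr 2"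
        by (simp add: powr_numeral)
      then show ?thesis by (simp only: powr_powr) simp
    qed simp
    finally have "((y - t *\<^sub>R x) \<bullet> (y - t *\<^sub>R x)) powr (- alpha) = ?n * ?S" .
    moreover have "cj (y - t *\<^sub>R x) = cj y - t *\<^sub>R cj x"
      using cj_line[of y "- t" x] by simp
    ultimately show ?thesis
      unfolding ker_def by (simp add: scaleR_diff_right mult_ac)
  qed
  ultimately show ?thesis by (simp add: kernel_coeff_def scaleR_diff_right mult_ac)
qed

text \<open>With real \<open>A\<close> and \<open>B\<close> the norm of
  \<open>A cj y - B cj x\<close> depends only on the inner products of \<open>x\<close> and
  \<open>y\<close>, and equals \<open>norm y\<close> times the modulus of \<open>A - w B\<close> for
  \<open>w = ratio x y\<close>, which \<open>norm_bconv_diff_le\<close> estimates.\<close>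

lemma norm_kernel_coeff_le:
  assumes y: "y \<noteq> 0"
  shows "norm (kernel_coeff k x y) \<le> real ((k + m) choose m) * (norm x / norm y) ^ k * ((y \<bullet> y) powr (- alpha) * norm y)"
proof -
  let ?w = "ratio x y"
  define A where "A = Re (bconv alpha ?w k)"
  define B where "B = Re (bconv' alpha ?w k)"
  have A: "bconv alpha ?w k = of_real A" unfolding A_def by (rule bconv_of_real)
  have B: "bconv' alpha ?w k = of_real B"
    unfolding B_def bconv'_def by (cases k) (simp_all add: bconv_of_real[symmetric])
  have cj_inner: "cj y \<bullet> cj x = y \<bullet> x"
    by (simp add: cj_def inner_diff_left inner_diff_right inner_1_1 inner_commute[of 1 x])
  have "(norm (A *\<^sub>R cj y - B *\<^sub>R cj x))\<^sup>2 = A\<^sup>2 * (y \<bullet> y) - 2 * A * B * (x \<bullet> y) + B\<^sup>2 * (x \<bullet> x)"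
    unfolding power2_norm_eq_inner
    using norm_cj[of x] norm_cj[of y]
    by (simp add: inner_diff_left inner_diff_right cj_inner inner_commute[of "cj x" "cj y"] inner_commute[of y x]
        norm_eq_sqrt_inner power2_eq_square algebra_simps)
  also have "\<dots> = (y \<bullet> y) * (A\<^sup>2 - 2 * A * B * Re ?w + B\<^sup>2 * (norm ?w)\<^sup>2)"
    unfolding Re_ratio norm_ratio(1)[OF y] using y by (simp add: distrib_left right_diff_distrib)
  also have "A\<^sup>2 - 2 * A * B * Re ?w + B\<^sup>2 * (norm ?w)\<^sup>2 = (norm (of_real A - ?w * of_real B))\<^sup>2"
    by (simp only: cmod_power2) (simp add: power2_eq_square algebra_simps)
  also have "(y \<bullet> y) * \<dots> = (norm y * norm (of_real A - ?w * of_real B))\<^sup>2"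
    by (simp add: power_mult_distrib power2_norm_eq_inner)
  finally have "norm (A *\<^sub>R cj y - B *\<^sub>R cj x) = norm y * norm (of_real A - ?w * of_real B)"
    by (rule power2_eq_imp_eq) auto
  also have "norm (of_real A - ?w * of_real B) \<le> real ((k + m) choose m) * (norm x / norm y) ^ k"
  proof -
    have "2 * alpha = real m + 1" by (simp add: alpha_def)
    then show ?thesis
      using norm_bconv_diff_le[OF alpha_ge_1, of ?w k] unfolding A B
      by (simp only: pochhammer_choose norm_ratio(2)[OF y])
  qed
  finally have "norm (A *\<^sub>R cj y - B *\<^sub>R cj x) \<le> norm y * (real ((k + m) choose m) * (norm x / norm y) ^ k)"
    by (simp add: mult_left_mono)
  then have "(y \<bullet> y) powr (- alpha) * norm (A *\<^sub>R cj y - B *\<^sub>R cj x) \<le>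
      (y \<bullet> y) powr (- alpha) * (norm y * (real ((k + m) choose m) * (norm x / norm y) ^ k))"
    by (rule mult_left_mono) simp
  then show ?thesis
    unfolding kernel_coeff_def A_def[symmetric] B_def[symmetric] by (simp add: mult_ac)
qed

lemma continuous_kernel_coeff: "continuous_on {y. y \<noteq> 0} (kernel_coeff k x)"
proof -
  have b: "continuous_on {y. y \<noteq> 0} (\<lambda>y. bconv alpha (ratio x y) j)" for j
    unfolding bconv_def by (intro continuous_intros continuous_ratio)
  have "continuous_on {y. y \<noteq> 0} (\<lambda>y. bconv' alpha (ratio x y) k)"
    unfolding bconv'_def by (cases k) (auto intro: b)
  then show ?thesis
    unfolding kernel_coeff_def by (intro continuous_intros continuous_cj b) auto
qed

lemma
  shows mult_bound_le: "u \<in> M \<Longrightarrow> norm (u * w) \<le> mult_bound M * norm u * norm w"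
    and mult_bound_nonneg: "0 \<le> mult_bound M"
proof -
  let ?S = "{(u, w). u \<in> M \<and> norm u = 1 \<and> norm (w::'a) = 1}"
  have "?S = (M \<inter> sphere 0 1) \<times> sphere 0 1" by auto
  then have "compact ?S"
    using closed_M by (simp add: compact_Times closed_Int_compact)
  moreover have "(1, 1) \<in> ?S" using one_in_M norm_1 by simp
  then have "?S \<noteq> {}" by blast
  moreover have "continuous_on ?S (\<lambda>(u, w). norm (u * w))"
    unfolding case_prod_beta by (intro continuous_intros continuous_on_times)
  ultimately have max: "(\<lambda>(u, w). norm (u * w)) z \<le> mult_bound M" if "z \<in> ?S" for z
    unfolding mult_bound_def using max_on_attained(2) that by blast
  show 0: "0 \<le> mult_bound M"
    using max[OF \<open>(1, 1) \<in> ?S\<close>] by (simp add: norm_1)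
  show "norm (u * w) \<le> mult_bound M * norm u * norm w" if u: "u \<in> M" for u w
  proof (cases "u = 0 \<or> w = 0")
    case False
    have "norm (((1 / norm u) *\<^sub>R u) * ((1 / norm w) *\<^sub>R w)) \<le> mult_bound M"
      using max[of "((1 / norm u) *\<^sub>R u, (1 / norm w) *\<^sub>R w)"] u subspace_M False
      by (simp add: subspace_scale)
    then show ?thesis using False by (simp add: field_simps)
  qed auto
qed

end

section \<open>The homogeneous parts as integrals, and their estimate\<close>

context monogenic_ball
begin

definition taylor_integral :: "nat \<Rightarrow> 'a \<Rightarrow> 'a" where
  "taylor_integral k x = inverse (total a b) *\<^sub>R integral\<^sup>L mu (\<lambda>y. kernel_coeff k x y * shell_density a b f y)"

lemma integrable_kernel_coeff: "integrable mu (\<lambda>y. kernel_coeff k x y * shell_density a b f y)"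
  using integrable_kernel[OF continuous_kernel_coeff, of 0 k x] a_pos by simp

text \<open>The left factors \<open>y\<close> and \<open>kernel_coeff k x y\<close> both lie in
  \<open>M\<close>, whence the square of \<open>mult_bound M\<close>. Two factors
  \<open>norm y\<close> combine with the kernel power to
  \<open>(y \<bullet> y) powr (1 - alpha)\<close>, the integrand of \<open>total\<close>, so that
  integration cancels the constant of the Cauchy formula.\<close>

lemma norm_kernel_coeff_shell_density_le:
  assumes x: "x \<in> M" and y: "y \<in> M" and K: "\<And>y. y \<in> M \<Longrightarrow> a \<le> y \<bullet> y \<Longrightarrow> y \<bullet> y \<le> b \<Longrightarrow> norm (f y) \<le> K"
  shows "norm (kernel_coeff k x y * shell_density a b f y) \<le>
    ((mult_bound M)\<^sup>2 * real ((k + m) choose m) * (norm x / sqrt a) ^ k * K) * (weight a b y * (y \<bullet> y) powr (1 - alpha))"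
proof (cases "weight a b y = 0")
  case True
  then show ?thesis by (simp add: shell_density_def)
next
  case False
  then have ya: "a < y \<bullet> y" and yb: "y \<bullet> y < b" using inside(2)[of y] outside(2)[of y] by (meson not_le)+
  then have y0: "y \<noteq> 0" using a_pos by auto
  have sq: "sqrt a \<le> norm y" "0 < sqrt a" using ya a_pos by (simp_all add: norm_eq_sqrt_inner)
  let ?\<omega> = "mult_bound M" and ?g = "real ((k + m) choose m)"
  have "norm (y * f y) \<le> ?\<omega> * norm y * norm (f y)" by (rule mult_bound_le[OF y])
  also have "\<dots> \<le> ?\<omega> * norm y * K"
    using K[OF y] ya yb mult_bound_nonneg by (intro mult_left_mono) auto
  finally have 1: "norm (shell_density a b f y) \<le> weight a b y * (?\<omega> * norm y * K)"
    using weight_nonneg[of a b y] by (simp add: shell_density_def mult_left_mono)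
  have K0: "0 \<le> K" using order_trans[OF norm_ge_zero K[OF y]] ya yb by simp
  have "(norm x / norm y) ^ k \<le> (norm x / sqrt a) ^ k"
    using sq y0 by (intro power_mono divide_left_mono) auto
  then have 2: "norm (kernel_coeff k x y) \<le> ?g * (norm x / sqrt a) ^ k * ((y \<bullet> y) powr (- alpha) * norm y)"
    by (intro order_trans[OF norm_kernel_coeff_le[OF y0]] mult_right_mono mult_left_mono) auto
  have "norm (kernel_coeff k x y * shell_density a b f y) \<le> ?\<omega> * norm (kernel_coeff k x y) * norm (shell_density a b f y)"
    by (rule mult_bound_le[OF kernel_coeff_in_M[OF x y]])
  also have "\<dots> \<le> ?\<omega> * (?g * (norm x / sqrt a) ^ k * ((y \<bullet> y) powr (- alpha) * norm y)) * (weight a b y * (?\<omega> * norm y * K))"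
    using mult_bound_nonneg a_pos by (intro mult_mono 1 2 mult_left_mono mult_nonneg_nonneg) auto
  also have "\<dots> = (?\<omega>\<^sup>2 * ?g * (norm x / sqrt a) ^ k * K) * (weight a b y * ((y \<bullet> y) powr (- alpha) * (norm y)\<^sup>2))"
    by (simp add: power2_eq_square mult_ac)
  also have "(y \<bullet> y) powr (- alpha) * (norm y)\<^sup>2 = (y \<bullet> y) powr (1 - alpha)"
    using y0 powr_mult_base[of "y \<bullet> y" "- alpha"] by (simp add: power2_norm_eq_inner mult.commute)
  finally show ?thesis .
qed

lemma integrable_weight_powr: "integrable mu (\<lambda>y. weight a b y * (y \<bullet> y) powr q)"
  by (rule integrable_mu_continuous[where r = "sqrt b", OF continuous_weight_powr])
     (simp add: outside sqrt_outside)

lemma norm_integral_kernel_coeff_le: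
  assumes x: "x \<in> M" and K: "\<And>y. y \<in> M \<Longrightarrow> a \<le> y \<bullet> y \<Longrightarrow> y \<bullet> y \<le> b \<Longrightarrow> norm (f y) \<le> K"
  shows "integral\<^sup>L mu (\<lambda>y. norm (kernel_coeff k x y * shell_density a b f y)) \<le>
    ((mult_bound M)\<^sup>2 * real ((k + m) choose m) * (norm x / sqrt a) ^ k * K) * total a b"
proof -
  have "integral\<^sup>L mu (\<lambda>y. norm (kernel_coeff k x y * shell_density a b f y)) \<le> integral\<^sup>L mu (\<lambda>y.
     ((mult_bound M)\<^sup>2 * real ((k + m) choose m) * (norm x / sqrt a) ^ k * K) * (weight a b y * (y \<bullet> y) powr (1 - alpha)))"
    by (intro integral_mono_AE integrable_norm integrable_kernel_coeff integrable_mult_right integrable_weight_powr AE_I2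
        norm_kernel_coeff_shell_density_le x K) (simp_all add: space_mu)
  then show ?thesis by (simp add: total_def)
qed

lemma norm_taylor_integral_le:
  assumes x: "x \<in> M" and K: "\<And>y. y \<in> M \<Longrightarrow> a \<le> y \<bullet> y \<Longrightarrow> y \<bullet> y \<le> b \<Longrightarrow> norm (f y) \<le> K"
  shows "norm (taylor_integral k x) \<le> (mult_bound M)\<^sup>2 * real ((k + m) choose m) * (norm x / sqrt a) ^ k * K"
proof -
  have "norm (integral\<^sup>L mu (\<lambda>y. kernel_coeff k x y * shell_density a b f y)) \<le>
    ((mult_bound M)\<^sup>2 * real ((k + m) choose m) * (norm x / sqrt a) ^ k * K) * total a b"
    by (rule order_trans[OF integral_norm_bound norm_integral_kernel_coeff_le[OF x K]])
  then show ?thesis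
    using total_pos by (simp add: taylor_integral_def divide_inverse_commute[symmetric] pos_divide_le_eq)
qed

lemma taylor_integral_sums:
  assumes x: "x \<in> M" and t: "\<bar>t\<bar> * norm x < sqrt a"
  shows "(\<lambda>k. t ^ k *\<^sub>R taylor_integral k x) sums f (t *\<^sub>R x)"
proof -
  have "continuous_on {y \<in> M. norm y \<le> sqrt b} f"
  proof (rule continuous_on_subset[OF continuous_f])
    have "sqrt b < \<rho>" using b_less \<rho>_pos real_sqrt_less_iff[of b "\<rho>\<^sup>2"] by simp
    then show "{y \<in> M. norm y \<le> sqrt b} \<subseteq> {y \<in> M. norm y < \<rho>}" by auto
  qed
  then obtain K where "\<And>y. y \<in> M \<Longrightarrow> norm y \<le> sqrt b \<Longrightarrow> norm (f y) \<le> K"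
    using bounded_on_ball_M by blast
  then have K: "norm (f y) \<le> K" if "y \<in> M" "a \<le> y \<bullet> y" "y \<bullet> y \<le> b" for y
    using that by (simp add: norm_eq_sqrt_inner)
  define h where "h k y = t ^ k *\<^sub>R (kernel_coeff k x y * shell_density a b f y)" for k y
  have tx: "t *\<^sub>R x \<in> M" "(t *\<^sub>R x) \<bullet> (t *\<^sub>R x) < a"
    using x subspace_M t a_pos by (simp_all add: subspace_scale ball_eq_inner del: inner_scaleR_left inner_scaleR_right)
  have h_sums: "(\<lambda>k. h k y) sums (ker 0 (y - t *\<^sub>R x) * shell_density a b f y)" for y
  proof (cases "shell_density a b f y = 0")
    case False
    then have "a < y \<bullet> y" using shell_density_inside by (meson not_le)
    then have "sqrt a < norm y" by (simp add: norm_eq_sqrt_inner)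
    then have "(\<lambda>k. t ^ k *\<^sub>R kernel_coeff k x y) sums ker 0 (y - t *\<^sub>R x)"
      using t by (intro kernel_coeff_sums) simp
    from bounded_linear.sums[OF bounded_linear_times_left this]
    show ?thesis by (simp add: h_def)
  qed (simp add: h_def)
  \<comment> \<open>The ratio in the majorant: both summability conditions for exchanging sum and
    integral reduce to \<open>choose_power_summable\<close>.\<close>
  define q where "q = \<bar>t\<bar> * norm x / sqrt a"
  have q: "0 \<le> q" "q < 1" using t a_pos by (simp_all add: q_def)
  have bound: "\<bar>t\<bar> ^ k * ((mult_bound M)\<^sup>2 * real ((k + m) choose m) * (norm x / sqrt a) ^ k * K * C) =
      (real ((k + m) choose m) * q ^ k) * ((mult_bound M)\<^sup>2 * K * C)" for k C
    by (simp add: q_def power_mult_distrib power_divide)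
  have "(\<lambda>k. integral\<^sup>L mu (h k)) sums integral\<^sup>L mu (\<lambda>y. \<Sum>k. h k y)"
  proof (rule sums_integral)
    show "integrable mu (h k)" for k
      unfolding h_def by (intro integrable_scaleR_right integrable_kernel_coeff)
    show "AE y in mu. summable (\<lambda>k. norm (h k y))"
    proof (rule AE_I2)
      fix y assume "y \<in> space mu"
      then have y: "y \<in> M" by (simp add: space_mu)
      show "summable (\<lambda>k. norm (h k y))"
      proof (rule summable_comparison_test')
        show "summable (\<lambda>k. (real ((k + m) choose m) * q ^ k) * ((mult_bound M)\<^sup>2 * K * (weight a b y * (y \<bullet> y) powr (1 - alpha))))"
          by (intro summable_mult2 choose_power_summable q)
        show "norm (norm (h k y)) \<le> (real ((k + m) choose m) * q ^ k) * ((mult_bound M)\<^sup>2 * K * (weight a b y * (y \<bullet> y) powr (1 - alpha)))" for k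
          unfolding bound[symmetric] using norm_kernel_coeff_shell_density_le[OF x y K, of k]
          by (simp add: h_def power_abs mult_left_mono)
      qed
    qed
    show "summable (\<lambda>k. integral\<^sup>L mu (\<lambda>y. norm (h k y)))"
    proof (rule summable_comparison_test')
      show "summable (\<lambda>k. (real ((k + m) choose m) * q ^ k) * ((mult_bound M)\<^sup>2 * K * total a b))"
        by (intro summable_mult2 choose_power_summable q)
      show "norm (integral\<^sup>L mu (\<lambda>y. norm (h k y))) \<le> (real ((k + m) choose m) * q ^ k) * ((mult_bound M)\<^sup>2 * K * total a b)" for k
        unfolding bound[symmetric] using norm_integral_kernel_coeff_le[OF x K, of k]
        by (simp add: h_def power_abs mult_left_mono)
    qed
  qed
  moreover have "integral\<^sup>L mu (\<lambda>y. \<Sum>k. h k y) = total a b *\<^sub>R f (t *\<^sub>R x)"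
    using h_sums cauchy_formula[OF tx] by (simp add: sums_iff)
  ultimately have "(\<lambda>k. inverse (total a b) *\<^sub>R integral\<^sup>L mu (h k)) sums (inverse (total a b) *\<^sub>R total a b *\<^sub>R f (t *\<^sub>R x))"
    by (intro bounded_linear.sums[OF bounded_linear_scaleR_right]) simp
  moreover have "inverse (total a b) *\<^sub>R integral\<^sup>L mu (h k) = t ^ k *\<^sub>R taylor_integral k x" for k
    by (simp add: h_def[abs_def] taylor_integral_def)
  ultimately show ?thesis using total_pos by simp
qed

end

section \<open>The Taylor expansion\<close>

context frame_open_set
begin

text \<open>For fixed \<open>x\<close> the integrals \<open>taylor_integral\<close> are the
  coefficients of a power series in \<open>t\<close> with sum \<open>f (p + t x)\<close>, whose
  derivatives along the ray are \<open>line_deriv\<close>. Uniqueness of coefficients carries the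
  estimate over to the Taylor parts.\<close>

lemma taylor_expansion:
  assumes mono: "left_monogenic v m U f" and p: "p \<in> M" and ball: "{x \<in> M. norm (x - p) < R} \<subseteq> U"
    and ab: "0 < a" "a < b" "b < R\<^sup>2" "0 < R" and x: "x \<in> M" "norm x < sqrt a"
  shows "(\<lambda>n. taylor_part v m f p n (p + x)) sums f (p + x)"
    and "(\<And>y. y \<in> M \<Longrightarrow> a \<le> y \<bullet> y \<Longrightarrow> y \<bullet> y \<le> b \<Longrightarrow> norm (f (p + y)) \<le> K) \<Longrightarrow>
      norm (taylor_part v m f p n (p + x)) \<le>
        (mult_bound M)\<^sup>2 * real ((n + m) choose m) * (norm x / sqrt a) ^ n * K"
proof -
  interpret B: monogenic_ball M v m "\<lambda>y. f (p + y)" "\<lambda>s y. partial_deriv (v s) f (p + y)" R a b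
    by (rule monogenic_ball_shift[OF mono U p ball ab])
  obtain \<tau> where \<tau>: "1 < \<tau>" "\<tau> * norm x < sqrt a"
  proof (cases "x = 0")
    case True
    then show ?thesis using ab(1) by (intro that[of 2]) auto
  next
    case False
    then have "1 < sqrt a / norm x" using x(2) by simp
    then obtain \<tau> where "1 < \<tau>" "\<tau> < sqrt a / norm x" using dense by blast
    then show ?thesis using False by (intro that[of \<tau>]) (auto simp: pos_less_divide_eq)
  qed
  have small: "\<bar>t\<bar> * norm x < sqrt a" if "\<bar>t\<bar> < \<tau>" for t
    using \<tau>(2) mult_right_mono[of "\<bar>t\<bar>" \<tau> "norm x"] that by simp
  have "sqrt a < R" using ab real_sqrt_less_iff[of a "R\<^sup>2"] by simp
  then have in_U: "p + t *\<^sub>R x \<in> U" if "\<bar>t\<bar> < \<tau>" for t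
    using ball small[OF that] line_in_M[OF p x(1)] by auto
  have coeff: "taylor_part v m f p n (p + x) = B.taylor_integral n x" for n
  proof -
    have "line_deriv f n x (p + 0 *\<^sub>R x) = fact n *\<^sub>R B.taylor_integral n x"
    proof (rule powser_coeff_eq_deriv[where f = "\<lambda>n t. line_deriv f n x (p + t *\<^sub>R x)"])
      show "(\<lambda>n. t ^ n *\<^sub>R B.taylor_integral n x) sums line_deriv f 0 x (p + t *\<^sub>R x)" if "\<bar>t\<bar> < \<tau>" for t
        using B.taylor_integral_sums[OF x(1) small[OF that]] by (simp add: line_deriv_0)
      show "((\<lambda>t. line_deriv f n x (p + t *\<^sub>R x)) has_vector_derivative line_deriv f (Suc n) x (p + t *\<^sub>R x)) (at t)"
        if "\<bar>t\<bar> < \<tau>" for n t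
        by (rule line_deriv_deriv[OF mono x(1) in_U[OF that]])
    qed (use \<tau> in simp)
    then show ?thesis by (simp add: line_deriv_eq_taylor_part)
  qed
  show "(\<lambda>n. taylor_part v m f p n (p + x)) sums f (p + x)"
    using B.taylor_integral_sums[OF x(1), of 1] x(2) by (simp add: coeff)
  show "norm (taylor_part v m f p n (p + x)) \<le> (mult_bound M)\<^sup>2 * real ((n + m) choose m) * (norm x / sqrt a) ^ n * K"
    if "\<And>y. y \<in> M \<Longrightarrow> a \<le> y \<bullet> y \<Longrightarrow> y \<bullet> y \<le> b \<Longrightarrow> norm (f (p + y)) \<le> K"
    unfolding coeff by (rule B.norm_taylor_integral_le[OF x(1)]) (use that in auto)
qed

lemma compact_M_sphere: "compact {y \<in> M. norm (y - p) = r}"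
proof -
  have "{y \<in> M. norm (y - p) = r} = M \<inter> sphere p r" by (auto simp: dist_norm norm_minus_commute)
  then show ?thesis using closed_M by (simp add: closed_Int_compact)
qed

lemma M_sphere_nonempty:
  assumes "p \<in> M" "0 \<le> r"
  shows "{y \<in> M. norm (y - p) = r} \<noteq> {}"
  using line_in_M[OF assms(1) one_in_M, of r] assms(2) norm_1
  by (intro ex_in_conv[THEN iffD1] exI[of _ "p + r *\<^sub>R 1"]) simp

text \<open>By uniform continuity on a compact ball, values on a thin shell are close to those at
  the radial projections onto the sphere; this replaces the maximum over the shell by that over the
  sphere.\<close>

lemma sphere_max_approx:
  assumes f: "continuous_on U f" and p: "p \<in> M" and ball: "{x \<in> M. norm (x - p) < R} \<subseteq> U"
    and r: "0 < r" "r < R" and e: "0 < e"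
  obtains b where "r\<^sup>2 < b" "b < R\<^sup>2"
    "\<And>y. y \<in> M \<Longrightarrow> r\<^sup>2 \<le> y \<bullet> y \<Longrightarrow> y \<bullet> y \<le> b \<Longrightarrow>
       norm (f (p + y)) \<le> max_on {y \<in> M. norm (y - p) = r} (\<lambda>y. norm (f y)) + e"
proof -
  define r' where "r' = (r + R) / 2"
  have r': "r < r'" "r' < R" using r by (simp_all add: r'_def)
  let ?C = "{y \<in> M. norm (y - p) \<le> r'}"
  have "?C = M \<inter> cball p r'" by (auto simp: dist_norm norm_minus_commute)
  then have "compact ?C" using closed_M by (simp add: closed_Int_compact)
  moreover have C_U: "?C \<subseteq> U" using ball r' by auto
  ultimately have "uniformly_continuous_on ?C f"
    by (intro compact_uniformly_continuous continuous_on_subset[OF f])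
  then obtain d where d: "0 < d" "\<And>y z. y \<in> ?C \<Longrightarrow> z \<in> ?C \<Longrightarrow> dist z y < d \<Longrightarrow> dist (f z) (f y) < e"
    unfolding uniformly_continuous_on_def using e by blast
  \<comment> \<open>The outer radius: below \<open>r + d\<close> for uniform continuity, at most
    \<open>r'\<close> to remain in the compact ball.\<close>
  define s where "s = min r' (r + d / 2)"
  have s: "r < s" "s \<le> r'" "s < r + d" using r' d(1) by (auto simp: s_def)
  show thesis
  proof (rule that[of "s\<^sup>2"])
    show "r\<^sup>2 < s\<^sup>2" "s\<^sup>2 < R\<^sup>2" using r s r' by (auto intro!: power_strict_mono)
    fix y assume y: "y \<in> M" "r\<^sup>2 \<le> y \<bullet> y" "y \<bullet> y \<le> s\<^sup>2"
    have n: "r \<le> norm y" "norm y \<le> s"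
      using y(2,3) r s by (auto simp flip: power2_norm_eq_inner intro: power2_le_imp_le)
    have y0: "0 < norm y" "y \<noteq> 0" using n(1) r(1) by auto
    define z where "z = (r / norm y) *\<^sub>R y"
    have z: "z \<in> M" "norm z = r"
      using y(1) subspace_M y0 r by (simp_all add: z_def subspace_scale)
    have pz: "p + z \<in> {y \<in> M. norm (y - p) = r}" using z add_in_M[OF p z(1)] by simp
    have "y - z = (1 - r / norm y) *\<^sub>R y" by (simp add: z_def scaleR_diff_left)
    also have "norm \<dots> = norm y - r"
      using n r y0 by (simp add: abs_of_nonneg left_diff_distrib)
    finally have "norm (y - z) < d" using n s by simp
    then have "dist (f (p + y)) (f (p + z)) < e"
      using n z s r' add_in_M[OF p] y(1) by (intro d(2)) (auto simp: dist_norm)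
    then have "norm (f (p + y)) < norm (f (p + z)) + e"
      using norm_triangle_ineq2[of "f (p + y)" "f (p + z)"] by (simp add: dist_norm)
    also have "norm (f (p + z)) \<le> max_on {y \<in> M. norm (y - p) = r} (\<lambda>y. norm (f y))"
    proof (rule max_on_attained(2)[OF compact_M_sphere _ _ pz])
      show "continuous_on {y \<in> M. norm (y - p) = r} (\<lambda>y. norm (f y))"
        by (intro continuous_on_norm continuous_on_subset[OF f]) (use C_U r' in force)
    qed (use pz in blast)
    finally show "norm (f (p + y)) \<le> max_on {y \<in> M. norm (y - p) = r} (\<lambda>y. norm (f y)) + e" by simp
  qed
qed

lemma taylor_part_bound:
  assumes mono: "left_monogenic v m U f" and p: "p \<in> M" and ball: "{x \<in> M. norm (x - p) < R} \<subseteq> U"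
    and r: "0 < r1" "r1 < r2" "r2 < R" and x: "x \<in> M" "norm (x - p) \<le> r1"
  shows "norm (taylor_part v m f p n x) \<le> (mult_bound M)\<^sup>2 * real ((n + m) choose m) * (r1 / r2) ^ n *
    max_on {y \<in> M. norm (y - p) = r2} (\<lambda>y. norm (f y))"
proof (rule field_le_epsilon)
  fix e :: real assume e: "0 < e"
  let ?S = "max_on {y \<in> M. norm (y - p) = r2} (\<lambda>y. norm (f y))"
  define C where "C = (mult_bound M)\<^sup>2 * real ((n + m) choose m) * (r1 / r2) ^ n"
  have C: "0 \<le> C" using r by (simp add: C_def)
  \<comment> \<open>The error is multiplied by \<open>C\<close> below; the summand 1 covers
    \<open>C = 0\<close>.\<close>
  define e' where "e' = e / (C + 1)"
  have e': "0 < e'" "C * e' \<le> e" using C e by (simp_all add: e'_def field_simps)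
  have f: "continuous_on U f" by (rule left_monogenic_continuous[OF mono U])
  have r2: "0 < r2" "0 < R" using r by auto
  obtain b where b: "r2\<^sup>2 < b" "b < R\<^sup>2"
    and K: "\<And>y. y \<in> M \<Longrightarrow> r2\<^sup>2 \<le> y \<bullet> y \<Longrightarrow> y \<bullet> y \<le> b \<Longrightarrow> norm (f (p + y)) \<le> ?S + e'"
    using sphere_max_approx[OF f p ball r2(1) r(3) e'(1)] by blast
  have xp: "x - p \<in> M" "norm (x - p) < sqrt (r2\<^sup>2)" using x r diff_in_M[OF x(1) p] by simp_all
  have "norm (taylor_part v m f p n (p + (x - p))) \<le>
      (mult_bound M)\<^sup>2 * real ((n + m) choose m) * (norm (x - p) / sqrt (r2\<^sup>2)) ^ n * (?S + e')"
    by (rule taylor_expansion(2)[OF mono p ball _ b(1) b(2) r2(2) xp K]) (use r2 in auto)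
  also have "\<dots> \<le> C * (?S + e')"
  proof (rule mult_right_mono)
    show "(mult_bound M)\<^sup>2 * real ((n + m) choose m) * (norm (x - p) / sqrt (r2\<^sup>2)) ^ n \<le> C"
      unfolding C_def using r x by (intro mult_left_mono power_mono) (auto intro: divide_right_mono)
    \<comment> \<open>A point of the sphere witnesses that \<open>?S + e'\<close> is
      nonnegative.\<close>
    obtain y where "y \<in> M" "norm (y - p) = r2" using M_sphere_nonempty[OF p, of r2] r2 by auto
    then have "norm (f (p + (y - p))) \<le> ?S + e'"
      using b by (intro K diff_in_M p) (auto simp flip: power2_norm_eq_inner)
    then show "0 \<le> ?S + e'" using norm_ge_zero order_trans by blast
  qed
  also have "\<dots> \<le> C * ?S + e" using e'(2) by (simp add: distrib_left)
  finally show "norm (taylor_part v m f p n x) \<le> C * ?S + e" by simp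
qed

lemma continuous_fueter_poly:
  "k \<in> multi_indices m n \<Longrightarrow> continuous_on M (fueter_poly v m (\<lambda>s. int (k s)))"
proof (induction n arbitrary: k)
  case 0
  then show ?case
    by (simp add: multi_indices_0 fueter_poly_0 flip: o_def) 
next
  case (Suc n)
  have z: "continuous_on M (fueter_var v m s)" if "s \<in> {1..m}" for s
    by (rule continuous_on_eq[where f = "\<lambda>x. (x \<bullet> v s) *\<^sub>R 1 - (x \<bullet> 1) *\<^sub>R v s"])
       (use that in \<open>auto simp: fueter_var_eq intro!: continuous_intros\<close>)
  have "continuous_on M (\<lambda>x. inverse (real (Suc n)) *\<^sub>R (\<Sum>s=1..m. real (k s) *\<^sub>R
      (fueter_poly v m (\<lambda>i. int ((k(s := k s - 1)) i)) x * fueter_var v m s x)))"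
  proof (rule continuous_on_scaleR[OF continuous_on_const continuous_on_sum])
    fix s assume s: "s \<in> {1..m}"
    show "continuous_on M (\<lambda>x. real (k s) *\<^sub>R (fueter_poly v m (\<lambda>i. int ((k(s := k s - 1)) i)) x * fueter_var v m s x))"
    proof (cases "k s = 0")
      case False
      then have "continuous_on M (fueter_poly v m (\<lambda>i. int ((k(s := k s - 1)) i)))"
        using Suc s by (intro Suc.IH multi_indices_pred) auto
      then show ?thesis by (intro continuous_intros continuous_on_times z s)
    qed simp
  qed
  moreover have "inverse (real (Suc n)) *\<^sub>R (\<Sum>s=1..m. real (k s) *\<^sub>R
      (fueter_poly v m (\<lambda>i. int ((k(s := k s - 1)) i)) x * fueter_var v m s x)) = fueter_poly v m (\<lambda>s. int (k s)) x" for x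
    unfolding fueter_poly_Suc[OF Suc.prems, symmetric] by (simp del: of_nat_Suc)
  ultimately show ?case by simp
qed

lemma continuous_taylor_part:
  assumes "p \<in> M" "S \<subseteq> M"
  shows "continuous_on S (taylor_part v m f p n)"
  unfolding taylor_part_def
  by (intro continuous_on_sum continuous_on_times continuous_on_const
      continuous_on_compose2[OF continuous_fueter_poly, of _ n] continuous_intros)
     (use assms diff_in_M in auto)

lemma converges_normally_taylor:
  assumes mono: "left_monogenic v m U f" and p: "p \<in> M" and R: "0 < R"
    and ball: "{x \<in> M. norm (x - p) < R} \<subseteq> U"
  shows "converges_normally (taylor_part v m f p) {x \<in> M. norm (x - p) < R}"
  unfolding converges_normally_def
proof (intro conjI allI impI)
  show "continuous_on {x \<in> M. norm (x - p) < R} (taylor_part v m f p n)" for n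
    by (rule continuous_taylor_part[OF p]) auto
  fix C assume C: "compact C \<and> C \<noteq> {} \<and> C \<subseteq> {x \<in> M. norm (x - p) < R}"
  have "continuous_on C (\<lambda>x. norm (x - p))" by (intro continuous_intros)
  then obtain x0 where x0: "x0 \<in> C" "\<And>x. x \<in> C \<Longrightarrow> norm (x - p) \<le> norm (x0 - p)"
    using continuous_attains_sup[of C "\<lambda>x. norm (x - p)"] C by blast
  \<comment> \<open>Averaging with \<open>R\<close> keeps the radii below \<open>R\<close> and makes
    \<open>r1\<close> positive even when \<open>C\<close> is the single point
    \<open>p\<close>.\<close>
  define r1 where "r1 = (norm (x0 - p) + R) / 2"
  define r2 where "r2 = (r1 + R) / 2"
  have "norm (x0 - p) < R" using x0 C by auto
  then have r: "0 < r1" "r1 < r2" "r2 < R" "norm (x0 - p) \<le> r1"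
    using R by (auto simp: r1_def r2_def add_nonneg_pos)
  let ?K = "(mult_bound M)\<^sup>2 * max_on {y \<in> M. norm (y - p) = r2} (\<lambda>y. norm (f y))"
  show "summable (\<lambda>n. max_on C (\<lambda>x. norm (taylor_part v m f p n x)))"
  proof (rule summable_comparison_test')
    show "summable (\<lambda>n. real ((n + m) choose m) * (r1 / r2) ^ n * ?K)"
      by (intro summable_mult2 choose_power_summable) (use r in auto)
    fix n
    have "max_on C (\<lambda>x. norm (taylor_part v m f p n x)) \<in> (\<lambda>x. norm (taylor_part v m f p n x)) ` C"
      using C by (intro max_on_attained(1) continuous_on_norm continuous_taylor_part p) auto
    then obtain x where x: "x \<in> C" "max_on C (\<lambda>x. norm (taylor_part v m f p n x)) = norm (taylor_part v m f p n x)"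
      by blast
    have "x \<in> M" "norm (x - p) \<le> r1" using x(1) C x0(2)[OF x(1)] r(4) by auto
    from taylor_part_bound[OF mono p ball r(1-3) this, of n]
    show "norm (max_on C (\<lambda>x. norm (taylor_part v m f p n x))) \<le> real ((n + m) choose m) * (r1 / r2) ^ n * ?K"
      by (simp add: x(2) mult_ac)
  qed
qed

end

text \<open>For an imaginary unit the vanishing trace gives \<open>c (v s) = - v s\<close>,
  whereupon norm 1 reads \<open>v s * v s = - 1\<close>.\<close>

lemma hypercomplex_basis_frame:
  fixes c :: "'a::{real_algebra_1, euclidean_space} \<Rightarrow> 'a"
  assumes basis: "hypercomplex_basis c M v m" and "m \<le> d" and ortho: "orthonormal_family v d"
  shows "hypercomplex_frame M v m"
proof
  show "v s * v s = - 1" if "s \<in> {1..m}" for s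
  proof -
    have "v s + c (v s) = 0" "v s * c (v s) = 1"
      using basis that by (auto simp: hypercomplex_basis_def imag_units_def)
    then have "v s * (- v s) = 1" by (metis eq_neg_iff_add_eq_0 add.commute)
    then show ?thesis by (simp add: equation_minus_iff)
  qed
  show "v i \<bullet> v j = (if i = j then 1 else 0)" if "i \<le> m" "j \<le> m" for i j
    using ortho that \<open>m \<le> d\<close> by (simp add: orthonormal_family_def)
  show "v s * v u = - (v u * v s)" if "s \<in> {1..m}" "u \<in> {1..m}" "s \<noteq> u" for s u
    using basis that unfolding hypercomplex_basis_def by blast
  show "1 \<le> m" "v 0 = 1" "span (v ` {0..m}) = M"
    using basis unfolding hypercomplex_basis_def ordered_basis_def by blast+
qed

theorem theorem3p22:
  fixes c :: "'a::{real_algebra_1, euclidean_space} \<Rightarrow> 'a"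
    and M G :: "'a set"
    and v :: "nat \<Rightarrow> 'a"
    and m d :: nat
    and \<phi> :: "'a \<Rightarrow> 'a"
    and p :: 'a
    and R :: real
  assumes "star_involution c"
    and "imag_units c \<noteq> {}"
    and "hypercomplex_subspace c M"
    and "hypercomplex_basis c M v m"
    and "m \<le> d" and "ordered_basis v d UNIV" and "orthonormal_family v d"
    and "G \<noteq> {}" and "connected G" and "openin (top_of_set M) G"
    and "left_monogenic v m G \<phi>"
    and "p \<in> M" and "R > 0" and "{x \<in> M. norm (x - p) < R} \<subseteq> G"
  shows "(\<forall>x\<in>M. norm (x - p) < R \<longrightarrow> (\<lambda>k. taylor_part v m \<phi> p k x) sums \<phi> x)
    \<and> converges_normally (taylor_part v m \<phi> p) {x \<in> M. norm (x - p) < R}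
    \<and> (\<forall>k r1 r2. 0 < r1 \<and> r1 < r2 \<and> r2 < R \<longrightarrow>
         max_on {x \<in> M. norm (x - p) \<le> r1} (\<lambda>x. norm (taylor_part v m \<phi> p k x))
         \<le> (mult_bound M)\<^sup>2 * sqrt 2 * real ((k + m) choose m) * (r1 / r2) ^ k
            * max_on {y \<in> M. norm (y - p) = r2} (\<lambda>y. norm (\<phi> y)))"
proof -
  note p = assms(12) and R = assms(13) and ball = assms(14) and mono = assms(11)
  interpret hypercomplex_frame M v m
    by (rule hypercomplex_basis_frame[OF assms(4,5,7)])
  interpret frame_open_set M v m G
    by unfold_locales (rule assms(10))
  have "(\<lambda>k. taylor_part v m \<phi> p k x) sums \<phi> x" if x: "x \<in> M" "norm (x - p) < R" for x
  proof -
    \<comment> \<open>Any such \<open>r\<close> serves as inner radius of a shell inside the ball;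
      the Taylor parts do not depend on it.\<close>
    obtain r where r: "norm (x - p) < r" "r < R" using dense x(2) by blast
    then have r0: "0 < r" using norm_ge_zero le_less_trans by blast
    then have "r\<^sup>2 < R\<^sup>2" using r by (intro power_strict_mono) auto
    then obtain b where b: "r\<^sup>2 < b" "b < R\<^sup>2" using dense by blast
    have "(\<lambda>k. taylor_part v m \<phi> p k (p + (x - p))) sums \<phi> (p + (x - p))"
      by (rule taylor_expansion(1)[OF mono p ball _ b R diff_in_M[OF x(1) p]]) (use r0 r in auto)
    then show ?thesis by simp
  qed
  moreover have "max_on {x \<in> M. norm (x - p) \<le> r1} (\<lambda>x. norm (taylor_part v m \<phi> p k x))
         \<le> (mult_bound M)\<^sup>2 * sqrt 2 * real ((k + m) choose m) * (r1 / r2) ^ k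
            * max_on {y \<in> M. norm (y - p) = r2} (\<lambda>y. norm (\<phi> y))"
    if r: "0 < r1" "r1 < r2" "r2 < R" for k r1 r2
  proof -
    let ?C = "{x \<in> M. norm (x - p) \<le> r1}" and ?T = "\<lambda>x. norm (taylor_part v m \<phi> p k x)"
    let ?B = "(mult_bound M)\<^sup>2 * real ((k + m) choose m) * (r1 / r2) ^ k * max_on {y \<in> M. norm (y - p) = r2} (\<lambda>y. norm (\<phi> y))"
    have "?C = M \<inter> cball p r1" by (auto simp: dist_norm norm_minus_commute)
    then have "compact ?C" using closed_M by (simp add: closed_Int_compact)
    moreover have "?C \<noteq> {}" using p r by (intro ex_in_conv[THEN iffD1] exI[of _ p]) simp
    ultimately have "max_on ?C ?T \<in> ?T ` ?C"
      by (intro max_on_attained(1) continuous_on_norm continuous_taylor_part p) auto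
    then obtain x where x: "x \<in> M" "norm (x - p) \<le> r1" "max_on ?C ?T = ?T x" by blast
    have le: "?T x \<le> ?B" by (rule taylor_part_bound[OF mono p ball r x(1,2)])
    then have "0 \<le> ?B" by (rule order_trans[OF norm_ge_zero])
    \<comment> \<open>The bound obtained so far is nonnegative, so a factor of at least 1 may be
      inserted to reach the stated form.\<close>
    then have "?B \<le> sqrt 2 * ?B"
      using mult_right_mono[of 1 "sqrt 2" ?B] by simp
    with le show ?thesis unfolding x(3) by (simp add: mult_ac)
  qed
  ultimately show ?thesis
    using converges_normally_taylor[OF mono p R ball] by blast
qed

end
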